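(* Let $d\ge 2$, $N\ge 2$ be integers and let $p_c(N,d)\le p<1$. Let $\mathcal C$ be the limiting set of Mandelbrot's fractal percolation in $[0,1]^d$ with parameters $N,p$, and let $\mathcal C^c$ and $\mathcal C^d$ be its connected part and its dust part. Then: (i) $\mathbb P_p$-almost surely, the box counting dimensions $\dim_B(\mathcal C^c)$ and $\dim_B(\mathcal C)$ exist and $$\dim_B(\mathcal C^c)=\dim_B(\mathcal C)=\dim_{\mathcal H}(\mathcal C).$$ (ii) $\mathbb P_p$-almost surely, if $\mathcal C\neq\emptyset$ then $$\dim_{\mathcal H}(\mathcal C^c)<\dim_{\mathcal H}(\mathcal C)$$ and $$\dim_{\mathcal H}(\mathcal C^d)=\dim_{\mathcal H}(\mathcal C).$$
   Context: Fractal percolation. For integers $d\ge2$, $N\ge 2$, a level-$n$ cube ($n\ge1$) is a cube $D^n_{\mathbf k}=\prod_{j=1}^d\left[\frac{k_j-1}{N^n},\frac{k_j}{N^n}\right]$ with $\mathbf k=(k_1,\dots,k_d)\in\{1,\dots,N^n\}^d$. Let $D$ be the set of all cubes of all levels $n\ge1$, $\Omega=\{0,1\}^D$, and let $\mathbb P_p$ be the product measure on $\Omega$ under which $\omega(D^n_{\mathbf k})=1$ with probability $p\in[0,1]$, independently for all cubes. Let $\mathcal C^n\subset[0,1]^d$ be the union of all level-$n$ cubes $Q$ such that $\omega=1$ for $Q$ and for each of the cubes of levels $1,\dots,n-1$ containing $Q$; the limiting set is $\mathcal C=\bigcap_{n\ge1}\mathcal C^n$. For $x\in\mathcal C$ let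 $\mathcal C_x$ be the connected component of $x$ in $\mathcal C$. Put $\mathcal C^d=\{x\in\mathcal C:\mathcal C_x=\{x\}\}$ (the superscript $d$ stands for "dust", not the dimension) and $\mathcal C^c=\mathcal C\setminus\mathcal C^d$. Critical value: $p_c(N,d)=\sup\{p:\mathcal C\text{ is }\mathbb P_p\text{-a.s. totally disconnected}\}$. Dimensions: $\dim_{\mathcal H}$ is Hausdorff dimension. For a bounded set $F\subset\mathbb R^d$, $M_\delta(F)$ is the minimal number of closed cubes of side length $\delta$ needed to cover $F$; $\underline{\dim}_B(F)=\liminf_{\delta\to0}\frac{\log M_\delta(F)}{-\log\delta}$, $\overline{\dim}_B(F)=\limsup_{\delta\to0}\frac{\log M_\delta(F)}{-\log\delta}$, and if they coincide the common value is $\dim_B(F)$. All dimensions of the empty set are taken to be $0$. *)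

theory Defs
  imports "HOL-Probability.Probability"
begin

(* The convention is diam(U)^0 = 1 for nonempty U and 0 for empty U. The case distinction is needed
   because 0 powr 0 = 0 in HOL: points must have mass 1 for s = 0. *)
definition diam_gauge :: "real \<Rightarrow> 'a::metric_space set \<Rightarrow> ennreal" where
  "diam_gauge s U =
    (if U = {} then 0 else if s = 0 then 1 else ennreal (diameter U powr s))"

(* Boundedness is required explicitly since diameter is unspecified on unbounded sets. Finite covers
   are included, because cover members may be empty. *)
definition hausdorff_premeasure :: "real \<Rightarrow> real \<Rightarrow> 'a::metric_space set \<Rightarrow> ennreal" where
  "hausdorff_premeasure s \<delta> F =
    (INF U \<in> {U :: nat \<Rightarrow> 'a set. F \<subseteq> (\<Union>i. U i) \<and> (\<forall>i. bounded (U i) \<and> diameter (U i) \<le> \<delta>)}.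
      (\<Sum>i. diam_gauge s (U i)))"

definition hausdorff_measure :: "real \<Rightarrow> 'a::metric_space set \<Rightarrow> ennreal" where
  "hausdorff_measure s F = (SUP \<delta> \<in> {0<..}. hausdorff_premeasure s \<delta> F)"

definition hausdorff_dim :: "'a::metric_space set \<Rightarrow> ereal" where
  "hausdorff_dim F = (INF s \<in> {s. 0 \<le> s \<and> hausdorff_measure s F = 0}. ereal s)"

(* M_\<delta>(F); intended for bounded F, so that finite covers exist. *)
definition cube_cover_number :: "real \<Rightarrow> 'a::euclidean_space set \<Rightarrow> nat" where
  "cube_cover_number \<delta> F =
    (LEAST m. \<exists>A. finite A \<and> card A = m \<and> F \<subseteq> (\<Union>a\<in>A. cbox a (a + \<delta> *\<^sub>R One)))"

definition lower_box_dim :: "'a::euclidean_space set \<Rightarrow> ereal" where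
  "lower_box_dim F = (if F = {} then 0
    else Liminf (at_right 0) (\<lambda>\<delta>. ereal (ln (real (cube_cover_number \<delta> F)) / - ln \<delta>)))"

definition upper_box_dim :: "'a::euclidean_space set \<Rightarrow> ereal" where
  "upper_box_dim F = (if F = {} then 0
    else Limsup (at_right 0) (\<lambda>\<delta>. ereal (ln (real (cube_cover_number \<delta> F)) / - ln \<delta>)))"

definition box_dim_exists :: "'a::euclidean_space set \<Rightarrow> bool" where
  "box_dim_exists F \<longleftrightarrow> lower_box_dim F = upper_box_dim F"

(* Only meaningful under box_dim_exists F; otherwise unspecified. *)
definition box_dim :: "'a::euclidean_space set \<Rightarrow> ereal" where
  "box_dim F = (THE D. lower_box_dim F = D \<and> upper_box_dim F = D)"

definition level_cube :: "nat \<Rightarrow> nat \<Rightarrow> ('d::finite \<Rightarrow> nat) \<Rightarrow> (real^'d) set" where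
  "level_cube N n k =
    cbox (\<chi> j. (real (k j) - 1) / real N ^ n) (\<chi> j. real (k j) / real N ^ n)"

definition level_cubes :: "nat \<Rightarrow> nat \<Rightarrow> (real^'d::finite) set set" where
  "level_cubes N n = {level_cube N n k | k. \<forall>j. k j \<in> {1..N ^ n}}"

definition all_cubes :: "nat \<Rightarrow> (real^'d::finite) set set" where
  "all_cubes N = (\<Union>n\<in>{1..}. level_cubes N n)"

(* A configuration maps cubes to bool instead of {0,1}. bernoulli_pmf p is Bernoulli(p) only
   for p in [0,1]. *)
definition percolation_measure :: "nat \<Rightarrow> real \<Rightarrow> ((real^'d::finite) set \<Rightarrow> bool) measure" where
  "percolation_measure N p = PiM (all_cubes N) (\<lambda>_. measure_pmf (bernoulli_pmf p))"

definition retained_level ::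
    "nat \<Rightarrow> ((real^'d::finite) set \<Rightarrow> bool) \<Rightarrow> nat \<Rightarrow> (real^'d) set" where
  "retained_level N \<omega> n =
    \<Union>{Q \<in> level_cubes N n. \<omega> Q \<and> (\<forall>m\<in>{1..<n}. \<forall>R\<in>level_cubes N m. Q \<subseteq> R \<longrightarrow> \<omega> R)}"

definition limit_set :: "nat \<Rightarrow> ((real^'d::finite) set \<Rightarrow> bool) \<Rightarrow> (real^'d) set" where
  "limit_set N \<omega> = (\<Inter>n\<in>{1..}. retained_level N \<omega> n)"

definition dust_part :: "'a::topological_space set \<Rightarrow> 'a set" where
  "dust_part C = {x \<in> C. connected_component_set C x = {x}}"

definition connected_part :: "'a::topological_space set \<Rightarrow> 'a set" where
  "connected_part C = C - dust_part C"

definition totally_disconnected :: "'a::topological_space set \<Rightarrow> bool" where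
  "totally_disconnected C \<longleftrightarrow> (\<forall>x\<in>C. connected_component_set C x = {x})"

(* The dimension is CARD('d), passed through the type argument. *)
definition critical_p :: "nat \<Rightarrow> 'd::finite itself \<Rightarrow> real" where
  "critical_p N _ = Sup {p \<in> {0..1}.
     AE \<omega> in (percolation_measure N p :: ((real^'d) set \<Rightarrow> bool) measure).
       totally_disconnected (limit_set N \<omega>)}"

end

theory Submission
  imports Defs
begin

text \<open>
  The tree of subcubes is embedded in a Bernoulli field indexed by all lattice cubes, which makes it
  translation invariant and lets neighbouring cubes be treated alike.  A property inherited from the
  retained subcubes has probability \<open>0\<close> or that of survival, because its failure
  probability and the extinction probability solve the same branching equation, whose root below
  \<open>1\<close> is unique.

  Counting retained cubes bounds the upper box dimension of the limit set by \<open>log\<^sub>N (p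
  N^d)\<close>.  For the lower bound, an independent further percolation with parameter \<open>q > 1
  / (p N^d)\<close> survives with positive conditional probability, whereas a null cover in
  dimension \<open>- log\<^sub>N q\<close> would force its extinction.

  The set of parameters at which the limit set is almost surely totally disconnected is open from
  the right: if crossings of a cube and its neighbours are unlikely at one scale, then a crossing a
  fixed number of levels deeper requires two independent crossings, so crossing probabilities decay
  by a quadratic recursion, and the starting condition depends on finitely many cubes, hence
  continuously on \<open>p\<close>.  Thus nontrivial components occur at \<open>p\<^sub>c\<close>
  already.  By the zero-one law they then occur in every surviving cube, so the connected part is
  dense and has the same covering numbers as the limit set.

  A component of diameter of order \<open>N^-n\<close> avoids all deeper cubes shielded by a layer
  of closed cubes.  Shielding has positive probability at each scale, so the unshielded cubes form a
  branching process of strictly smaller mean, which lowers the Hausdorff dimension of the connected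
  part.
\<close>

section \<open>Bernoulli fields\<close>

text \<open>Dimensions and total disconnectedness of a random set are not obviously measurable
  functions of the configuration. Probabilities are therefore computed only for events such as
  \<open>survives\<close>, \<open>phi_pos\<close> and \<open>nontriv\<close>, which are built by
  countable operations from events on finitely many cubes; the geometric conclusions are drawn from
  them pointwise. Independence becomes bookkeeping of index sets: \<open>dep J f\<close> records
  which cubes \<open>f\<close> reads, and disjoint sets \<open>J\<close> give product formulas.

  The fixed numbers of levels come from admitting N = 2. Two levels are then the least that leave a
  subcube away from the boundary of its parent, hence \<open>L 2 \<ge> 4\<close> in the shielding
  layer and in the block that turns a crossing into a component. Three levels give the factor 8 that
  makes room for two local crossings whose parent cubes differ by at least 3 in some coordinate; the
  blocks of neighbours of two such parents have no cube in common.\<close>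

definition dep :: "'i set \<Rightarrow> (('i \<Rightarrow> bool) \<Rightarrow> 'c) \<Rightarrow> bool" where
  "dep J f \<longleftrightarrow> (\<forall>\<omega> \<omega>'. (\<forall>x\<in>J. \<omega> x = \<omega>' x) \<longrightarrow> f \<omega> = f \<omega>')"

lemma depI: "(\<And>\<omega> \<omega>'. (\<And>x. x \<in> J \<Longrightarrow> \<omega> x = \<omega>' x) \<Longrightarrow> f \<omega> = f \<omega>') \<Longrightarrow> dep J f"
  unfolding dep_def by blast

lemma depD: "dep J f \<Longrightarrow> (\<And>x. x \<in> J \<Longrightarrow> \<omega> x = \<omega>' x) \<Longrightarrow> f \<omega> = f \<omega>'"
  unfolding dep_def by blast

lemma dep_mono: "dep J f \<Longrightarrow> J \<subseteq> J' \<Longrightarrow> dep J' f"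
  unfolding dep_def by blast

lemma dep_compose: "dep J f \<Longrightarrow> dep J (\<lambda>\<omega>. g (f \<omega>))"
  unfolding dep_def by metis

lemma dep_indicator: "dep J P \<Longrightarrow> dep J (indicat_real {\<omega>. P \<omega>})"
  using dep_compose[of J P "of_bool"] by (simp add: indicator_def[abs_def])

text \<open>With the whole type as index set the space is \<open>UNIV\<close>, and every injection
  of indices acts on configurations by composition.\<close>

definition bernoulli_field :: "'i itself \<Rightarrow> real \<Rightarrow> ('i \<Rightarrow> bool) measure" where
  "bernoulli_field _ p = PiM UNIV (\<lambda>_. measure_pmf (bernoulli_pmf p))"

abbreviation BF :: "real \<Rightarrow> ('i \<Rightarrow> bool) measure" where
  "BF p \<equiv> bernoulli_field TYPE('i) p"

lemma prob_space_BF: "prob_space (BF p)"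
  unfolding bernoulli_field_def by (intro prob_space_PiM measure_pmf.prob_space_axioms)

lemma space_BF [simp]: "space (BF p) = UNIV"
  unfolding bernoulli_field_def by (simp add: space_PiM)

lemma measurable_coordinate [measurable]: "(\<lambda>\<omega>. \<omega> x) \<in> measurable (BF p) (count_space UNIV)"
  unfolding bernoulli_field_def
  by (rule measurable_compose[OF measurable_component_singleton]) auto

text \<open>A function that reads only \<open>J\<close> takes the same value at the restriction of
  its argument to \<open>J\<close>. Every preimage is thus a union of finitely many cylinders, one
  for each admissible pattern on \<open>J\<close>.\<close>

lemma dep_finite_measurable:
  fixes f :: "('i \<Rightarrow> bool) \<Rightarrow> 'c"
  assumes "dep J f" "finite J"
  shows "f \<in> measurable (BF p) (count_space UNIV)"
proof -
  define F where "F = (\<lambda>g::'i\<Rightarrow>bool. {\<omega>. \<forall>x\<in>J. \<omega> x = g x})"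
  have F_sets: "F g \<in> sets (BF p)" for g
  proof -
    have "{\<omega> \<in> space (BF p). \<forall>x\<in>J. \<omega> x = g x} \<in> sets (BF p)"
      using assms(2) by measurable
    then show ?thesis by (simp add: F_def)
  qed
  have "f -` A \<in> sets (BF p)" for A
  proof -
    have "f -` A = (\<Union>g\<in>{g \<in> PiE J (\<lambda>_. UNIV). f g \<in> A}. F g)"
    proof (intro set_eqI iffI)
      fix \<omega> assume "\<omega> \<in> f -` A"
      moreover have "f \<omega> = f (restrict \<omega> J)"
        by (rule depD[OF assms(1)]) simp
      ultimately have "restrict \<omega> J \<in> {g \<in> PiE J (\<lambda>_. UNIV). f g \<in> A}" "\<omega> \<in> F (restrict \<omega> J)"
        by (auto simp: F_def)
      then show "\<omega> \<in> (\<Union>g\<in>{g \<in> PiE J (\<lambda>_. UNIV). f g \<in> A}. F g)" by blast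
    next
      fix \<omega> assume "\<omega> \<in> (\<Union>g\<in>{g \<in> PiE J (\<lambda>_. UNIV). f g \<in> A}. F g)"
      then obtain g where "f g \<in> A" "\<forall>x\<in>J. \<omega> x = g x" by (auto simp: F_def)
      then show "\<omega> \<in> f -` A" using depD[OF assms(1), of \<omega> g] by auto
    qed
    also have "\<dots> \<in> sets (BF p)"
      using F_sets finite_PiE[OF assms(2), of "\<lambda>_. UNIV :: bool set"]
      by (intro sets.finite_UN) auto
    finally show ?thesis .
  qed
  then show ?thesis by (intro measurableI) auto
qed

lemma dep_finite_sets:
  assumes "dep J (\<lambda>\<omega>. P \<omega>)" "finite J"
  shows "{\<omega>. P \<omega>} \<in> sets (BF p)"
  using measurable_sets[OF dep_finite_measurable[OF assms, of p], of "{True}"]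
  by (simp add: vimage_def)

lemma dep_finite_borel:
  assumes "dep J f" "finite J"
  shows "f \<in> borel_measurable (BF p)"
  using dep_finite_measurable[OF assms, of p] by (auto simp: measurable_def)

lemma indep_coordinates:
  fixes p :: real
  shows "prob_space.indep_vars (BF p :: ('i \<Rightarrow> bool) measure)
    (\<lambda>_. measure_pmf (bernoulli_pmf p)) (\<lambda>x \<omega>. \<omega> x) UNIV"
proof -
  interpret prob_space "BF p :: ('i \<Rightarrow> bool) measure" by (rule prob_space_BF)
  interpret P: product_prob_space "\<lambda>_::'i. measure_pmf (bernoulli_pmf p)" UNIV
    by unfold_locales
  have rv: "random_variable (measure_pmf (bernoulli_pmf p)) (\<lambda>\<omega>. \<omega> x)" for x :: 'i
    unfolding bernoulli_field_def by (rule measurable_component_singleton) simp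
  have d: "distr (BF p) (measure_pmf (bernoulli_pmf p)) (\<lambda>\<omega>. \<omega> x) = measure_pmf (bernoulli_pmf p)" for x :: 'i
    unfolding bernoulli_field_def by (rule P.PiM_component) simp
  show ?thesis
  proof (subst indep_vars_iff_distr_eq_PiM)
    have "distr (BF p :: ('i \<Rightarrow> bool) measure) (Pi\<^sub>M UNIV (\<lambda>i. measure_pmf (bernoulli_pmf p))) (\<lambda>x. x) = BF p"
      by (rule distr_id2) (simp add: bernoulli_field_def)
    also have "\<dots> = Pi\<^sub>M UNIV (\<lambda>i. distr (BF p) (measure_pmf (bernoulli_pmf p)) (\<lambda>\<omega>. \<omega> i))"
      unfolding bernoulli_field_def by (intro PiM_cong refl d[unfolded bernoulli_field_def, symmetric])
    finally show "distr (BF p :: ('i \<Rightarrow> bool) measure) (Pi\<^sub>M UNIV (\<lambda>i. measure_pmf (bernoulli_pmf p))) (\<lambda>x. \<lambda>i\<in>UNIV. x i) =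
      Pi\<^sub>M UNIV (\<lambda>i. distr (BF p) (measure_pmf (bernoulli_pmf p)) (\<lambda>\<omega>. \<omega> i))"
      unfolding restrict_UNIV .
  qed (use rv in auto)
qed

text \<open>Coordinates outside \<open>J\<close> are filled with \<open>False\<close>, which a
  function depending only on \<open>J\<close> cannot notice. The library's independence of
  restrictions to disjoint blocks is carried over in this way to functions of the full
  configuration.\<close>

lemma measurable_extend:
  "(\<lambda>\<rho> x. x \<in> J \<and> \<rho> x) \<in> measurable (PiM J (\<lambda>_. measure_pmf (bernoulli_pmf p))) (BF p)"
  unfolding bernoulli_field_def
proof (rule measurable_PiM_single')
  show "(\<lambda>\<rho>. x \<in> J \<and> \<rho> x) \<in>
      measurable (PiM J (\<lambda>_. measure_pmf (bernoulli_pmf p))) (measure_pmf (bernoulli_pmf p))" for x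
  proof (cases "x \<in> J")
    case True
    then show ?thesis using measurable_component_singleton[OF True, of "\<lambda>_. measure_pmf (bernoulli_pmf p)"]
      by simp
  qed simp
qed auto

lemma indep_vars_dep:
  fixes f :: "'k \<Rightarrow> ('i \<Rightarrow> bool) \<Rightarrow> 'c"
  assumes "\<And>k. k \<in> K \<Longrightarrow> f k \<in> measurable (BF p) S"
    and "\<And>k. k \<in> K \<Longrightarrow> dep (J k) (f k)" "disjoint_family_on J K"
  shows "prob_space.indep_vars (BF p) (\<lambda>_. S) f K"
proof -
  interpret prob_space "BF p :: ('i \<Rightarrow> bool) measure" by (rule prob_space_BF)
  let ?B = "\<lambda>_::'i. measure_pmf (bernoulli_pmf p)"
  have "indep_vars (\<lambda>k. PiM (J k) ?B) (\<lambda>k \<omega>. restrict (\<lambda>i. \<omega> i) (J k)) K"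
    by (rule indep_vars_restrict[OF indep_coordinates]) (use assms in auto)
  then have "indep_vars (\<lambda>_. S) (\<lambda>k \<omega>. (\<lambda>\<rho>. f k (\<lambda>x. x \<in> J k \<and> \<rho> x)) (restrict (\<lambda>i. \<omega> i) (J k))) K"
    by (rule indep_vars_compose2) (rule measurable_compose[OF measurable_extend assms(1)])
  moreover have "f k (\<lambda>x. x \<in> J k \<and> restrict (\<lambda>i. \<omega> i) (J k) x) = f k \<omega>" if "k \<in> K" for k \<omega>
    by (rule depD[OF assms(2)[OF that]]) auto
  ultimately show ?thesis
    by (subst indep_vars_cong[OF refl _ refl, of _ _ "\<lambda>k \<omega>. f k (\<lambda>x. x \<in> J k \<and> restrict (\<lambda>i. \<omega> i) (J k) x)"]) auto
qed

lemma expectation_prod_dep: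
  fixes f :: "'k \<Rightarrow> ('i \<Rightarrow> bool) \<Rightarrow> real"
  assumes "finite K" "\<And>k. k \<in> K \<Longrightarrow> f k \<in> borel_measurable (BF p)"
    and "\<And>k \<omega>. k \<in> K \<Longrightarrow> \<bar>f k \<omega>\<bar> \<le> B"
    and "\<And>k. k \<in> K \<Longrightarrow> dep (J k) (f k)" "disjoint_family_on J K"
  shows "(\<integral>\<omega>. (\<Prod>k\<in>K. f k \<omega>) \<partial>BF p) = (\<Prod>k\<in>K. \<integral>\<omega>. f k \<omega> \<partial>BF p)"
proof -
  interpret prob_space "BF p :: ('i \<Rightarrow> bool) measure" by (rule prob_space_BF)
  show ?thesis
    by (rule indep_vars_lebesgue_integral[OF assms(1) indep_vars_dep[OF assms(2,4,5)]])
       (use assms in \<open>auto intro!: integrable_const_bound[where B=B] AE_I2\<close>)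
qed

lemma prob_INT_dep:
  fixes E :: "'k \<Rightarrow> ('i \<Rightarrow> bool) \<Rightarrow> bool"
  assumes "finite K" "\<And>k. k \<in> K \<Longrightarrow> {\<omega>. E k \<omega>} \<in> sets (BF p)"
    and "\<And>k. k \<in> K \<Longrightarrow> dep (J k) (E k)" "disjoint_family_on J K"
  shows "measure (BF p) {\<omega>. \<forall>k\<in>K. E k \<omega>} = (\<Prod>k\<in>K. measure (BF p) {\<omega>. E k \<omega>})"
proof -
  interpret prob_space "BF p :: ('i \<Rightarrow> bool) measure" by (rule prob_space_BF)
  have "(\<integral>\<omega>. (\<Prod>k\<in>K. indicat_real {\<omega>. E k \<omega>} \<omega>) \<partial>BF p) = (\<Prod>k\<in>K. \<integral>\<omega>. indicat_real {\<omega>. E k \<omega>} \<omega> \<partial>BF p)"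
    by (rule expectation_prod_dep[where B=1 and J=J])
       (use assms(1,2,4) in \<open>auto split: split_indicator intro: dep_indicator[OF assms(3)]\<close>)
  moreover have "(\<Prod>k\<in>K. indicat_real {\<omega>. E k \<omega>} \<omega>) = indicat_real {\<omega>. \<forall>k\<in>K. E k \<omega>} \<omega>" for \<omega>
    using assms(1) by (auto simp: indicator_def prod_zero_iff)
  moreover have "{\<omega>. \<forall>k\<in>K. E k \<omega>} \<in> sets (BF p)"
  proof -
    have "{\<omega>. \<forall>k\<in>K. E k \<omega>} = space (BF p) \<inter> (\<Inter>k\<in>K. {\<omega>. E k \<omega>})" by auto
    also have "\<dots> \<in> sets (BF p)"
      using assms sets.top[of "BF p :: ('i \<Rightarrow> bool) measure"]
      by (cases "K = {}") (auto intro!: sets.Int sets.finite_INT)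
    finally show ?thesis .
  qed
  ultimately show ?thesis using assms by simp
qed

lemma prob_conj_dep:
  fixes P Q :: "('i \<Rightarrow> bool) \<Rightarrow> bool"
  assumes "{\<omega>. P \<omega>} \<in> sets (BF p)" "{\<omega>. Q \<omega>} \<in> sets (BF p)"
    and "dep J P" "dep J' Q" "J \<inter> J' = {}"
  shows "measure (BF p) {\<omega>. P \<omega> \<and> Q \<omega>} = measure (BF p) {\<omega>. P \<omega>} * measure (BF p) {\<omega>. Q \<omega>}"
proof -
  have "measure (BF p) {\<omega>. \<forall>b\<in>UNIV. (if b then P else Q) \<omega>} =
      (\<Prod>b\<in>UNIV. measure (BF p) {\<omega>. (if b then P else Q) \<omega>})"
    by (rule prob_INT_dep[where J="\<lambda>b. if b then J else J'"])
       (use assms in \<open>auto simp: disjoint_family_on_def\<close>)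
  moreover have "{\<omega>. \<forall>b\<in>UNIV. (if b then P else Q) \<omega>} = {\<omega>. P \<omega> \<and> Q \<omega>}"
    by (auto simp: UNIV_bool)
  ultimately show ?thesis by (simp add: UNIV_bool)
qed

text \<open>Injectivity keeps the coordinates independent, and all of them have the same law. This
  is the stationarity by which every lattice cube carries a copy of the percolation.\<close>

lemma distr_BF_reindex:
  fixes f :: "'i \<Rightarrow> 'i"
  assumes "inj f"
  shows "distr (BF p) (BF p) (\<lambda>\<omega>. \<omega> \<circ> f) = BF p"
  using distr_PiM_reindex[of UNIV "\<lambda>_. measure_pmf (bernoulli_pmf p)" f UNIV] assms
  by (simp add: bernoulli_field_def comp_def restrict_UNIV measure_pmf.prob_space_axioms)

lemma measurable_BF_reindex [measurable]:
  fixes f :: "'i \<Rightarrow> 'i"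
  shows "(\<lambda>\<omega>. \<omega> \<circ> f) \<in> measurable (BF p) (BF p)"
  unfolding bernoulli_field_def
  unfolding comp_def
  by (rule measurable_PiM_single', rule measurable_component_singleton) auto

lemma prob_reindex:
  fixes f :: "'i \<Rightarrow> 'i"
  assumes "inj f" "{\<omega>. P \<omega>} \<in> sets (BF p)"
  shows "measure (BF p) {\<omega>. P (\<omega> \<circ> f)} = measure (BF p) {\<omega>. P \<omega>}"
    and "{\<omega>. P (\<omega> \<circ> f)} \<in> sets (BF p)"
proof -
  have "measure (BF p) {\<omega>. P \<omega>} = measure (distr (BF p) (BF p) (\<lambda>\<omega>. \<omega> \<circ> f)) {\<omega>. P \<omega>}"
    by (simp add: distr_BF_reindex[OF assms(1)])
  also have "\<dots> = measure (BF p) {\<omega>. P (\<omega> \<circ> f)}"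
    by (subst measure_distr[OF measurable_BF_reindex assms(2)]) (simp add: vimage_def)
  finally show "measure (BF p) {\<omega>. P (\<omega> \<circ> f)} = measure (BF p) {\<omega>. P \<omega>}" by simp
  show "{\<omega>. P (\<omega> \<circ> f)} \<in> sets (BF p)"
    using measurable_sets[OF measurable_BF_reindex assms(2), of f] by (simp add: vimage_def)
qed

section \<open>Finite events as polynomials in the parameter\<close>

lemma prob_finite_cylinder:
  assumes "finite J" "0 \<le> p" "p \<le> 1"
  shows "measure (BF p) {\<omega>. \<forall>x\<in>J. \<omega> x = g x} = (\<Prod>x\<in>J. if g x then p else 1 - p)"
proof -
  have "emeasure (BF p) {\<omega>. \<forall>x\<in>J. \<omega> x = g x} =
     (\<Prod>x\<in>J. emeasure (measure_pmf (bernoulli_pmf p)) {g x})"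
    using emeasure_PiM_emb[of UNIV "\<lambda>_. measure_pmf (bernoulli_pmf p)" J "\<lambda>x. {g x}"] assms
    by (simp add: bernoulli_field_def prod_emb_def measure_pmf.prob_space_axioms vimage_def PiE_iff
        restrict_def extensional_def Ball_def)
  also have "\<dots> = (\<Prod>x\<in>J. ennreal (if g x then p else 1 - p))"
    using assms by (intro prod.cong) (auto simp: emeasure_pmf_single)
  also have "\<dots> = ennreal (\<Prod>x\<in>J. if g x then p else 1 - p)"
    using assms by (intro prod_ennreal) auto
  finally show ?thesis
    using assms by (simp add: measure_def prod_nonneg)
qed

lemma prob_coordinate:
  assumes "0 \<le> p" "p \<le> 1"
  shows "measure (BF p) {\<omega>. \<omega> x} = p"
  using prob_finite_cylinder[of "{x}" p "\<lambda>_. True"] assms by simp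

lemma prob_dep_finite_polynomial:
  fixes P :: "('i \<Rightarrow> bool) \<Rightarrow> bool"
  assumes "dep J P" "finite J" "0 \<le> p" "p \<le> 1"
  shows "measure (BF p) {\<omega>. P \<omega>} =
    (\<Sum>g\<in>{g \<in> PiE J (\<lambda>_. UNIV). P g}. \<Prod>x\<in>J. if g x then p else 1 - p)"
proof -
  interpret prob_space "BF p :: ('i \<Rightarrow> bool) measure" by (rule prob_space_BF)
  let ?G = "{g \<in> PiE J (\<lambda>_. UNIV). P g}"
  let ?F = "\<lambda>g. {\<omega>. \<forall>x\<in>J. \<omega> x = g x}"
  have fin: "finite ?G"
    using finite_PiE[OF assms(2), of "\<lambda>_. UNIV :: bool set"] by simp
  have F: "?F g \<in> sets (BF p)" for g
    by (rule dep_finite_sets[of J]) (use assms in \<open>auto simp: dep_def\<close>)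
  have "{\<omega>. P \<omega>} = (\<Union>g\<in>?G. ?F g)"
  proof (intro set_eqI iffI)
    fix \<omega> assume "\<omega> \<in> {\<omega>. P \<omega>}"
    moreover have "P \<omega> = P (restrict \<omega> J)"
      by (rule depD[OF assms(1)]) simp
    ultimately have "restrict \<omega> J \<in> ?G" "\<omega> \<in> ?F (restrict \<omega> J)" by auto
    then show "\<omega> \<in> (\<Union>g\<in>?G. ?F g)" by blast
  next
    fix \<omega> assume "\<omega> \<in> (\<Union>g\<in>?G. ?F g)"
    then obtain g where "P g" "\<forall>x\<in>J. \<omega> x = g x" by auto
    then show "\<omega> \<in> {\<omega>. P \<omega>}" using depD[OF assms(1), of \<omega> g] by auto
  qed
  moreover have "disjoint_family_on ?F ?G"
    unfolding disjoint_family_on_def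
  proof (intro ballI impI)
    fix g h assume gh: "g \<in> ?G" "h \<in> ?G" "g \<noteq> h"
    then obtain x where "x \<in> J" "g x \<noteq> h x" by (auto simp: PiE_iff extensional_def fun_eq_iff)
    then show "?F g \<inter> ?F h = {}" by auto
  qed
  ultimately have "measure (BF p) {\<omega>. P \<omega>} = (\<Sum>g\<in>?G. measure (BF p) (?F g))"
    using F by (simp only:) (rule finite_measure_finite_Union[OF fin], auto)
  also have "\<dots> = (\<Sum>g\<in>?G. \<Prod>x\<in>J. if g x then p else 1 - p)"
    using assms by (intro sum.cong refl prob_finite_cylinder) auto
  finally show ?thesis .
qed

text \<open>The probability is a polynomial in the parameter. Smallness of an event on finitely many
  cubes at \<open>p\<close> therefore persists for some larger parameter.\<close>

lemma prob_dep_finite_right_continuous: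
  fixes P :: "('i \<Rightarrow> bool) \<Rightarrow> bool"
  assumes "dep J P" "finite J" "0 \<le> p" "p < 1" "measure (BF p) {\<omega>. P \<omega>} < c"
  shows "\<exists>p'>p. p' < 1 \<and> measure (BF p') {\<omega>. P \<omega>} < c"
proof -
  let ?h = "\<lambda>t::real. \<Sum>g\<in>{g \<in> PiE J (\<lambda>_. UNIV). P g}. \<Prod>x\<in>J. if g x then t else 1 - t"
  have "continuous_on UNIV ?h"
  proof (intro continuous_on_sum continuous_on_prod)
    show "continuous_on UNIV (\<lambda>t::real. if g x then t else 1 - t)" for g :: "'i \<Rightarrow> bool" and x
      by (cases "g x") (auto intro!: continuous_intros)
  qed
  then have "isCont ?h p" by (simp add: continuous_on_eq_continuous_at)
  then have "?h \<midarrow>p\<rightarrow> ?h p" by (simp add: isCont_def)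
  then have "(?h \<longlongrightarrow> ?h p) (at_right p)" by (rule filterlim_mono) (auto intro: at_le)
  moreover have "?h p < c" using prob_dep_finite_polynomial[OF assms(1,2,3)] assms by simp
  ultimately have "eventually (\<lambda>t. ?h t < c) (at_right p)" by (rule order_tendstoD)
  moreover have "eventually (\<lambda>t. t < 1 \<and> p < t) (at_right p)"
    using assms(4) by (auto simp: eventually_at_right intro!: exI[of _ 1])
  ultimately have "eventually (\<lambda>t. ?h t < c \<and> t < 1 \<and> p < t) (at_right p)"
    by eventually_elim auto
  then obtain t where "?h t < c" "t < 1" "p < t"
    using eventually_happens by fastforce
  then show ?thesis
    using prob_dep_finite_polynomial[OF assms(1,2), of t] assms by auto
qed

text \<open>Passing to a coordinate projection keeps almost sure statements even when the event is not
  known to be measurable; this is why the complementary coordinates are integrated out by Fubini.\<close>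
lemma AE_BF_restrict:
  fixes I :: "'i set"
  assumes "AE \<omega> in BF p. P (restrict \<omega> I)"
  shows "AE \<omega> in PiM I (\<lambda>_. measure_pmf (bernoulli_pmf p)). P \<omega>"
proof -
  interpret prob_space "BF p :: ('i \<Rightarrow> bool) measure" by (rule prob_space_BF)
  let ?B = "\<lambda>_::'i. measure_pmf (bernoulli_pmf p)"
  let ?K = "\<lambda>b::bool. if b then I else - I"
  have rv: "random_variable (PiM J ?B) (\<lambda>\<omega>. restrict \<omega> J)" for J
    unfolding bernoulli_field_def by (rule measurable_restrict_subset) simp
  have d: "distr (BF p) (PiM J ?B) (\<lambda>\<omega>. restrict \<omega> J) = PiM J ?B" for J
    unfolding bernoulli_field_def
    using distr_PiM_reindex[of UNIV ?B "\<lambda>x. x" J] by (simp add: measure_pmf.prob_space_axioms restrict_def)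
  have "indep_var (PiM (?K True) ?B) (\<lambda>\<omega>. restrict (\<lambda>i. \<omega> i) (?K True))
      (PiM (?K False) ?B) (\<lambda>\<omega>. restrict (\<lambda>i. \<omega> i) (?K False))"
    by (rule indep_var_restrict[OF indep_coordinates]) auto
  then have ind: "indep_var (PiM I ?B) (\<lambda>\<omega>. restrict \<omega> I) (PiM (-I) ?B) (\<lambda>\<omega>. restrict \<omega> (-I))"
    by simp
  let ?mg = "merge I (-I) :: (('i \<Rightarrow> bool) \<times> ('i \<Rightarrow> bool)) \<Rightarrow> 'i \<Rightarrow> bool"
  have mg: "?mg \<in> measurable (PiM I ?B \<Otimes>\<^sub>M PiM (-I) ?B) (BF p)"
    using measurable_merge[of I "-I" ?B] by (simp add: bernoulli_field_def)
  have "BF p = distr (BF p) (BF p) (\<lambda>\<omega>. ?mg (restrict \<omega> I, restrict \<omega> (-I)))"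
  proof -
    have "?mg (restrict \<omega> I, restrict \<omega> (-I)) = \<omega>" for \<omega>
      by (auto simp: merge_def)
    then show ?thesis by (simp add: distr_id)
  qed
  also have "\<dots> = distr (distr (BF p) (PiM I ?B \<Otimes>\<^sub>M PiM (-I) ?B) (\<lambda>\<omega>. (restrict \<omega> I, restrict \<omega> (-I)))) (BF p) ?mg"
    by (subst distr_distr[OF mg measurable_Pair[OF rv rv]]) (simp add: comp_def)
  also have "\<dots> = distr (PiM I ?B \<Otimes>\<^sub>M PiM (-I) ?B) (BF p) ?mg"
    using ind unfolding indep_var_distribution_eq d by (elim conjE) (simp only:)
  finally have eq: "BF p = distr (PiM I ?B \<Otimes>\<^sub>M PiM (-I) ?B) (BF p) ?mg" .
  have "AE \<omega> in distr (PiM I ?B \<Otimes>\<^sub>M PiM (-I) ?B) (BF p) ?mg. P (restrict \<omega> I)"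
    using assms by (subst eq[symmetric])
  then have "AE z in PiM I ?B \<Otimes>\<^sub>M PiM (-I) ?B. P (restrict (?mg z) I)"
    by (rule AE_distrD[OF mg])
  moreover have "sigma_finite_measure (PiM J ?B)" for J
    by (intro prob_space_imp_sigma_finite prob_space_PiM measure_pmf.prob_space_axioms)
  ultimately have "AE x in PiM I ?B. AE y in PiM (-I) ?B. P (restrict (?mg (x, y)) I)"
    by (intro pair_sigma_finite.AE_pair[where Q="\<lambda>z. P (restrict (?mg z) I)"] pair_sigma_finite.intro)
  then have "AE x in PiM I ?B. P (restrict x I)"
  proof eventually_elim
    case (elim x)
    have "restrict (?mg (x, y)) I = restrict x I" for y by (auto simp: merge_def restrict_def)
    then have "AE y in PiM (-I) ?B. P (restrict x I)" using elim by simp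
    moreover have "prob_space (PiM (-I) ?B)"
      by (intro prob_space_PiM measure_pmf.prob_space_axioms)
    ultimately show ?case by (simp add: prob_space.AE_const)
  qed
  moreover have "AE x in PiM I ?B. restrict x I = x"
    by (rule AE_I2) (simp add: space_PiM PiE_restrict)
  ultimately show ?thesis by eventually_elim simp
qed

lemma dist_le_coordinates:
  fixes x y :: "real^'d::finite"
  assumes "\<And>i. \<bar>x $ i - y $ i\<bar> \<le> c"
  shows "dist x y \<le> real CARD('d) * c"
proof -
  have "dist x y \<le> (\<Sum>i\<in>UNIV. \<bar>(x - y) $ i\<bar>)"
    unfolding dist_norm by (rule norm_le_l1_cart)
  also have "\<dots> \<le> (\<Sum>i\<in>(UNIV::'d set). c)" using assms by (intro sum_mono) simp
  finally show ?thesis by simp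
qed

declare One_nat_def [simp del]

lemma dep_Bex: "(\<And>a. a \<in> A \<Longrightarrow> dep J (P a)) \<Longrightarrow> dep J (\<lambda>\<omega>. \<exists>a\<in>A. P a \<omega>)"
  unfolding dep_def by (intro allI impI bex_cong refl) blast

lemma dep_Ball: "(\<And>a. a \<in> A \<Longrightarrow> dep J (P a)) \<Longrightarrow> dep J (\<lambda>\<omega>. \<forall>a\<in>A. P a \<omega>)"
  unfolding dep_def by (intro allI impI ball_cong refl) blast

lemma dep_conj: "dep J P \<Longrightarrow> dep J Q \<Longrightarrow> dep J (\<lambda>\<omega>. P \<omega> \<and> Q \<omega>)"
  unfolding dep_def by metis

section \<open>The branching equation\<close>

lemma one_minus_power_sum: "1 - (1 - y) ^ M = y * (\<Sum>i<M. (1 - y) ^ i)" for y :: real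
  using power_diff_1_eq[of "1 - y" M] by simp

text \<open>Writing \<open>1 - (1 - p * x) ^ M = x * (p * (\<Sum>i<M. (1 - p * x) ^ i))\<close>, the second factor is
  strictly decreasing in \<open>x\<close>; comparing it with \<open>1\<close> replaces the usual convexity argument.\<close>
lemma branching_factor_less:
  fixes p a s :: real
  assumes "0 < p" "p \<le> 1" "M \<ge> 2" "0 \<le> a" "a < s" "s \<le> 1"
  shows "p * (\<Sum>i<M. (1 - p * s) ^ i) < p * (\<Sum>i<M. (1 - p * a) ^ i)"
proof -
  have ps: "p * s \<le> 1" "p * a < p * s" using assms by (auto intro: mult_le_one)
  have "(\<Sum>i<M. (1 - p * s) ^ i) < (\<Sum>i<M. (1 - p * a) ^ i)"
  proof (rule sum_strict_mono_ex1)
    show "\<forall>i\<in>{..<M}. (1 - p * s) ^ i \<le> (1 - p * a) ^ i"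
      using ps by (auto intro!: power_mono)
    show "\<exists>i\<in>{..<M}. (1 - p * s) ^ i < (1 - p * a) ^ i"
      using assms(3) ps by (intro bexI[of _ 1]) auto
  qed simp
  then show ?thesis using assms(1) by simp
qed

text \<open>Write f(x) for \<open>p * (\<Sum>i<M. (1 - p * x) ^ i)\<close>. The hypothesis on
  \<open>a\<close> says f(a) \<le> 1, the one on \<open>s\<close> gives f(s) \<ge> 1 as soon as s >
  0, and f is strictly decreasing. In the application \<open>s\<close> is the survival probability
  and \<open>a\<close> the probability of an inherited property.\<close>

lemma branching_fixpoint_unique:
  fixes p a s :: real
  assumes "0 < p" "p \<le> 1" "M \<ge> 2" "0 < a" "s \<le> 1"
    and a: "1 - a \<le> (1 - p * a) ^ M" and s: "(1 - p * s) ^ M \<le> 1 - s"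
  shows "s \<le> a"
proof (rule ccontr)
  assume "\<not> s \<le> a"
  then have as: "a < s" by simp
  have "a * (p * (\<Sum>i<M. (1 - p * a) ^ i)) \<le> a * 1"
    using a one_minus_power_sum[of "p * a" M] by (simp add: mult_ac)
  then have 1: "p * (\<Sum>i<M. (1 - p * a) ^ i) \<le> 1" using assms(4) by (simp only: mult_le_cancel_left_pos)
  have "s * 1 \<le> s * (p * (\<Sum>i<M. (1 - p * s) ^ i))"
    using s one_minus_power_sum[of "p * s" M] by (simp add: mult_ac)
  then have 2: "1 \<le> p * (\<Sum>i<M. (1 - p * s) ^ i)" using assms(4) as by (simp only: mult_le_cancel_left_pos)
  show False using branching_factor_less[OF assms(1-3) less_imp_le[OF assms(4)] as assms(5)] 1 2 by linarith
qed

text \<open>The factor is at least 1 at \<open>s\<close> and strictly larger at 0, where it equals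
  the mean \<open>p * M\<close>. Positive survival probability thus excludes the critical mean 1 as
  well.\<close>

lemma branching_mean_gt_1:
  fixes p s :: real
  assumes "0 < p" "p \<le> 1" "M \<ge> 2" "0 < s" "s \<le> 1" and s: "(1 - p * s) ^ M \<le> 1 - s"
  shows "1 < p * M"
proof -
  have "s * 1 \<le> s * (p * (\<Sum>i<M. (1 - p * s) ^ i))"
    using s one_minus_power_sum[of "p * s" M] by (simp add: mult_ac)
  then have 2: "1 \<le> p * (\<Sum>i<M. (1 - p * s) ^ i)" using assms(4) by (simp only: mult_le_cancel_left_pos)
  have "p * (\<Sum>i<M. (1 - p * s) ^ i) < p * (\<Sum>i<M. (1 - p * 0) ^ i)"
    by (rule branching_factor_less) (use assms in auto)
  then show ?thesis using 2 by simp
qed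

text \<open>At 0 the factor \<open>r * (\<Sum>i<M. (1 - r * x) ^ i)\<close> is the mean, which
  exceeds 1, so by continuity it still exceeds 1 at some small positive \<open>x\<close>. Such an
  \<open>x\<close> is a lower barrier for the iteration of the survival probabilities.\<close>

lemma branching_supersolution:
  fixes r :: real
  assumes "1 < r * M" "0 < r" "r \<le> 1"
  shows "\<exists>x. 0 < x \<and> x \<le> 1 \<and> x \<le> 1 - (1 - r * x) ^ M"
proof -
  let ?g = "\<lambda>x. r * (\<Sum>i<M. (1 - r * x) ^ i)"
  have "continuous_on UNIV ?g" by (intro continuous_intros)
  then have "(?g \<longlongrightarrow> ?g 0) (at 0)"
    unfolding continuous_on_eq_continuous_at[OF open_UNIV] isCont_def by (rule bspec) simp
  then have "(?g \<longlongrightarrow> ?g 0) (at_right 0)"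
    by (rule filterlim_mono) (auto intro: at_le)
  moreover have "?g 0 > 1" using assms by simp
  ultimately have "eventually (\<lambda>x. 1 < ?g x) (at_right 0)" by (rule order_tendstoD)
  moreover have "eventually (\<lambda>x::real. 0 < x \<and> x < 1) (at_right 0)"
    using eventually_at_right_real[of 0 1] by simp
  ultimately have "eventually (\<lambda>x. 1 < ?g x \<and> 0 < x \<and> x < 1) (at_right 0)"
    by eventually_elim auto
  then obtain x where x: "1 < ?g x" "0 < x" "x < 1"
    using eventually_happens by fastforce
  then have "x * 1 \<le> x * ?g x" by (intro mult_left_mono) auto
  then have "x \<le> 1 - (1 - r * x) ^ M"
    using one_minus_power_sum[of "r * x" M] by (simp add: mult_ac)
  then show ?thesis using x by (intro exI[of _ x]) auto
qed

section \<open>The cube tree and the zero-one law\<close>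

text \<open>A node \<open>(m, j)\<close> stands for the level-\<open>m\<close> cube with lower corner \<open>j / N^m\<close>; the corner ranges
  over the whole lattice, so that every cube has all its neighbours.\<close>
type_synonym 'd node = "nat \<times> ('d \<Rightarrow> int)"

locale perc =
  fixes N :: nat
  assumes N2: "2 \<le> N"
begin

abbreviation L :: "nat \<Rightarrow> int" where "L m \<equiv> int N ^ m"

lemma L_pos [simp]: "0 < L m" "L m \<noteq> 0" "0 \<le> L m"
  using N2 by auto

definition anc :: "nat \<Rightarrow> ('d \<Rightarrow> int) \<Rightarrow> 'd \<Rightarrow> int" where
  "anc r j = (\<lambda>i. j i div L r)"

definition grid :: "nat \<Rightarrow> ('d \<Rightarrow> int) set" where
  "grid m = {j. \<forall>i. 0 \<le> j i \<and> j i < L m}"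

text \<open>Offsets \<open>j\<close> outside \<open>grid m\<close> are meaningful: they address
  cells of the cubes around \<open>k\<close>, which is what the crossing events read.\<close>

definition sub :: "nat \<Rightarrow> ('d \<Rightarrow> int) \<Rightarrow> ('d \<Rightarrow> int) \<Rightarrow> 'd \<Rightarrow> int" where
  "sub m k j = (\<lambda>i. k i * L m + j i)"

definition shift_idx :: "nat \<Rightarrow> ('d \<Rightarrow> int) \<Rightarrow> 'd node \<Rightarrow> 'd node" where
  "shift_idx n k = (\<lambda>(m, j). (n + m, sub m k j))"

definition shift :: "nat \<Rightarrow> ('d \<Rightarrow> int) \<Rightarrow> ('d node \<Rightarrow> bool) \<Rightarrow> 'd node \<Rightarrow> bool" where
  "shift n k \<omega> = \<omega> \<circ> shift_idx n k"

text \<open>Level 0 is not read, since the unit cube carries no coin in the model.\<close>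

definition retained :: "('d node \<Rightarrow> bool) \<Rightarrow> nat \<Rightarrow> ('d \<Rightarrow> int) \<Rightarrow> bool" where
  "retained \<omega> m j \<longleftrightarrow> (\<forall>l\<in>{1..m}. \<omega> (l, anc (m - l) j))"

definition tree_nodes :: "'d node set" where
  "tree_nodes = {(m, j). 1 \<le> m \<and> j \<in> grid m}"

definition survives :: "('d node \<Rightarrow> bool) \<Rightarrow> bool" where
  "survives \<omega> \<longleftrightarrow> (\<forall>m. \<exists>j\<in>grid m. retained \<omega> m j)"

lemma shift_apply: "shift n k \<omega> (m, j) = \<omega> (n + m, sub m k j)"
  by (simp add: shift_def shift_idx_def)

lemma inj_shift_idx: "inj (shift_idx n k)"
  by (auto simp: inj_def shift_idx_def sub_def fun_eq_iff)

lemma anc_0 [simp]: "anc 0 j = j"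
  by (simp add: anc_def)

lemma anc_anc: "anc r (anc s j) = anc (s + r) j"
  by (simp add: anc_def power_add div_mult2_eq' zdiv_zmult2_eq)

lemma anc_sub:
  assumes "r \<le> m"
  shows "anc r (sub m k j) = sub (m - r) k (anc r j)"
proof
  fix i
  have "L m = L (m - r) * L r" using assms by (simp flip: power_add)
  then have e: "k i * L m + j i = j i + (k i * L (m - r)) * L r" by simp
  show "anc r (sub m k j) i = sub (m - r) k (anc r j) i"
    unfolding anc_def sub_def e by (rule div_mult_self1) (rule L_pos(2))
qed

lemma sub_0 [simp]: "sub 0 k j = (\<lambda>i. k i + j i)"
  by (simp add: sub_def)

lemma sub_sub: "sub m (sub n k j) j' = sub (n + m) k (sub m j j')"
  by (simp add: sub_def power_add algebra_simps)

lemma anc_grid_0: "j \<in> grid m \<Longrightarrow> anc m j = (\<lambda>_. 0)"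
  by (auto simp: anc_def grid_def)

lemma anc_sub_grid: "j \<in> grid m \<Longrightarrow> anc m (sub m k j) = k"
  by (subst anc_sub) (auto simp: anc_grid_0)

lemma anc_in_grid:
  assumes "j \<in> grid (n + m)"
  shows "anc m j \<in> grid n"
proof -
  have "0 \<le> j i div L m \<and> j i div L m < L n" for i
  proof -
    have "0 \<le> j i" "j i < L n * L m" using assms by (auto simp: grid_def power_add)
    moreover have "j i div L m * L m \<le> j i" using L_pos(1)[of m] by (simp add: minus_mod_eq_div_mult[symmetric])
    ultimately have "0 \<le> j i div L m" "j i div L m * L m < L n * L m"
      using pos_imp_zdiv_nonneg_iff[OF L_pos(1)[of m], of "j i"] by auto
    then show ?thesis using mult_less_cancel_right_pos[OF L_pos(1)[of m]] by blast
  qed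
  then show ?thesis by (simp add: grid_def anc_def)
qed

lemma sub_in_grid:
  assumes "k \<in> grid n" "j \<in> grid m"
  shows "sub m k j \<in> grid (n + m)"
proof -
  have "k i * L m + j i < L n * L m" for i
  proof -
    have "k i < L n" "j i < L m" using assms by (auto simp: grid_def)
    then have "(k i + 1) * L m \<le> L n * L m" by (intro mult_right_mono) (auto simp del: of_nat_power)
    then show ?thesis using \<open>j i < L m\<close> by (simp add: algebra_simps)
  qed
  then show ?thesis using assms by (auto simp: grid_def sub_def power_add)
qed

definition off :: "nat \<Rightarrow> ('d \<Rightarrow> int) \<Rightarrow> 'd \<Rightarrow> int" where
  "off m j = (\<lambda>i. j i mod L m)"

lemma off_in_grid: "off m j \<in> grid m"
  unfolding off_def grid_def using L_pos(1)[of m] by (auto simp del: L_pos intro: pos_mod_sign pos_mod_bound)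

lemma sub_anc_off: "sub m (anc m j) (off m j) = j"
  unfolding sub_def anc_def off_def by (rule ext) (rule div_mult_mod_eq)

lemma grid_0 [simp]: "grid 0 = {\<lambda>_. 0}"
proof (intro set_eqI iffI)
  fix x :: "'d \<Rightarrow> int" assume "x \<in> grid 0"
  then have "x i = 0" for i unfolding grid_def by (auto dest!: spec[of _ i])
  then show "x \<in> {\<lambda>_. 0}" by auto
qed (auto simp: grid_def)

lemma grid_eq_PiE: "grid m = PiE UNIV (\<lambda>_. {0..<L m})"
  by (auto simp: grid_def PiE_iff)

lemma finite_grid: "finite (grid m :: ('d::finite \<Rightarrow> int) set)"
  unfolding grid_eq_PiE by (intro finite_PiE) auto

lemma card_grid: "card (grid m :: ('d::finite \<Rightarrow> int) set) = (N ^ m) ^ CARD('d)"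
proof -
  have "nat (L m) = N ^ m" by (metis nat_int of_nat_power)
  then show ?thesis unfolding grid_eq_PiE by (subst card_PiE) auto
qed

lemma grid_split:
  "grid (n + m) = (\<lambda>(k, j). sub m k j) ` (grid n \<times> grid m)"
proof (intro set_eqI iffI)
  fix x :: "'d \<Rightarrow> int" assume "x \<in> grid (n + m)"
  then have "x = (\<lambda>(k, j). sub m k j) (anc m x, off m x)" "(anc m x, off m x) \<in> grid n \<times> grid m"
    by (auto simp: sub_anc_off anc_in_grid off_in_grid)
  then show "x \<in> (\<lambda>(k, j). sub m k j) ` (grid n \<times> grid m)" by (rule image_eqI)
qed (auto simp: sub_in_grid)

lemma inj_on_sub: "inj_on (\<lambda>(k, j). sub m k j) (UNIV \<times> grid m)"
proof (rule inj_onI, clarsimp)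
  fix k j k' j' :: "'d \<Rightarrow> int" assume *: "j \<in> grid m" "j' \<in> grid m" "sub m k j = sub m k' j'"
  then have "k = k'" by (metis anc_sub_grid)
  then show "k = k' \<and> j = j'" using *(3) by (auto simp: sub_def fun_eq_iff)
qed

text \<open>The ancestors of \<open>sub m k j\<close> split at level \<open>n\<close>. For an offset
  outside the grid the level-\<open>n\<close> ancestor is not \<open>k\<close> but the neighbour
  \<open>k + anc m j\<close>; this general form serves the crossing events, while true descendants
  of \<open>k\<close> have \<open>anc m j = 0\<close>.\<close>

lemma retained_shift:
  "retained \<omega> (n + m) (sub m k j) \<longleftrightarrow>
    retained \<omega> n (\<lambda>i. k i + anc m j i) \<and> retained (shift n k \<omega>) m j"
proof -
  have 1: "anc (n + m - l) (sub m k j) = anc (n - l) (\<lambda>i. k i + anc m j i)" if "l \<le> n" for l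
  proof -
    have "anc (n + m - l) (sub m k j) = anc (n - l) (anc m (sub m k j))"
      using that by (simp add: anc_anc add.commute)
    then show ?thesis by (simp add: anc_sub)
  qed
  have 2: "\<omega> (n + l, anc (m - l) (sub m k j)) = shift n k \<omega> (l, anc (m - l) j)" if "l \<le> m" for l
    using that by (simp add: shift_apply anc_sub)
  have "retained \<omega> (n + m) (sub m k j) \<longleftrightarrow>
    (\<forall>l\<in>{1..n}. \<omega> (l, anc (n + m - l) (sub m k j))) \<and>
    (\<forall>l\<in>{1..m}. \<omega> (n + l, anc (n + m - (n + l)) (sub m k j)))"
  proof -
    have "(\<forall>l\<in>{1..n + m}. Q l) \<longleftrightarrow> (\<forall>l\<in>{1..n}. Q l) \<and> (\<forall>l\<in>{1..m}. Q (n + l))" for Q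
    proof (intro iffI conjI ballI)
      fix l assume Q: "(\<forall>l\<in>{1..n}. Q l) \<and> (\<forall>l\<in>{1..m}. Q (n + l))" and l: "l \<in> {1..n + m}"
      show "Q l"
      proof (cases "l \<le> n")
        case False
        then have "l - n \<in> {1..m}" using l by auto
        then have "Q (n + (l - n))" using Q by blast
        then show ?thesis using False by simp
      qed (use Q l in auto)
    qed auto
    then show ?thesis unfolding retained_def .
  qed
  then show ?thesis using 1 2 by (auto simp: retained_def)
qed

lemma retained_sub_grid:
  "j \<in> grid m \<Longrightarrow> retained \<omega> (n + m) (sub m k j) \<longleftrightarrow> retained \<omega> n k \<and> retained (shift n k \<omega>) m j"
  by (simp add: retained_shift anc_grid_0)

lemma retained_anc: "retained \<omega> (n + m) j \<Longrightarrow> retained \<omega> n (anc m j)"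
  using retained_sub_grid[OF off_in_grid, of \<omega> n m "anc m j" j] by (simp add: sub_anc_off)

lemma retained_0 [simp]: "retained \<omega> 0 j"
  by (simp add: retained_def)

lemma retained_1: "retained \<omega> 1 j \<longleftrightarrow> \<omega> (1, j)"
  by (simp add: retained_def)

lemma dep_retained: "dep {(l, anc (m - l) j) |l. l \<in> {1..m}} (\<lambda>\<omega>. retained \<omega> m j)"
  unfolding retained_def dep_def by (metis (mono_tags, lifting) mem_Collect_eq)

lemma dep_retained_grid:
  assumes "j \<in> grid m"
  shows "dep (tree_nodes \<inter> {(l, j). l \<le> m}) (\<lambda>\<omega>. retained \<omega> m j)"
proof (rule dep_mono[OF dep_retained])
  have "anc (m - l) j \<in> grid l" if "l \<le> m" for l
    using anc_in_grid[of j l "m - l"] that assms by simp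
  then show "{(l, anc (m - l) j) |l. l \<in> {1..m}} \<subseteq> tree_nodes \<inter> {(l, j). l \<le> m}"
    by (auto simp: tree_nodes_def)
qed

lemma finite_tree_nodes_le: "finite (tree_nodes \<inter> {(l, j). l \<le> m} :: 'd::finite node set)"
proof (rule finite_subset)
  show "tree_nodes \<inter> {(l, j). l \<le> m} \<subseteq> (\<Union>l\<le>m. (\<lambda>j. (l, j)) ` (grid l :: ('d \<Rightarrow> int) set))"
    by (auto simp: tree_nodes_def)
qed (simp add: finite_grid)

lemma dep_shift:
  assumes "dep J P"
  shows "dep (shift_idx n k ` J) (\<lambda>\<omega>. P (shift n k \<omega>))"
  using assms unfolding dep_def shift_def by simp

lemma prob_shift:
  assumes "{\<omega>. P \<omega>} \<in> sets (BF p)"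
  shows "measure (BF p) {\<omega>. P (shift n k \<omega>)} = measure (BF p) {\<omega>. P \<omega>}"
    and "{\<omega>. P (shift n k \<omega>)} \<in> sets (BF p)"
  using prob_reindex[OF inj_shift_idx assms] by (simp_all add: shift_def)

lemma measurable_shift [measurable]: "shift n k \<in> measurable (BF p) (BF p)"
  unfolding shift_def[abs_def] by (rule measurable_BF_reindex)

text \<open>The extra index \<open>(0, \<lambda>_. 0)\<close> is shifted to the child itself. The
  shifted \<open>tree_nodes\<close> alone would start one level below it and miss the child's own
  coin.\<close>

definition child_nodes :: "('d \<Rightarrow> int) \<Rightarrow> 'd node set" where
  "child_nodes k = shift_idx 1 k ` (insert (0, \<lambda>_. 0) tree_nodes)"

lemma disjoint_child_nodes: "disjoint_family_on child_nodes K"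
proof -
  have "k = k'" if "x \<in> child_nodes k" "x \<in> child_nodes k'" for k k' x
  proof -
    have "anc (fst x - 1) (snd x) = k" if "x \<in> child_nodes k" for k
      using that by (auto simp: child_nodes_def shift_idx_def tree_nodes_def anc_sub_grid)
    then show ?thesis using that by metis
  qed
  then show ?thesis by (auto simp: disjoint_family_on_def)
qed

lemma dep_child:
  fixes f :: "('d node \<Rightarrow> bool) \<Rightarrow> 'c"
  assumes "dep tree_nodes f"
  shows "dep (child_nodes k) (\<lambda>\<omega>. g (\<omega> (1, k)) (f (shift 1 k \<omega>)))"
proof (rule depI)
  fix \<omega> \<omega>' :: "'d node \<Rightarrow> bool"
  assume *: "\<And>x. x \<in> child_nodes k \<Longrightarrow> \<omega> x = \<omega>' x"
  have "\<omega> (1, k) = \<omega>' (1, k)"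
    by (rule *) (auto simp: child_nodes_def shift_idx_def)
  moreover have "f (shift 1 k \<omega>) = f (shift 1 k \<omega>')"
    by (rule depD[OF dep_shift[OF assms]]) (use * in \<open>auto simp: child_nodes_def\<close>)
  ultimately show "g (\<omega> (1, k)) (f (shift 1 k \<omega>)) = g (\<omega>' (1, k)) (f (shift 1 k \<omega>'))" by simp
qed

lemma dep_coordinate: "dep {x} (\<lambda>\<omega>. \<omega> x)"
  by (auto simp: dep_def)

lemma coordinate_sets: "{\<omega>. \<omega> x} \<in> sets (BF p)"
  by (rule dep_finite_sets[OF dep_coordinate]) simp

lemma prob_child:
  fixes P :: "('d node \<Rightarrow> bool) \<Rightarrow> bool"
  assumes "{\<omega>. P \<omega>} \<in> sets (BF p)" "dep tree_nodes P" "0 \<le> p" "p \<le> 1"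
  shows "measure (BF p) {\<omega>. \<omega> (1, k) \<and> P (shift 1 k \<omega>)} = p * measure (BF p) {\<omega>. P \<omega>}"
proof -
  have "measure (BF p) {\<omega>. \<omega> (1, k) \<and> P (shift 1 k \<omega>)} =
    measure (BF p) {\<omega>. \<omega> (1::nat, k)} * measure (BF p) {\<omega>. P (shift 1 k \<omega>)}"
  proof (rule prob_conj_dep)
    show "{\<omega>. P (shift 1 k \<omega>)} \<in> sets (BF p)" by (rule prob_shift(2)[OF assms(1)])
    show "dep (shift_idx 1 k ` tree_nodes) (\<lambda>\<omega>. P (shift 1 k \<omega>))" by (rule dep_shift[OF assms(2)])
    show "{(1, k)} \<inter> shift_idx 1 k ` tree_nodes = {}" by (auto simp: shift_idx_def tree_nodes_def)
  qed (rule coordinate_sets dep_coordinate)+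
  then show ?thesis using assms by (simp add: prob_coordinate prob_shift)
qed

lemma prob_no_child:
  fixes P :: "('d::finite node \<Rightarrow> bool) \<Rightarrow> bool"
  assumes "{\<omega>. P \<omega>} \<in> sets (BF p)" "dep tree_nodes P" "0 \<le> p" "p \<le> 1"
  shows "measure (BF p) {\<omega>. \<forall>k\<in>grid 1. \<not> (\<omega> (1, k) \<and> P (shift 1 k \<omega>))} =
    (1 - p * measure (BF p) {\<omega>. P \<omega>}) ^ (N ^ CARD('d))"
proof -
  interpret prob_space "BF p :: ('d node \<Rightarrow> bool) measure" by (rule prob_space_BF)
  have s: "{\<omega>. \<omega> (1, k) \<and> P (shift 1 k \<omega>)} \<in> events" for k
    using sets.Int[OF coordinate_sets prob_shift(2)[OF assms(1)], of "(1, k)" 1 k]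
    by (simp add: Collect_conj_eq)
  have c: "{\<omega>. \<not> (\<omega> (1, k) \<and> P (shift 1 k \<omega>))} = space (BF p) - {\<omega>. \<omega> (1, k) \<and> P (shift 1 k \<omega>)}" for k
    by auto
  have "measure (BF p) {\<omega>. \<forall>k\<in>grid 1. \<not> (\<omega> (1, k) \<and> P (shift 1 k \<omega>))} =
    (\<Prod>k\<in>grid 1. measure (BF p) {\<omega>. \<not> (\<omega> (1, k) \<and> P (shift 1 k \<omega>))})"
    by (rule prob_INT_dep[OF finite_grid _ dep_child[OF assms(2)] disjoint_child_nodes])
       (unfold c, rule sets.compl_sets[OF s])
  also have "\<dots> = (\<Prod>k\<in>(grid 1 :: ('d \<Rightarrow> int) set). 1 - p * measure (BF p) {\<omega>. P \<omega>})"
    by (intro prod.cong refl) (simp only: c prob_compl[OF s] prob_child[OF assms])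
  also have "\<dots> = (1 - p * measure (BF p) {\<omega>. P \<omega>}) ^ (N ^ CARD('d))"
    by (simp add: card_grid)
  finally show ?thesis .
qed

lemma survives_level_dep:
  "dep (tree_nodes \<inter> {(l, j). l \<le> m}) (\<lambda>\<omega>. \<exists>j\<in>grid m. retained \<omega> m j)"
  by (intro dep_Bex dep_retained_grid)

lemma dep_survives: "dep tree_nodes survives"
proof -
  have "dep tree_nodes (\<lambda>\<omega>. \<forall>m\<in>UNIV. \<exists>j\<in>grid m. retained \<omega> m j)"
    by (intro dep_Ball dep_mono[OF survives_level_dep]) auto
  then show ?thesis by (simp add: survives_def[abs_def])
qed

lemma survives_sets: "{\<omega> :: 'd::finite node \<Rightarrow> bool. survives \<omega>} \<in> sets (BF p)"
proof -
  have "{\<omega> :: 'd node \<Rightarrow> bool. survives \<omega>} = (\<Inter>m. {\<omega>. \<exists>j\<in>grid m. retained \<omega> m j})"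
    by (auto simp: survives_def)
  also have "\<dots> \<in> sets (BF p)"
    using dep_finite_sets[OF survives_level_dep finite_tree_nodes_le] by (intro sets.countable_INT') auto
  finally show ?thesis .
qed

text \<open>Koenig's argument: if each retained child had a tree dying at some level, the maximum of
  these finitely many levels would bound the whole tree.\<close>

lemma survives_child:
  fixes \<omega> :: "'d::finite node \<Rightarrow> bool"
  assumes "survives \<omega>"
  shows "\<exists>k\<in>grid 1. \<omega> (1, k) \<and> survives (shift 1 k \<omega>)"
proof (rule ccontr)
  assume "\<not> ?thesis"
  then have "\<forall>k\<in>grid 1. \<exists>m. \<omega> (1, k) \<longrightarrow> (\<forall>j\<in>grid m. \<not> retained (shift 1 k \<omega>) m j)"
    by (auto simp: survives_def)
  then obtain f where f: "\<And>k j. k \<in> grid 1 \<Longrightarrow> \<omega> (1, k) \<Longrightarrow> j \<in> grid (f k) \<Longrightarrow>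
      \<not> retained (shift 1 k \<omega>) (f k) j"
    by metis
  define m where "m = Max (f ` grid 1)"
  have fm: "f k \<le> m" if "k \<in> grid 1" for k
    using that finite_grid unfolding m_def by (intro Max_ge) auto
  obtain x where x: "x \<in> grid (1 + m)" "retained \<omega> (1 + m) x"
    using assms unfolding survives_def by blast
  then obtain k j where kj: "k \<in> grid 1" "j \<in> grid m" "x = sub m k j"
    by (auto simp: grid_split)
  have r: "\<omega> (1, k)" "retained (shift 1 k \<omega>) m j"
    using x(2) kj retained_sub_grid[of j m \<omega> 1 k] by (auto simp: retained_1)
  have e: "m = f k + (m - f k)" using fm[OF kj(1)] by simp
  have "anc (m - f k) j \<in> grid (f k)" "retained (shift 1 k \<omega>) (f k) (anc (m - f k) j)"
    using anc_in_grid retained_anc kj(2) r(2) e by metis+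
  then show False using f kj(1) r(1) by blast
qed

lemma survives_retained_shift:
  assumes "retained \<omega> n k" "k \<in> grid n" "survives (shift n k \<omega>)"
  shows "survives \<omega>"
  unfolding survives_def
proof
  fix m
  obtain j where j: "j \<in> grid m" "retained (shift n k \<omega>) m j"
    using assms(3) by (auto simp: survives_def)
  then have "sub m k j \<in> grid (m + n)" "retained \<omega> (m + n) (sub m k j)"
    using assms sub_in_grid[of k n j m] retained_sub_grid[of j m \<omega> n k] by (auto simp: add.commute)
  then show "\<exists>j\<in>grid m. retained \<omega> m j"
    using anc_in_grid retained_anc by blast
qed

lemma branch_number_ge_2: "2 \<le> N ^ CARD('d::finite)"
proof -
  have "1 \<le> CARD('d)" using zero_less_card_finite[where 'a='d] by linarith
  then have "N ^ 1 \<le> N ^ CARD('d)" using N2 by (intro power_increasing) auto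
  then show ?thesis using N2 by simp
qed

text \<open>By \<open>survives_child\<close>, the tree is extinct when no retained child carries a
  surviving tree, and the children are independent copies. This is the inequality asked of
  \<open>s\<close> in \<open>branching_fixpoint_unique\<close>.\<close>

lemma extinction_ge:
  assumes "0 \<le> p" "p \<le> 1"
  shows "(1 - p * measure (BF p) {\<omega> :: 'd::finite node \<Rightarrow> bool. survives \<omega>}) ^ (N ^ CARD('d))
    \<le> 1 - measure (BF p) {\<omega> :: 'd node \<Rightarrow> bool. survives \<omega>}"
proof -
  interpret prob_space "BF p :: ('d node \<Rightarrow> bool) measure" by (rule prob_space_BF)
  have "(1 - p * measure (BF p) {\<omega> :: 'd node \<Rightarrow> bool. survives \<omega>}) ^ (N ^ CARD('d)) =
      prob {\<omega>. \<forall>k\<in>grid 1. \<not> (\<omega> (1, k) \<and> survives (shift 1 k \<omega>))}"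
    by (rule prob_no_child[OF survives_sets dep_survives assms, symmetric])
  also have "\<dots> \<le> prob (space (BF p) - {\<omega>. survives \<omega>})"
    by (rule finite_measure_mono[OF _ sets.compl_sets[OF survives_sets]])
       (use survives_retained_shift[of _ 1] in \<open>auto simp: retained_1\<close>, use survives_child in blast)
  also have "\<dots> = 1 - prob {\<omega>. survives \<omega>}"
    by (rule prob_compl[OF survives_sets])
  finally show ?thesis .
qed

lemma mean_gt_1:
  assumes "0 < p" "p \<le> 1" "measure (BF p) {\<omega> :: 'd::finite node \<Rightarrow> bool. survives \<omega>} > 0"
  shows "1 < p * real (N ^ CARD('d))"
proof -
  interpret prob_space "BF p :: ('d node \<Rightarrow> bool) measure" by (rule prob_space_BF)
  show ?thesis
    using branching_mean_gt_1[OF assms(1,2) branch_number_ge_2 assms(3) prob_le_1 extinction_ge] assms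
    by simp
qed

text \<open>Inheritance goes in one direction only, so the probability of \<open>P\<close> satisfies
  just an inequality, opposite to the one for survival. It gives P(survival) \<le>
  P(\<open>P\<close>), and since \<open>P\<close> implies survival the difference of the two events
  is null.\<close>

theorem zero_one_law:
  fixes P :: "('d::finite node \<Rightarrow> bool) \<Rightarrow> bool"
  assumes p: "0 < p" "p \<le> 1"
    and P: "{\<omega>. P \<omega>} \<in> sets (BF p)" "dep tree_nodes P"
    and inherit: "\<And>\<omega> k. k \<in> grid 1 \<Longrightarrow> \<omega> (1, k) \<Longrightarrow> P (shift 1 k \<omega>) \<Longrightarrow> P \<omega>"
    and surv: "\<And>\<omega>. P \<omega> \<Longrightarrow> survives \<omega>"
    and pos: "measure (BF p) {\<omega>. P \<omega>} > 0"
  shows "AE \<omega> in BF p. survives \<omega> \<longrightarrow> P \<omega>"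
proof -
  interpret prob_space "BF p :: ('d node \<Rightarrow> bool) measure" by (rule prob_space_BF)
  have s: "{\<omega>. \<not> (\<omega> (1, k) \<and> P (shift 1 k \<omega>))} \<in> events" for k
  proof -
    have "{\<omega>. \<not> (\<omega> (1, k) \<and> P (shift 1 k \<omega>))} =
        space (BF p) - ({\<omega>. \<omega> (1, k)} \<inter> {\<omega>. P (shift 1 k \<omega>)})" by auto
    also have "\<dots> \<in> events"
      by (intro sets.compl_sets sets.Int coordinate_sets prob_shift(2) P)
    finally show ?thesis .
  qed
  have sA: "{\<omega>. \<forall>k\<in>grid 1. \<not> (\<omega> (1, k) \<and> P (shift 1 k \<omega>))} \<in> events"
  proof -
    have "(\<lambda>_. 0) \<in> grid 1" using N2 by (auto simp: grid_def)
    then have "(\<Inter>k\<in>grid 1. {\<omega>. \<not> (\<omega> (1, k) \<and> P (shift 1 k \<omega>))}) \<in> events"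
      using s finite_grid by (intro sets.finite_INT) auto
    moreover have "(\<Inter>k\<in>grid 1. {\<omega>. \<not> (\<omega> (1, k) \<and> P (shift 1 k \<omega>))}) =
      {\<omega>. \<forall>k\<in>grid 1. \<not> (\<omega> (1, k) \<and> P (shift 1 k \<omega>))}" by auto
    ultimately show ?thesis by simp
  qed
  have "1 - prob {\<omega>. P \<omega>} = prob (space (BF p) - {\<omega>. P \<omega>})"
    by (rule prob_compl[OF P(1), symmetric])
  also have "\<dots> \<le> prob {\<omega>. \<forall>k\<in>grid 1. \<not> (\<omega> (1, k) \<and> P (shift 1 k \<omega>))}"
    by (rule finite_measure_mono[OF _ sA]) (use inherit in auto)
  also have "\<dots> = (1 - p * prob {\<omega>. P \<omega>}) ^ (N ^ CARD('d))"
    using p by (intro prob_no_child[OF P]) auto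
  finally have a: "1 - prob {\<omega>. P \<omega>} \<le> (1 - p * prob {\<omega>. P \<omega>}) ^ (N ^ CARD('d))" .
  have "prob {\<omega>. survives \<omega>} \<le> prob {\<omega>. P \<omega>}"
    using p by (intro branching_fixpoint_unique[OF p branch_number_ge_2 pos _ a extinction_ge]) auto
  moreover have "prob ({\<omega>. survives \<omega>} - {\<omega>. P \<omega>}) = prob {\<omega>. survives \<omega>} - prob {\<omega>. P \<omega>}"
    by (rule finite_measure_Diff[OF survives_sets P(1)]) (use surv in auto)
  ultimately have "prob ({\<omega>. survives \<omega>} - {\<omega>. P \<omega>}) = 0"
    using measure_nonneg[of "BF p" "{\<omega>. survives \<omega>} - {\<omega>. P \<omega>}"] by linarith
  then have "{\<omega>. survives \<omega>} - {\<omega>. P \<omega>} \<in> null_sets (BF p)"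
    using survives_sets P(1) by (auto simp: null_sets_def emeasure_eq_measure)
  then show ?thesis
    by (rule AE_I') auto
qed

end

section \<open>Survival of a further percolation\<close>

lemma measure_BF_UNIV [simp]: "measure (BF p) UNIV = 1"
  using prob_space.prob_space[OF prob_space_BF, of p] by simp

lemma expectation_mult_dep:
  fixes f g :: "('i \<Rightarrow> bool) \<Rightarrow> real"
  assumes "f \<in> borel_measurable (BF p)" "g \<in> borel_measurable (BF p)"
    and "\<And>\<omega>. \<bar>f \<omega>\<bar> \<le> B" "\<And>\<omega>. \<bar>g \<omega>\<bar> \<le> B"
    and "dep J f" "dep J' g" "J \<inter> J' = {}"
  shows "(\<integral>\<omega>. f \<omega> * g \<omega> \<partial>BF p) = (\<integral>\<omega>. f \<omega> \<partial>BF p) * (\<integral>\<omega>. g \<omega> \<partial>BF p)"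
proof -
  have "(\<integral>\<omega>. (\<Prod>b\<in>UNIV. (if b then f else g) \<omega>) \<partial>BF p) = (\<Prod>b\<in>UNIV. \<integral>\<omega>. (if b then f else g) \<omega> \<partial>BF p)"
    by (rule expectation_prod_dep[where B=B and J="\<lambda>b. if b then J else J'"])
       (use assms in \<open>auto simp: disjoint_family_on_def\<close>)
  then show ?thesis by (simp add: UNIV_bool mult.commute)
qed

lemma (in prob_space) integrable_unit_bounded:
  assumes "f \<in> borel_measurable M" "\<And>x. 0 \<le> f x" "\<And>x. f x \<le> (1::real)"
  shows "integrable M f"
  by (rule integrable_const_bound[where B=1]) (use assms in auto)

context perc
begin

lemma expectation_shift:
  fixes f :: "('d node \<Rightarrow> bool) \<Rightarrow> real"
  assumes "f \<in> borel_measurable (BF p)"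
  shows "(\<integral>\<omega>. f (shift n k \<omega>) \<partial>BF p) = (\<integral>\<omega>. f \<omega> \<partial>BF p)"
proof -
  have "(\<integral>\<omega>. f \<omega> \<partial>distr (BF p) (BF p) (shift n k)) = (\<integral>\<omega>. f (shift n k \<omega>) \<partial>BF p)"
    by (rule integral_distr[OF measurable_shift assms])
  then show ?thesis
    using distr_BF_reindex[OF inj_shift_idx, of p n k] by (simp add: shift_def[abs_def])
qed

text \<open>\<open>phi q m \<omega>\<close> is the probability that the retained tree of \<open>\<omega>\<close> still reaches level \<open>m\<close> after an
  additional independent percolation with parameter \<open>q\<close>, given \<open>\<omega>\<close>.  Defining it by recursion avoids
  carrying a second configuration.\<close>
primrec phi :: "real \<Rightarrow> nat \<Rightarrow> ('d::finite node \<Rightarrow> bool) \<Rightarrow> real" where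
  "phi q 0 = (\<lambda>\<omega>. 1)"
| "phi q (Suc m) = (\<lambda>\<omega>. 1 - (\<Prod>k\<in>grid 1. 1 - (if \<omega> (1, k) then q * phi q m (shift 1 k \<omega>) else 0)))"

lemma phi_bounds:
  assumes "0 \<le> q" "q \<le> 1"
  shows "0 \<le> phi q m \<omega>" "phi q m \<omega> \<le> 1"
proof -
  have "0 \<le> phi q m \<omega> \<and> phi q m \<omega> \<le> 1"
  proof (induction m arbitrary: \<omega>)
    case (Suc m)
    have "0 \<le> 1 - (if \<omega> (1, k) then q * phi q m (shift 1 k \<omega>) else 0) \<and>
        1 - (if \<omega> (1, k) then q * phi q m (shift 1 k \<omega>) else 0) \<le> 1" for k
      using Suc assms by (auto intro: mult_le_one)
    then show ?case by (auto intro!: prod_nonneg prod_le_1)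
  qed simp
  then show "0 \<le> phi q m \<omega>" "phi q m \<omega> \<le> 1" by auto
qed

lemma phi_factor_bounds:
  assumes "0 \<le> q" "q \<le> 1"
  shows "0 \<le> (if b then q * phi q m \<omega> else 0)" "(if b then q * phi q m \<omega> else 0) \<le> 1"
  using assms phi_bounds[OF assms, of m \<omega>] by (auto intro: mult_le_one)

lemma phi_Suc_le:
  assumes "0 \<le> q" "q \<le> 1"
  shows "phi q (Suc m) \<omega> \<le> phi q m \<omega>"
proof (induction m arbitrary: \<omega>)
  case 0
  show ?case using phi_bounds(2)[OF assms, of "Suc 0" \<omega>] by (simp only: phi.simps(1))
next
  case (Suc m)
  have "(\<Prod>k\<in>grid 1. 1 - (if \<omega> (1, k) then q * phi q m (shift 1 k \<omega>) else 0)) \<le>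
    (\<Prod>k\<in>grid 1. 1 - (if \<omega> (1, k) then q * phi q (Suc m) (shift 1 k \<omega>) else 0))"
    using Suc phi_bounds[OF assms] assms
    by (intro prod_mono) (auto intro!: mult_left_mono mult_le_one simp del: phi.simps(2))
  then show ?case by (subst phi.simps(2)) (subst (2) phi.simps(2), simp del: phi.simps)
qed

lemma decseq_phi: "0 \<le> q \<Longrightarrow> q \<le> 1 \<Longrightarrow> decseq (\<lambda>m. phi q m \<omega>)"
  by (intro decseq_SucI phi_Suc_le)

lemma shift_idx_tree_nodes:
  "k \<in> grid n \<Longrightarrow> shift_idx n k ` tree_nodes \<subseteq> tree_nodes"
  by (auto simp: shift_idx_def tree_nodes_def sub_in_grid)

lemma dep_phi: "dep (tree_nodes \<inter> {(l, j). l \<le> m}) (phi q m :: ('a::finite node \<Rightarrow> bool) \<Rightarrow> real)"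
proof (induction m)
  case 0
  show ?case by (simp add: dep_def)
next
  case (Suc m)
  show ?case
  proof (rule depI)
    fix \<omega> \<omega>' :: "'a node \<Rightarrow> bool"
    assume *: "\<And>x. x \<in> tree_nodes \<inter> {(l, j). l \<le> Suc m} \<Longrightarrow> \<omega> x = \<omega>' x"
    have 1: "\<omega> (1, k) = \<omega>' (1, k)" if "k \<in> grid 1" for k
      by (rule *) (use that in \<open>auto simp: tree_nodes_def\<close>)
    have 2: "phi q m (shift 1 k \<omega>) = phi q m (shift 1 k \<omega>')" if "k \<in> grid 1" for k
    proof (rule depD[OF dep_shift[OF Suc]])
      fix x :: "'a node" assume "x \<in> shift_idx 1 k ` (tree_nodes \<inter> {(l, j). l \<le> m})"
      then have "x \<in> tree_nodes" "fst x \<le> Suc m"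
        using shift_idx_tree_nodes[OF that] by (auto simp: shift_idx_def)
      then show "\<omega> x = \<omega>' x" by (intro *) auto
    qed
    show "phi q (Suc m) \<omega> = phi q (Suc m) \<omega>'"
      unfolding phi.simps using 1 2 by (intro arg_cong2[where f=minus] refl prod.cong) auto
  qed
qed

lemma phi_measurable [measurable]: "phi q m \<in> borel_measurable (BF p)"
  by (rule dep_finite_borel[OF dep_phi finite_tree_nodes_le])

text \<open>After averaging over the configuration the two percolations merge into one with
  parameter \<open>p * q\<close>. The factors of the children are independent because each reads
  only its own \<open>child_nodes\<close>.\<close>

lemma expectation_phi_Suc:
  assumes "0 \<le> q" "q \<le> 1" "0 \<le> p" "p \<le> 1"
  shows "(\<integral>\<omega>. phi q (Suc m) \<omega> \<partial>(BF p :: ('d::finite node \<Rightarrow> bool) measure)) =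
    1 - (1 - p * q * (\<integral>\<omega>. phi q m \<omega> \<partial>(BF p :: ('d node \<Rightarrow> bool) measure))) ^ (N ^ CARD('d))"
proof -
  let ?M = "BF p :: ('d node \<Rightarrow> bool) measure"
  interpret prob_space ?M by (rule prob_space_BF)
  let ?f = "\<lambda>k \<omega>. 1 - (if \<omega> (1::nat, k) then q * phi q m (shift 1 k \<omega>) else 0)"
  have coord: "(\<lambda>\<omega>. of_bool (\<omega> x) :: real) \<in> borel_measurable ?M" for x
    by (rule dep_finite_borel[OF dep_compose[OF dep_coordinate]]) simp
  have f_eq: "?f k \<omega> = 1 - q * (of_bool (\<omega> (1, k)) * phi q m (shift 1 k \<omega>))" for k \<omega> by simp
  have meas: "(\<lambda>\<omega>. phi q m (shift 1 k \<omega>)) \<in> borel_measurable ?M" for k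
    by (rule measurable_compose[OF measurable_shift phi_measurable])
  have f_meas: "?f k \<in> borel_measurable ?M" for k
    unfolding f_eq using coord[of "(1, k)"] meas[of k] by measurable
  have f_dep: "dep (child_nodes k) (?f k)" for k
    by (rule dep_child[where g="\<lambda>b x. 1 - (if b then q * x else 0)"])
       (rule dep_mono[OF dep_phi], simp)
  have fb: "0 \<le> ?f k \<omega>" "?f k \<omega> \<le> 1" for k \<omega>
    using phi_factor_bounds[OF assms(1,2), of "\<omega> (1, k)" m "shift 1 k \<omega>"] by linarith+
  have f_bd: "\<bar>?f k \<omega>\<bar> \<le> 1" for k \<omega>
    using phi_factor_bounds[OF assms(1,2), of "\<omega> (1, k)" m "shift 1 k \<omega>"] by linarith
  have phi_abs: "\<bar>phi q m \<omega>\<bar> \<le> 1" for \<omega> :: "'d node \<Rightarrow> bool"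
    using phi_bounds[OF assms(1,2), of m \<omega>] by linarith
  have E: "(\<integral>\<omega>. ?f k \<omega> \<partial>?M) = 1 - p * q * (\<integral>\<omega>. phi q m \<omega> \<partial>?M)" for k
  proof -
    have "(\<integral>\<omega>. of_bool (\<omega> (1, k)) * phi q m (shift 1 k \<omega>) \<partial>?M) =
      (\<integral>\<omega>. of_bool (\<omega> (1, k)) \<partial>?M) * (\<integral>\<omega>. phi q m (shift 1 k \<omega>) \<partial>?M)"
      by (rule expectation_mult_dep[OF coord meas _ _ dep_compose[OF dep_coordinate]
            dep_shift[OF dep_mono[OF dep_phi inf_le1]], where B=1])
         (use phi_abs in \<open>auto simp: shift_idx_def tree_nodes_def\<close>)
    moreover have "(\<integral>\<omega>. of_bool (\<omega> (1::nat, k)) \<partial>?M) = p"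
    proof -
      have "(\<integral>\<omega>. of_bool (\<omega> (1::nat, k)) \<partial>?M) = (\<integral>\<omega>. indicat_real {\<omega>. \<omega> (1, k)} \<omega> \<partial>?M)"
        by (simp add: indicator_def)
      also have "\<dots> = measure ?M {\<omega>. \<omega> (1, k)}"
        by simp
      finally show ?thesis using assms by (simp add: prob_coordinate)
    qed
    moreover have "integrable ?M (\<lambda>\<omega>. of_bool (\<omega> (1, k)) * phi q m (shift 1 k \<omega>))"
      by (rule integrable_unit_bounded)
         (use coord[of "(1, k)"] meas[of k] phi_bounds[OF assms(1,2)] in \<open>auto intro: mult_le_one\<close>)
    ultimately show ?thesis
      unfolding f_eq by (simp add: expectation_shift prob_space mult_ac)
  qed
  have "(\<integral>\<omega>. (\<Prod>k\<in>grid 1. ?f k \<omega>) \<partial>?M) = (\<Prod>k\<in>grid 1. \<integral>\<omega>. ?f k \<omega> \<partial>?M)"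
    by (rule expectation_prod_dep[OF finite_grid f_meas f_bd f_dep disjoint_child_nodes])
  also have "\<dots> = (1 - p * q * (\<integral>\<omega>. phi q m \<omega> \<partial>?M)) ^ (N ^ CARD('d))"
    by (simp only: E prod_constant card_grid power_one_right)
  finally have "(\<integral>\<omega>. (\<Prod>k\<in>grid 1. ?f k \<omega>) \<partial>?M) = (1 - p * q * (\<integral>\<omega>. phi q m \<omega> \<partial>?M)) ^ (N ^ CARD('d))" .
  moreover have "integrable ?M (\<lambda>\<omega>. \<Prod>k\<in>grid 1. ?f k \<omega>)"
  proof (rule integrable_unit_bounded)
    show "(\<lambda>\<omega>. \<Prod>k\<in>grid 1. ?f k \<omega>) \<in> borel_measurable ?M"
      by (rule borel_measurable_prod) (rule f_meas)
    show "0 \<le> (\<Prod>k\<in>grid 1. ?f k \<omega>)" "(\<Prod>k\<in>grid 1. ?f k \<omega>) \<le> 1" for \<omega>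
      by (intro prod_nonneg prod_le_1 conjI fb)+
  qed
  ultimately show ?thesis by (simp add: prob_space)
qed

text \<open>As \<open>phi q m\<close> decreases in \<open>m\<close>, this says that the limit is
  positive: given the configuration, the further percolation survives with positive
  probability.\<close>

definition phi_pos :: "real \<Rightarrow> ('d::finite node \<Rightarrow> bool) \<Rightarrow> bool" where
  "phi_pos q \<omega> \<longleftrightarrow> (\<exists>c>0. \<forall>m. c \<le> phi q m \<omega>)"

lemma phi_pos_sets: "{\<omega> :: 'd::finite node \<Rightarrow> bool. phi_pos q \<omega>} \<in> sets (BF p)"
proof -
  have "phi_pos q \<omega> \<longleftrightarrow> (\<exists>n::nat. \<forall>m. inverse (real (Suc n)) \<le> phi q m \<omega>)" for \<omega> :: "'d node \<Rightarrow> bool"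
  proof
    assume "phi_pos q \<omega>"
    then obtain c where c: "0 < c" "\<forall>m. c \<le> phi q m \<omega>" by (auto simp: phi_pos_def)
    obtain n where "inverse (real (Suc n)) < c" using reals_Archimedean[OF c(1)] by blast
    then show "\<exists>n::nat. \<forall>m. inverse (real (Suc n)) \<le> phi q m \<omega>" using c(2) by (meson less_imp_le order_trans)
  next
    assume "\<exists>n::nat. \<forall>m. inverse (real (Suc n)) \<le> phi q m \<omega>"
    then obtain n where "\<forall>m. inverse (real (Suc n)) \<le> phi q m \<omega>" by blast
    then show "phi_pos q \<omega>" unfolding phi_pos_def by (intro exI[of _ "inverse (real (Suc n))"]) simp
  qed
  then have "{\<omega> :: 'd node \<Rightarrow> bool. phi_pos q \<omega>} =
      {\<omega>\<in>space (BF p). \<exists>n::nat. \<forall>m. inverse (real (Suc n)) \<le> phi q m \<omega>}" by auto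
  also have "\<dots> \<in> sets (BF p)" by measurable
  finally show ?thesis .
qed

lemma dep_phi_pos: "dep tree_nodes (phi_pos q)"
proof (rule depI)
  fix \<omega> \<omega>' :: "'a node \<Rightarrow> bool" assume "\<And>x. x \<in> tree_nodes \<Longrightarrow> \<omega> x = \<omega>' x"
  then have "phi q m \<omega> = phi q m \<omega>'" for m by (intro depD[OF dep_phi]) auto
  then show "phi_pos q \<omega> = phi_pos q \<omega>'" by (simp add: phi_pos_def)
qed

lemma phi_pos_inherit:
  assumes "0 < q" "q \<le> 1" "k \<in> grid 1" "\<omega> (1, k)" "phi_pos q (shift 1 k \<omega>)"
  shows "phi_pos q \<omega>"
proof -
  obtain c where c: "0 < c" "\<And>m. c \<le> phi q m (shift 1 k \<omega>)" using assms(5) by (auto simp: phi_pos_def)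
  have c1: "c \<le> 1" using c(2)[of 0] by simp
  have q0: "0 \<le> q" using assms(1) by simp
  have "q * c \<le> phi q m \<omega>" for m
  proof (cases m)
    case (Suc n)
    let ?f = "\<lambda>k. 1 - (if \<omega> (1, k) then q * phi q n (shift 1 k \<omega>) else 0)"
    have f: "0 \<le> ?f k" "?f k \<le> 1" for k
      using phi_factor_bounds[OF q0 assms(2), of "\<omega> (1, k)" n "shift 1 k \<omega>"] by linarith+
    have "(\<Prod>k\<in>grid 1. ?f k) = ?f k * (\<Prod>k\<in>grid 1 - {k}. ?f k)"
      by (rule prod.remove[OF finite_grid assms(3)])
    also have "\<dots> \<le> ?f k * 1"
      using f by (intro mult_left_mono prod_le_1) auto
    also have "\<dots> \<le> 1 - q * c" using assms(1,4) c(2)[of n] by (simp add: mult_left_mono)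
    finally show ?thesis by (simp add: Suc)
  qed (use c1 assms(1,2) c(1) in \<open>auto intro: mult_le_one\<close>)
  then show ?thesis unfolding phi_pos_def using c(1) assms(1) by (intro exI[of _ "q * c"]) auto
qed

text \<open>The supersolution \<open>x\<close> keeps every expectation of \<open>phi q m\<close>
  above \<open>x\<close>. Since \<open>phi\<close> is at most 1, the event
  \<open>x / 2 \<le> phi q m\<close> has probability at least \<open>x / 2\<close> at every level,
  and these events decrease in \<open>m\<close>.\<close>

lemma phi_pos_prob:
  assumes p: "0 < p" "p \<le> 1" and q: "0 < q" "q \<le> 1" and mean: "1 < p * q * real (N ^ CARD('d::finite))"
  shows "measure (BF p) {\<omega> :: 'd node \<Rightarrow> bool. phi_pos q \<omega>} > 0"
proof -
  let ?M = "BF p :: ('d node \<Rightarrow> bool) measure"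
  interpret prob_space ?M by (rule prob_space_BF)
  have q0: "0 \<le> q" using q by simp
  obtain x where x: "0 < x" "x \<le> 1" "x \<le> 1 - (1 - p * q * x) ^ (N ^ CARD('d))"
    using branching_supersolution[OF mean] p q by (auto simp: mult_le_one)
  have E: "x \<le> (\<integral>\<omega>. phi q m \<omega> \<partial>?M)" for m
  proof (induction m)
    case 0
    then show ?case using x prob_space by simp
  next
    case (Suc m)
    have "(\<integral>\<omega>. phi q m \<omega> \<partial>?M) \<le> (\<integral>\<omega>. 1 \<partial>?M)"
      by (rule integral_mono) (use phi_bounds[OF q0 q(2)] in \<open>auto intro!: integrable_unit_bounded\<close>)
    then have I: "(\<integral>\<omega>. phi q m \<omega> \<partial>?M) \<le> 1" using prob_space by simp
    have "p * q * (\<integral>\<omega>. phi q m \<omega> \<partial>?M) \<le> 1"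
      using p q I Suc x by (intro mult_le_one) auto
    then have "(1 - p * q * (\<integral>\<omega>. phi q m \<omega> \<partial>?M)) ^ (N ^ CARD('d)) \<le> (1 - p * q * x) ^ (N ^ CARD('d))"
      using Suc p q by (intro power_mono) auto
    then show ?case using x p q by (subst expectation_phi_Suc) auto
  qed
  define B where "B m = {\<omega> \<in> space ?M. x / 2 \<le> phi q m \<omega>}" for m
  have B: "B m \<in> events" for m unfolding B_def by measurable
  have PB: "x / 2 \<le> prob (B m)" for m
  proof -
    have "x \<le> (\<integral>\<omega>. phi q m \<omega> \<partial>?M)" by (rule E)
    also have "\<dots> \<le> (\<integral>\<omega>. indicat_real (B m) \<omega> + x / 2 \<partial>?M)"
    proof (rule integral_mono)
      show "phi q m \<omega> \<le> indicat_real (B m) \<omega> + x / 2" for \<omega>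
        using phi_bounds[OF q0 q(2), of m \<omega>] x by (auto simp: B_def indicator_def)
    qed (use B phi_bounds[OF q0 q(2)] in \<open>auto intro!: integrable_unit_bounded simp: emeasure_eq_measure\<close>)
    also have "\<dots> = prob (B m) + x / 2"
      using B by (subst Bochner_Integration.integral_add) (auto simp: prob_space emeasure_eq_measure)
    finally show ?thesis by simp
  qed
  have dec: "decseq B"
    unfolding decseq_def B_def
    using decseqD[OF decseq_phi[OF q0 q(2)]] by (blast intro: order_trans)
  have "(\<lambda>m. prob (B m)) \<longlonglongrightarrow> prob (\<Inter>m. B m)"
    using B dec by (intro finite_Lim_measure_decseq) auto
  then have "x / 2 \<le> prob (\<Inter>m. B m)"
    by (rule LIMSEQ_le_const) (use PB in auto)
  also have "\<dots> \<le> prob {\<omega>. phi_pos q \<omega>}"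
    by (rule finite_measure_mono[OF _ phi_pos_sets])
       (use x in \<open>auto simp: B_def phi_pos_def intro!: exI[of _ "x / 2"]\<close>)
  finally show ?thesis using x by linarith
qed

section \<open>Cutsets of the retained tree\<close>

definition is_cutset :: "('d node \<Rightarrow> bool) \<Rightarrow> nat \<Rightarrow> 'd node set \<Rightarrow> bool" where
  "is_cutset \<omega> m V \<longleftrightarrow>
    (\<forall>j\<in>grid m. retained \<omega> m j \<longrightarrow> (\<exists>n\<le>m. (n, anc (m - n) j) \<in> V))"

text \<open>This is the union bound for the further percolation: to reach level \<open>m\<close> it
  has to keep some node of the cutset together with all ancestors of that node, which at level n has
  probability \<open>q ^ n\<close>. As \<open>phi\<close> is defined by recursion, the bound is
  obtained by distributing the cutset over the children.\<close>

lemma phi_le_cutset: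
  fixes \<omega> :: "'d::finite node \<Rightarrow> bool"
  assumes q: "0 \<le> q" "q \<le> 1"
  shows "finite V \<Longrightarrow> is_cutset \<omega> m V \<Longrightarrow> phi q m \<omega> \<le> (\<Sum>v\<in>V. q ^ fst v)"
proof (induction m arbitrary: \<omega> V)
  case 0
  then have "(0, \<lambda>_. 0) \<in> V" by (auto simp: is_cutset_def)
  then have "q ^ fst (0::nat, \<lambda>_::'d. 0::int) \<le> (\<Sum>v\<in>V. q ^ fst v)"
    using q by (intro member_le_sum 0) auto
  then show ?case by simp
next
  case (Suc m)
  show ?case
  proof (cases "(0, \<lambda>_. 0) \<in> V")
    case True
    then have "q ^ fst (0::nat, \<lambda>_::'d. 0::int) \<le> (\<Sum>v\<in>V. q ^ fst v)"
      using q by (intro member_le_sum Suc) auto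
    then show ?thesis using phi_bounds(2)[OF q, of "Suc m" \<omega>] by (simp del: phi.simps)
  next
    case False
    \<comment> \<open>\<open>W k\<close> is the part of \<open>V\<close> at or below the child
      \<open>k\<close>, seen with \<open>k\<close> as new root. The grid condition excludes
      neighbours' nodes, so the parts of different children stay disjoint.\<close>
    define W where "W k = {v. shift_idx 1 k v \<in> V \<and> snd v \<in> grid (fst v)}" for k
    have W_img: "shift_idx 1 k ` W k \<subseteq> V" for k by (auto simp: W_def)
    have inj: "inj_on (shift_idx 1 k) (W k)" for k by (rule inj_on_subset[OF inj_shift_idx]) simp
    have finW: "finite (W k)" for k
      using finite_imageD[OF finite_subset[OF W_img Suc.prems(1)] inj] .
    have disj: "shift_idx 1 k ` W k \<inter> shift_idx 1 k' ` W k' = {}" if "k \<noteq> k'" for k k'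
    proof -
      have "anc (fst x - 1) (snd x) = k" if "x \<in> shift_idx 1 k ` W k" for x k
        using that by (auto simp: W_def shift_idx_def anc_sub_grid)
      then show ?thesis using \<open>k \<noteq> k'\<close> by (metis disjoint_iff)
    qed
    have cut: "is_cutset (shift 1 k \<omega>) m (W k)" if k: "k \<in> grid 1" "\<omega> (1, k)" for k
      unfolding is_cutset_def
    proof (intro ballI impI)
      fix j assume j: "j \<in> grid m" "retained (shift 1 k \<omega>) m j"
      have "sub m k j \<in> grid (1 + m)" "retained \<omega> (1 + m) (sub m k j)"
        using sub_in_grid[OF k(1) j(1)] retained_sub_grid[OF j(1), of \<omega> 1 k] k(2) j(2)
        by (auto simp: retained_1)
      then obtain n where n: "n \<le> Suc m" "(n, anc (Suc m - n) (sub m k j)) \<in> V"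
        using Suc.prems(2) unfolding is_cutset_def plus_1_eq_Suc by blast
      have "n \<noteq> 0"
      proof
        assume "n = 0"
        then have "(0, anc (1 + m) (sub m k j)) \<in> V" using n by (simp add: plus_1_eq_Suc)
        then show False
          using False anc_grid_0[OF \<open>sub m k j \<in> grid (1 + m)\<close>] by simp
      qed
      then obtain n' where n': "n = Suc n'" by (cases n) auto
      then have "anc (Suc m - n) (sub m k j) = sub n' k (anc (m - n') j)"
        using n(1) by (simp add: anc_sub)
      moreover have "anc (m - n') j \<in> grid n'"
        using anc_in_grid[of j n' "m - n'"] j(1) n(1) n' by simp
      ultimately have "(n', anc (m - n') j) \<in> W k"
        using n n' by (simp add: W_def shift_idx_def plus_1_eq_Suc)
      then show "\<exists>n\<le>m. (n, anc (m - n) j) \<in> W k" using n n' by auto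
    qed
    let ?a = "\<lambda>k. if \<omega> (1, k) then q * phi q m (shift 1 k \<omega>) else 0"
    have "phi q (Suc m) \<omega> = 1 - (\<Prod>k\<in>grid 1. 1 - ?a k)" by simp
    also have "\<dots> \<le> (\<Sum>k\<in>grid 1. ?a k)"
    proof -
      have "1 - (\<Sum>k\<in>grid 1. ?a k) \<le> (\<Prod>k\<in>grid 1. 1 - ?a k)"
        by (rule Weierstrass_prod_ineq) (unfold atLeastAtMost_iff, intro conjI phi_factor_bounds[OF q])
      then show ?thesis by linarith
    qed
    also have "\<dots> \<le> (\<Sum>k\<in>grid 1. \<Sum>v\<in>shift_idx 1 k ` W k. q ^ fst v)"
    proof (rule sum_mono)
      fix k :: "'d \<Rightarrow> int" assume k: "k \<in> grid 1"
      have eq: "(\<Sum>v\<in>shift_idx 1 k ` W k. q ^ fst v) = q * (\<Sum>v\<in>W k. q ^ fst v)"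
        by (subst sum.reindex[OF inj]) (auto simp: sum_distrib_left shift_idx_def power_add intro!: sum.cong)
      show "?a k \<le> (\<Sum>v\<in>shift_idx 1 k ` W k. q ^ fst v)"
        unfolding eq using Suc.IH[OF finW cut[OF k]] q
        by (auto intro!: mult_left_mono sum_nonneg mult_nonneg_nonneg)
    qed
    also have "\<dots> = (\<Sum>v\<in>(\<Union>k\<in>grid 1. shift_idx 1 k ` W k). q ^ fst v)"
      using finW disj by (intro sum.UNION_disjoint[symmetric] finite_grid) auto
    also have "\<dots> \<le> (\<Sum>v\<in>V. q ^ fst v)"
      using W_img q by (intro sum_mono2 Suc.prems) auto
    finally show ?thesis .
  qed
qed

lemma phi_pos_survives:
  assumes "0 \<le> q" "q \<le> 1" "phi_pos q \<omega>"
  shows "survives \<omega>"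
proof (rule ccontr)
  assume "\<not> survives \<omega>"
  then obtain m where "is_cutset \<omega> m {}" unfolding survives_def is_cutset_def by blast
  then have "phi q m \<omega> \<le> 0" using phi_le_cutset[OF assms(1,2), of "{}" \<omega> m] by simp
  then show False using assms(3) unfolding phi_pos_def by (meson not_le order_less_le_trans)
qed

lemma AE_phi_pos:
  assumes p: "0 < p" "p \<le> 1" and q: "0 < q" "q \<le> 1" and mean: "1 < p * q * real (N ^ CARD('d::finite))"
  shows "AE \<omega> in (BF p :: ('d node \<Rightarrow> bool) measure). survives \<omega> \<longrightarrow> phi_pos q \<omega>"
  by (rule zero_one_law[OF p phi_pos_sets dep_phi_pos phi_pos_inherit[OF q] phi_pos_survives phi_pos_prob[OF p q mean]])
     (use q in auto)

end

section \<open>The limit set\<close>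

lemma INF_less_ennreal_ex:
  fixes f :: "'a \<Rightarrow> ennreal"
  assumes "(INF x\<in>A. f x) = 0" "0 < e"
  shows "\<exists>x\<in>A. f x < e"
  using assms by (metis INF_less_iff)

context perc
begin

abbreviation S :: "nat \<Rightarrow> real" where "S m \<equiv> real N ^ m"

lemma N_pos [simp]: "0 < N" "N \<noteq> 0"
  using N2 by auto

lemma S_pos: "0 < S m" "S m \<noteq> 0" "0 \<le> S m"
  by auto

lemma real_of_L [simp]: "real_of_int (L m) = S m"
  by simp

definition cell :: "nat \<Rightarrow> ('d::finite \<Rightarrow> int) \<Rightarrow> (real^'d) set" where
  "cell m j = cbox (\<chi> i. real_of_int (j i) / S m) (\<chi> i. (real_of_int (j i) + 1) / S m)"

definition level_set :: "('d::finite node \<Rightarrow> bool) \<Rightarrow> nat \<Rightarrow> (real^'d) set" where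
  "level_set \<omega> m = (\<Union>j\<in>{j \<in> grid m. retained \<omega> m j}. cell m j)"

definition lim_set :: "('d::finite node \<Rightarrow> bool) \<Rightarrow> (real^'d) set" where
  "lim_set \<omega> = (\<Inter>m. level_set \<omega> m)"

lemma mem_cell:
  "x \<in> cell m j \<longleftrightarrow> (\<forall>i. real_of_int (j i) \<le> x $ i * S m \<and> x $ i * S m \<le> real_of_int (j i) + 1)"
  by (simp add: cell_def mem_box_cart field_simps)

lemma corner_in_cell: "(\<chi> i. real_of_int (j i) / S m) \<in> cell m j"
  by (simp add: mem_cell)

lemma compact_cell: "compact (cell m j)"
  by (simp add: cell_def compact_cbox)

lemma cell_anc:
  assumes "x \<in> cell (n + m) j"
  shows "x \<in> cell n (anc m j)"
  unfolding mem_cell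
proof
  fix i
  define a where "a = j i div L m"
  have "a * L m \<le> j i" "j i + 1 \<le> (a + 1) * L m"
  proof -
    show "a * L m \<le> j i"
      using pos_mod_sign[OF L_pos(1)[of m], of "j i"] by (simp add: a_def minus_mod_eq_div_mult[symmetric])
    have "j i = a * L m + j i mod L m" unfolding a_def by (rule div_mult_mod_eq[symmetric])
    moreover have "j i mod L m < L m" by (rule pos_mod_bound[OF L_pos(1)])
    moreover have "(a + 1) * L m = a * L m + L m" by (simp add: algebra_simps)
    ultimately show "j i + 1 \<le> (a + 1) * L m" by linarith
  qed
  then have "real_of_int (a * L m) \<le> real_of_int (j i)" "real_of_int (j i + 1) \<le> real_of_int ((a + 1) * L m)"
    by (simp_all only: of_int_le_iff)
  then have "real_of_int a * S m \<le> real_of_int (j i)" "real_of_int (j i) + 1 \<le> (real_of_int a + 1) * S m"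
    by simp_all
  moreover have "real_of_int (j i) \<le> x $ i * S n * S m" "x $ i * S n * S m \<le> real_of_int (j i) + 1"
    using assms by (auto simp: mem_cell power_add mult.assoc)
  ultimately have "real_of_int a * S m \<le> x $ i * S n * S m" "x $ i * S n * S m \<le> (real_of_int a + 1) * S m"
    by linarith+
  then show "real_of_int (anc m j i) \<le> x $ i * S n \<and> x $ i * S n \<le> real_of_int (anc m j i) + 1"
    using S_pos(1)[of m] by (simp only: mult_le_cancel_right_pos) (simp add: a_def anc_def)
qed

lemma level_setE:
  assumes "x \<in> level_set \<omega> m"
  obtains j where "j \<in> grid m" "retained \<omega> m j" "x \<in> cell m j"
  using assms by (auto simp: level_set_def)

lemma level_setI: "j \<in> grid m \<Longrightarrow> retained \<omega> m j \<Longrightarrow> x \<in> cell m j \<Longrightarrow> x \<in> level_set \<omega> m"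
  by (auto simp: level_set_def)

lemma level_set_antimono: "n \<le> m \<Longrightarrow> level_set \<omega> m \<subseteq> level_set \<omega> n"
proof
  fix x assume "n \<le> m" "x \<in> level_set \<omega> m"
  then obtain j where j: "j \<in> grid (n + (m - n))" "retained \<omega> (n + (m - n)) j" "x \<in> cell (n + (m - n)) j"
    by (auto elim: level_setE)
  then show "x \<in> level_set \<omega> n"
    using anc_in_grid retained_anc cell_anc by (intro level_setI[of "anc (m - n) j"])
qed

lemma compact_level_set: "compact (level_set \<omega> m)"
  unfolding level_set_def
  by (rule compact_UN) (auto intro: finite_subset[OF _ finite_grid] compact_cell)

lemma compact_lim_set: "compact (lim_set \<omega>)"
  unfolding lim_set_def using compact_level_set by (intro compact_Inter) auto

text \<open>The sets \<open>level_set \<omega> m - U\<close> are nested, compact and have empty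
  intersection. Open conditions on the limit set thereby become conditions on a single
  level.\<close>

lemma level_set_subset_open:
  assumes "lim_set \<omega> \<subseteq> U" "open U"
  shows "\<exists>m. level_set \<omega> m \<subseteq> U"
proof (rule ccontr)
  assume *: "\<not> ?thesis"
  have "(\<Inter>m. level_set \<omega> m - U) \<noteq> {}"
  proof (rule compact_nest)
    show "compact (level_set \<omega> m - U)" for m
      using assms compact_level_set by (intro compact_diff) auto
    show "level_set \<omega> m - U \<noteq> {}" for m using * by auto
  qed (use level_set_antimono in blast)
  then show False using assms(1) by (auto simp: lim_set_def)
qed

lemma lim_set_nonempty_iff: "lim_set \<omega> \<noteq> {} \<longleftrightarrow> survives \<omega>"
proof
  assume "lim_set \<omega> \<noteq> {}"
  then show "survives \<omega>" by (auto simp: lim_set_def survives_def level_set_def)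
next
  assume s: "survives \<omega>"
  show "lim_set \<omega> \<noteq> {}"
  proof
    assume "lim_set \<omega> = {}"
    then obtain m where "level_set \<omega> m = {}" using level_set_subset_open[of \<omega> "{}"] by auto
    then show False using s corner_in_cell by (force simp: survives_def level_set_def)
  qed
qed

definition zoom :: "nat \<Rightarrow> ('d::finite \<Rightarrow> int) \<Rightarrow> real^'d \<Rightarrow> real^'d" where
  "zoom n k x = (\<chi> i. (real_of_int (k i) + x $ i) / S n)"

lemma zoom_in_cell: "zoom n k x \<in> cell (n + m) (sub m k j) \<longleftrightarrow> x \<in> cell m j"
proof -
  have "(real_of_int (k i) + x $ i) / S n * S (n + m) = real_of_int (k i) * S m + x $ i * S m" for i
    by (simp add: power_add field_simps)
  then show ?thesis by (simp add: mem_cell zoom_def sub_def add.assoc)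
qed

lemma zoom_in_cell_0: "x \<in> cell 0 (\<lambda>_. 0) \<Longrightarrow> zoom n k x \<in> cell n k"
  using zoom_in_cell[of n k x 0 "\<lambda>_. 0"] by simp

lemma inj_zoom: "inj (zoom n k)"
  by (auto simp: inj_def zoom_def vec_eq_iff)

lemma continuous_on_zoom: "continuous_on A (zoom n k)"
  unfolding zoom_def by (intro continuous_intros) auto

lemma lim_set_subset_unit: "lim_set \<omega> \<subseteq> cell 0 (\<lambda>_. 0)"
  by (auto simp: lim_set_def level_set_def dest!: spec[of _ 0])

text \<open>Only an inclusion is stated: a point on the face of a cell may belong to the limit set
  through a neighbouring cell.\<close>

lemma zoom_lim_set:
  assumes "k \<in> grid n" "retained \<omega> n k"
  shows "zoom n k ` lim_set (shift n k \<omega>) \<subseteq> lim_set \<omega> \<inter> cell n k"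
proof (rule image_subsetI, rule IntI)
  fix x assume x: "x \<in> lim_set (shift n k \<omega>)"
  have "zoom n k x \<in> level_set \<omega> m" for m
  proof -
    have "x \<in> level_set (shift n k \<omega>) m" using x by (auto simp: lim_set_def)
    then obtain j where "j \<in> grid m" "retained (shift n k \<omega>) m j" "x \<in> cell m j" by (rule level_setE)
    then have "zoom n k x \<in> level_set \<omega> (n + m)"
      using assms by (intro level_setI[of "sub m k j"]) (auto simp: sub_in_grid retained_sub_grid zoom_in_cell)
    then show ?thesis using level_set_antimono[of m "n + m" \<omega>] by auto
  qed
  then show "zoom n k x \<in> lim_set \<omega>" by (simp add: lim_set_def)
  show "zoom n k x \<in> cell n k" using x lim_set_subset_unit zoom_in_cell_0 by blast
qed

lemma cell_coordinates_close:
  assumes "x \<in> cell m j" "y \<in> cell m j"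
  shows "\<bar>x $ i - y $ i\<bar> \<le> 1 / S m"
proof -
  have "\<bar>x $ i * S m - y $ i * S m\<bar> \<le> 1" using assms by (auto simp: mem_cell abs_le_iff) (smt (verit))+
  then have "\<bar>x $ i - y $ i\<bar> * S m \<le> 1"
    by (metis S_pos(3) abs_mult abs_of_nonneg left_diff_distrib)
  then show ?thesis by (simp add: field_simps)
qed

lemma cell_dist_le:
  fixes x y :: "real^'d::finite"
  shows "x \<in> cell m j \<Longrightarrow> y \<in> cell m j \<Longrightarrow> dist x y \<le> real CARD('d) * (1 / S m)"
  by (intro dist_le_coordinates cell_coordinates_close)

lemma inverse_S_tendsto_0: "(\<lambda>m. 1 / S m) \<longlonglongrightarrow> 0"
proof -
  have "(\<lambda>m. inverse (S m)) \<longlonglongrightarrow> 0"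
    using N2 by (intro LIMSEQ_inverse_realpow_zero) auto
  then show ?thesis by (simp add: inverse_eq_divide)
qed

lemma ex_inverse_S_less: "0 < e \<Longrightarrow> \<exists>m. 1 / S m < e"
  using order_tendstoD(2)[OF inverse_S_tendsto_0, of e] by (auto simp: eventually_sequentially)

end

section \<open>From Hausdorff covers to cutsets\<close>

lemma ennreal_sum_less_real:
  assumes "(\<Sum>i. ennreal (f i)) < ennreal e" "\<And>i. 0 \<le> f i" "finite I" "0 < e"
  shows "(\<Sum>i\<in>I. f i) < e"
proof -
  have "ennreal (\<Sum>i\<in>I. f i) = (\<Sum>i\<in>I. ennreal (f i))"
    using assms by simp
  also have "\<dots> \<le> (\<Sum>i. ennreal (f i))"
    by (rule sum_le_suminf) (use assms in auto)
  also have "\<dots> < ennreal e" by (rule assms)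
  finally show ?thesis using assms by (simp add: ennreal_less_iff sum_nonneg)
qed

lemma diam_gauge_pos: "0 < s \<Longrightarrow> diam_gauge s U = ennreal (diameter U powr s)"
  by (simp add: diam_gauge_def)

lemma hausdorff_null_cover:
  assumes "hausdorff_measure s F = 0" "0 < s" "0 < e" "0 < \<delta>"
  shows "\<exists>U :: nat \<Rightarrow> 'a::metric_space set. F \<subseteq> (\<Union>i. U i) \<and> (\<forall>i. bounded (U i) \<and> diameter (U i) \<le> \<delta>)
    \<and> (\<Sum>i. ennreal (diameter (U i) powr s)) < ennreal e"
proof -
  have "hausdorff_premeasure s \<delta> F \<le> hausdorff_measure s F"
    unfolding hausdorff_measure_def using assms by (intro SUP_upper) auto
  then have "hausdorff_premeasure s \<delta> F = 0" using assms(1) by simp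
  then have "\<exists>U\<in>{U :: nat \<Rightarrow> 'a set. F \<subseteq> (\<Union>i. U i) \<and> (\<forall>i. bounded (U i) \<and> diameter (U i) \<le> \<delta>)}.
      (\<Sum>i. diam_gauge s (U i)) < ennreal e"
    unfolding hausdorff_premeasure_def using assms(3) by (intro INF_less_ennreal_ex) auto
  then show ?thesis using assms(2) by (auto simp: diam_gauge_pos)
qed

lemma sum_UNION_le:
  fixes f :: "'b \<Rightarrow> real"
  assumes "finite I" "\<And>i. i \<in> I \<Longrightarrow> finite (A i)" "\<And>x. 0 \<le> f x"
  shows "sum f (\<Union>i\<in>I. A i) \<le> (\<Sum>i\<in>I. sum f (A i))"
  using assms(1,2)
proof (induction I)
  case (insert i I)
  have "sum f (A i \<union> (\<Union>i\<in>I. A i)) = sum f (A i) + sum f ((\<Union>i\<in>I. A i) - A i)"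
    using insert by (subst sum.union_disjoint[symmetric]) (auto intro!: sum.cong)
  also have "\<dots> \<le> sum f (A i) + sum f (\<Union>i\<in>I. A i)"
    using insert assms(3) by (intro add_left_mono sum_mono2) auto
  finally show ?case using insert by simp
qed simp

lemma card_int_box:
  "card (PiE UNIV (\<lambda>c::'d::finite. {l c - 3..l c + (2::int)})) = 6 ^ CARD('d)"
  by (subst card_PiE) auto

context perc
begin

lemma S_powr: "S n powr s = (real N powr s) ^ n"
  by (simp add: powr_powr mult.commute flip: powr_realpow)

text \<open>For t > 0 take the finest grid scale not below \<open>t\<close>. It is less than
  \<open>N * t\<close>, so rounding costs only the factor \<open>N powr s\<close>. For
  \<open>t = 0\<close> there is no finest scale, and the slack \<open>e\<close> takes over.\<close>

lemma ex_scale: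
  assumes s: "0 < s" and t: "0 \<le> t" "t \<le> 1" and e: "0 < e"
  shows "\<exists>n. t \<le> 1 / S n \<and> (1 / real N powr s) ^ n \<le> real N powr s * t powr s + e"
proof (cases "t = 0")
  case True
  have "1 < real N powr s" using N2 s by (intro gr_one_powr) auto
  then obtain n where "(1 / real N powr s) ^ n < e"
    using real_arch_pow_inv[OF e, of "1 / real N powr s"] by auto
  then show ?thesis using True by (intro exI[of _ n]) auto
next
  case False
  then have t0: "0 < t" using t by simp
  obtain m where "1 / S m < t" using ex_inverse_S_less[OF t0] by blast
  define n where "n = (LEAST m. 1 / S m < t)"
  have n: "1 / S n < t" unfolding n_def by (rule LeastI) fact
  have "n \<noteq> 0" using n t by (intro notI) simp
  then obtain k where k: "n = Suc k" by (cases n) auto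
  have "\<not> 1 / S k < t" using not_less_Least[of k "\<lambda>m. 1 / S m < t"] k n_def by simp
  then have 1: "t \<le> 1 / S k" by simp
  have "(1 / real N powr s) ^ k = real N powr s * (1 / S n) powr s"
    unfolding k powr_divide S_powr powr_one_eq_one power_divide power_one by simp
  also have "\<dots> \<le> real N powr s * t powr s"
    using n s by (intro mult_left_mono powr_mono2) auto
  finally show ?thesis using 1 e by (intro exI[of _ k]) auto
qed

text \<open>Every point of the enlarged set lies within two cell widths of a fixed point of
  \<open>U\<close>. Each index coordinate then ranges over floor - 3 to floor + 2, which are six
  values.\<close>

lemma cells_near_finite:
  fixes U :: "(real^'d::finite) set"
  assumes "bounded U" "diameter U \<le> 1 / S n"
  defines "V \<equiv> {k. cell n k \<inter> (\<Union>u\<in>U. ball u (1 / S n)) \<noteq> {}}"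
  shows "finite V \<and> card V \<le> 6 ^ CARD('d)"
proof (cases "U = {}")
  case True
  then have "V = {}" by (simp add: V_def)
  then show ?thesis by simp
next
  case False
  then obtain u0 where u0: "u0 \<in> U" by blast
  let ?B = "PiE UNIV (\<lambda>c. {\<lfloor>u0 $ c * S n\<rfloor> - 3..\<lfloor>u0 $ c * S n\<rfloor> + 2})"
  have "V \<subseteq> ?B"
  proof
    fix k assume "k \<in> V"
    then obtain x u where x: "x \<in> cell n k" "u \<in> U" "dist u x < 1 / S n" by (auto simp: V_def)
    have "k c \<in> {\<lfloor>u0 $ c * S n\<rfloor> - 3..\<lfloor>u0 $ c * S n\<rfloor> + 2}" for c
    proof -
      have "dist u0 u \<le> 1 / S n"
        using diameter_bounded_bound[OF assms(1) u0 x(2)] assms(2) by linarith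
      then have "dist u0 x < 2 / S n"
        using x(3) dist_triangle[of u0 x u] add_divide_distrib[of 1 1 "S n"] by simp
      moreover have "\<bar>u0 $ c - x $ c\<bar> \<le> dist u0 x"
        using component_le_norm_cart[of "u0 - x" c] by (simp add: dist_norm)
      ultimately have "\<bar>u0 $ c - x $ c\<bar> < 2 / S n" by linarith
      then have "\<bar>u0 $ c - x $ c\<bar> * S n < 2" by (simp add: field_simps)
      then have "\<bar>u0 $ c * S n - x $ c * S n\<bar> < 2"
        by (metis S_pos(3) abs_mult abs_of_nonneg left_diff_distrib)
      moreover have "real_of_int (k c) \<le> x $ c * S n" "x $ c * S n \<le> real_of_int (k c) + 1"
        using x(1) by (auto simp: mem_cell)
      ultimately have "real_of_int (k c) < u0 $ c * S n + 2" "u0 $ c * S n - 3 < real_of_int (k c)" by linarith+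
      then show ?thesis by simp linarith
    qed
    then show "k \<in> ?B" by (auto simp: PiE_iff)
  qed
  moreover have fin: "finite ?B" by (intro finite_PiE) auto
  ultimately have "finite V \<and> card V \<le> card ?B" by (intro conjI finite_subset[of V ?B] card_mono)
  then show ?thesis by (simp only: card_int_box simp_thms)
qed

text \<open>With \<open>q = N powr (- s)\<close> the weight \<open>q ^ n\<close> of a node is the
  \<open>s\<close>-th power of the side of its cube, so cutset sums and Hausdorff sums are
  comparable. Covers of arbitrarily small sum become cutsets of arbitrarily small weight, which a
  positive lower bound of \<open>phi\<close> forbids.\<close>

theorem hausdorff_null_imp_not_phi_pos:
  fixes \<omega> :: "'d::finite node \<Rightarrow> bool"
  assumes s: "0 < s" and null: "hausdorff_measure s (lim_set \<omega>) = 0"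
  shows "\<not> phi_pos (1 / real N powr s) \<omega>"
proof
  let ?q = "1 / real N powr s"
  assume "phi_pos ?q \<omega>"
  then obtain c where c: "0 < c" "\<And>m. c \<le> phi ?q m \<omega>" by (auto simp: phi_pos_def)
  have N1: "1 < real N powr s" using N2 s by (intro gr_one_powr) auto
  then have q: "0 \<le> ?q" "?q \<le> 1" by auto
  \<comment> \<open>\<open>K\<close> collects all losses: at most \<open>6 ^ CARD('d)\<close> cells
    per covering set, the factor \<open>N powr s\<close> of \<open>ex_scale\<close>, and 1 for the
    total of the slacks. With \<open>e = c / (2 * K)\<close> the final bound is
    \<open>c / 2\<close>.\<close>
  define K where "K = 6 ^ CARD('d) * (real N powr s + 1)"
  have K: "0 < K" unfolding K_def using N1 by (intro mult_pos_pos) auto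
  define e where "e = c / (2 * K)"
  have e: "0 < e" using c K by (simp add: e_def)
  obtain U :: "nat \<Rightarrow> (real^'d) set" where U': "lim_set \<omega> \<subseteq> (\<Union>i. U i) \<and>
      (\<forall>i. bounded (U i) \<and> diameter (U i) \<le> 1) \<and> (\<Sum>i. ennreal (diameter (U i) powr s)) < ennreal e"
    using hausdorff_null_cover[OF null s e zero_less_one] by (rule exE)
  then have U: "lim_set \<omega> \<subseteq> (\<Union>i. U i)" "\<And>i. bounded (U i)"
      "\<And>i. diameter (U i) \<le> 1" "(\<Sum>i. ennreal (diameter (U i) powr s)) < ennreal e"
    by (elim conjE; simp only:)+
  have "\<exists>n. diameter (U i) \<le> 1 / S n \<and>
      ?q ^ n \<le> real N powr s * diameter (U i) powr s + e * (1 / 2) ^ Suc i" for i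
    using ex_scale[OF s diameter_ge_0[OF U(2)] U(3)] e by simp
  then obtain n where n: "\<And>i. diameter (U i) \<le> 1 / S (n i)"
      "\<And>i. ?q ^ n i \<le> real N powr s * diameter (U i) powr s + e * (1 / 2) ^ Suc i" by metis
  \<comment> \<open>Enlarging the covering sets by one cell width makes them open, so that
    compactness leaves finitely many; the enlargement is the one counted by
    \<open>cells_near_finite\<close>.\<close>
  define W where "W i = (\<Union>u\<in>U i. ball u (1 / S (n i)))" for i
  have openW: "open (W i)" for i by (auto simp: W_def)
  have UW: "U i \<subseteq> W i" for i by (auto simp: W_def)
  have "lim_set \<omega> \<subseteq> (\<Union>i. W i)" using U(1) UW by blast
  then obtain I where I: "finite I" "lim_set \<omega> \<subseteq> (\<Union>i\<in>I. W i)"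
    by (rule compactE_image[OF compact_lim_set openW]) auto
  obtain m0 where m0: "level_set \<omega> m0 \<subseteq> (\<Union>i\<in>I. W i)"
    using level_set_subset_open[OF I(2) open_UN] openW by auto
  define m where "m = Max (insert m0 (n ` I))"
  have m: "m0 \<le> m" "\<And>i. i \<in> I \<Longrightarrow> n i \<le> m" using I(1) by (auto simp: m_def)
  define V where "V i = {k. cell (n i) k \<inter> W i \<noteq> {}}" for i
  have V: "finite (V i)" "card (V i) \<le> 6 ^ CARD('d)" for i
    using cells_near_finite[OF U(2) n(1), of i] by (auto simp: V_def W_def)
  have cut: "is_cutset \<omega> m (\<Union>i\<in>I. Pair (n i) ` V i)"
    unfolding is_cutset_def
  proof (intro ballI impI)
    fix j :: "'d \<Rightarrow> int" assume j: "j \<in> grid m" "retained \<omega> m j"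
    \<comment> \<open>The corner of a retained cell need not belong to the limit set, but it belongs
      to \<open>level_set \<omega> m0\<close>; hence the cover was first extended to a whole
      level.\<close>
    let ?x = "\<chi> i. real_of_int (j i) / S m"
    have "?x \<in> level_set \<omega> m0"
      by (rule subsetD[OF level_set_antimono[OF m(1)] level_setI[OF j corner_in_cell]])
    then obtain i where i: "i \<in> I" "?x \<in> W i" using m0 by blast
    have "?x \<in> cell (n i) (anc (m - n i) j)"
      using m(2)[OF i(1)] corner_in_cell[of j m] by (intro cell_anc) simp
    then have "anc (m - n i) j \<in> V i" using i(2) by (auto simp: V_def)
    then show "\<exists>l\<le>m. (l, anc (m - l) j) \<in> (\<Union>i\<in>I. Pair (n i) ` V i)"
      using i(1) m(2) by blast
  qed
  have "phi ?q m \<omega> \<le> (\<Sum>v\<in>(\<Union>i\<in>I. Pair (n i) ` V i). ?q ^ fst v)"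
    by (rule phi_le_cutset[OF q _ cut]) (use I V in auto)
  also have "\<dots> \<le> (\<Sum>i\<in>I. \<Sum>v\<in>Pair (n i) ` V i. ?q ^ fst v)"
    using I(1) V q by (intro sum_UNION_le) auto
  also have "\<dots> \<le> (\<Sum>i\<in>I. 6 ^ CARD('d) * ?q ^ n i)"
  proof (rule sum_mono)
    fix i assume "i \<in> I"
    have "(\<Sum>v\<in>Pair (n i) ` V i. ?q ^ fst v) = real (card (V i)) * ?q ^ n i"
      by (subst sum.reindex) (auto simp: inj_on_def)
    also have "\<dots> \<le> real (6 ^ CARD('d)) * ?q ^ n i"
      using V(2)[of i] q by (intro mult_right_mono) (simp_all only: of_nat_le_iff zero_le_power)
    finally show "(\<Sum>v\<in>Pair (n i) ` V i. ?q ^ fst v) \<le> 6 ^ CARD('d) * ?q ^ n i" by simp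
  qed
  also have "\<dots> \<le> (\<Sum>i\<in>I. 6 ^ CARD('d) * (real N powr s * diameter (U i) powr s + e * (1 / 2) ^ Suc i))"
    using n(2) by (intro sum_mono mult_left_mono) auto
  also have "\<dots> = 6 ^ CARD('d) * (real N powr s * (\<Sum>i\<in>I. diameter (U i) powr s) + e * (\<Sum>i\<in>I. (1 / 2) ^ Suc i))"
    by (simp add: sum_distrib_left sum.distrib distrib_left)
  also have "\<dots> \<le> 6 ^ CARD('d) * (real N powr s * e + e * 1)"
  proof (intro mult_left_mono add_mono)
    show "(\<Sum>i\<in>I. diameter (U i) powr s) \<le> e"
      using ennreal_sum_less_real[OF U(4) _ I(1) e] by simp
    have "(\<Sum>i\<in>I. (1 / 2::real) ^ Suc i) \<le> (\<Sum>i. (1 / 2::real) ^ Suc i)"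
      using power_half_series I(1) by (intro sum_le_suminf) (auto simp: sums_iff)
    also have "\<dots> = 1" using power_half_series by (simp add: sums_iff)
    finally show "(\<Sum>i\<in>I. (1 / 2::real) ^ Suc i) \<le> 1" .
  qed (use e N1 in auto)
  also have "\<dots> = K * e" by (simp add: K_def algebra_simps)
  also have "\<dots> = c / 2" using K by (simp add: e_def)
  finally show False using c(1) c(2)[of m] by linarith
qed

end

section \<open>Hausdorff and box dimensions\<close>

text \<open>For \<open>s > 0\<close> the summands agree with \<open>diam_gauge s\<close>: the empty
  set has diameter 0 and \<open>0 powr s = 0\<close>.\<close>

definition cover_within :: "real \<Rightarrow> real \<Rightarrow> real \<Rightarrow> 'a::metric_space set \<Rightarrow> (nat \<Rightarrow> 'a set) \<Rightarrow> bool" where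
  "cover_within s \<delta> e F U \<longleftrightarrow> F \<subseteq> (\<Union>i. U i) \<and> (\<forall>i. bounded (U i) \<and> diameter (U i) \<le> \<delta>) \<and>
    (\<Sum>i. ennreal (diameter (U i) powr s)) \<le> ennreal e"

lemma hausdorff_nullI:
  fixes F :: "'a::metric_space set"
  assumes s: "0 < s" and cov: "\<And>e \<delta>. 0 < e \<Longrightarrow> 0 < \<delta> \<Longrightarrow> \<exists>U. cover_within s \<delta> e F U"
  shows "hausdorff_measure s F = 0"
proof -
  have "hausdorff_premeasure s \<delta> F \<le> 0" if d: "0 < \<delta>" for \<delta>
  proof (rule ennreal_le_epsilon)
    fix e :: real assume e: "0 < e"
    obtain U where U: "cover_within s \<delta> e F U" using cov[OF e d] by (rule exE)
    have "hausdorff_premeasure s \<delta> F \<le> (\<Sum>i. diam_gauge s (U i))"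
      unfolding hausdorff_premeasure_def by (rule INF_lower) (use U in \<open>simp add: cover_within_def\<close>)
    also have "\<dots> \<le> ennreal e" using U s by (simp add: diam_gauge_pos cover_within_def)
    finally show "hausdorff_premeasure s \<delta> F \<le> 0 + ennreal e" by simp
  qed
  then have "hausdorff_measure s F \<le> 0"
    unfolding hausdorff_measure_def by (intro SUP_least) simp
  then show ?thesis by simp
qed

lemma hausdorff_nullE:
  fixes F :: "'a::metric_space set"
  assumes "hausdorff_measure s F = 0" "0 < s" "0 < e" "0 < \<delta>"
  obtains U where "cover_within s \<delta> e F U"
proof -
  obtain U :: "nat \<Rightarrow> 'a set" where U: "F \<subseteq> (\<Union>i. U i) \<and> (\<forall>i. bounded (U i) \<and> diameter (U i) \<le> \<delta>)
      \<and> (\<Sum>i. ennreal (diameter (U i) powr s)) < ennreal e"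
    using hausdorff_null_cover[OF assms] by (rule exE)
  then have "cover_within s \<delta> e F U"
    unfolding cover_within_def by (elim conjE) (intro conjI, assumption+, rule less_imp_le, assumption)
  then show thesis by (rule that)
qed

lemma hausdorff_measure_mono: "A \<subseteq> B \<Longrightarrow> hausdorff_measure s A \<le> hausdorff_measure s B"
  unfolding hausdorff_measure_def hausdorff_premeasure_def
  by (intro SUP_mono' INF_superset_mono) auto

lemma hausdorff_dim_mono:
  assumes "A \<subseteq> B"
  shows "hausdorff_dim A \<le> hausdorff_dim B"
  unfolding hausdorff_dim_def
proof (rule INF_superset_mono)
  have "hausdorff_measure s A = 0" if "hausdorff_measure s B = 0" for s
    using hausdorff_measure_mono[OF assms, of s] that by simp
  then show "{s. 0 \<le> s \<and> hausdorff_measure s B = 0} \<subseteq> {s. 0 \<le> s \<and> hausdorff_measure s A = 0}"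
    by blast
qed simp

lemma hausdorff_measure_empty:
  assumes "0 < s"
  shows "hausdorff_measure s ({} :: 'a::metric_space set) = 0"
proof (rule hausdorff_nullI[OF assms])
  fix e \<delta> :: real assume "0 < e" "0 < \<delta>"
  then have "cover_within s \<delta> e ({} :: 'a set) (\<lambda>_. {})" by (simp add: cover_within_def)
  then show "\<exists>U :: nat \<Rightarrow> 'a set. cover_within s \<delta> e {} U" by (rule exI[of _ "\<lambda>_. {}"])
qed

lemma hausdorff_measure_0_null:
  assumes "hausdorff_measure 0 F = 0"
  shows "F = {}"
proof -
  have "hausdorff_premeasure 0 1 F \<le> hausdorff_measure 0 F"
    unfolding hausdorff_measure_def by (intro SUP_upper) auto
  then have "hausdorff_premeasure 0 1 F = 0" using assms by simp
  then have "\<exists>U\<in>{U :: nat \<Rightarrow> 'a set. F \<subseteq> (\<Union>i. U i) \<and> (\<forall>i. bounded (U i) \<and> diameter (U i) \<le> 1)}.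
      (\<Sum>i. diam_gauge 0 (U i)) < 1"
    unfolding hausdorff_premeasure_def by (intro INF_less_ennreal_ex) auto
  then obtain U :: "nat \<Rightarrow> 'a set" where U: "F \<subseteq> (\<Union>i. U i)" "(\<Sum>i. diam_gauge 0 (U i)) < 1"
    by auto
  have "U i = {}" for i
  proof (rule ccontr)
    assume "U i \<noteq> {}"
    then have "1 = (\<Sum>i\<in>{i}. diam_gauge 0 (U i))" by (simp add: diam_gauge_def)
    also have "\<dots> \<le> (\<Sum>i. diam_gauge 0 (U i))" by (rule sum_le_suminf) auto
    finally show False using U(2) by simp
  qed
  then show ?thesis using U(1) by auto
qed

lemma hausdorff_measure_null_mono:
  fixes F :: "'a::metric_space set"
  assumes "hausdorff_measure s F = 0" "0 \<le> s" "s < t"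
  shows "hausdorff_measure t F = 0"
proof (cases "s = 0")
  case True
  then show ?thesis using assms hausdorff_measure_0_null hausdorff_measure_empty by blast
next
  case False
  then have s: "0 < s" using assms by simp
  show ?thesis
  proof (rule hausdorff_nullI)
    fix e \<delta> :: real assume e: "0 < e" and d: "0 < \<delta>"
    \<comment> \<open>Diameters of at most 1 make \<open>diameter powr s\<close> decrease when the
      exponent grows.\<close>
    have "0 < min \<delta> 1" using d by simp
    from hausdorff_nullE[OF assms(1) s e this] obtain U where U: "cover_within s (min \<delta> 1) e F U" .
    have Ub: "bounded (U i)" "diameter (U i) \<le> min \<delta> 1" for i
      using U unfolding cover_within_def by blast+
    have "diameter (U i) powr t \<le> diameter (U i) powr s" for i
    proof (rule powr_mono')
      show "0 \<le> diameter (U i)" by (rule diameter_ge_0[OF Ub(1)])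
      show "diameter (U i) \<le> 1" using Ub(2)[of i] by simp
    qed (use assms in simp)
    then have "(\<Sum>i. ennreal (diameter (U i) powr t)) \<le> (\<Sum>i. ennreal (diameter (U i) powr s))"
      by (intro suminf_le ennreal_leI) auto
    also have "\<dots> \<le> ennreal e" using U by (simp add: cover_within_def)
    finally have "(\<Sum>i. ennreal (diameter (U i) powr t)) \<le> ennreal e" .
    moreover have "F \<subseteq> (\<Union>i. U i)" using U unfolding cover_within_def by blast
    moreover have "bounded (U i) \<and> diameter (U i) \<le> \<delta>" for i using Ub[of i] by simp
    ultimately have "cover_within t \<delta> e F U"
      unfolding cover_within_def by blast
    then show "\<exists>U. cover_within t \<delta> e F U" by (rule exI[of _ U])
  qed (use s assms in simp)
qed

lemma hausdorff_dim_ge: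
  assumes "hausdorff_measure s F \<noteq> 0"
  shows "ereal s \<le> hausdorff_dim F"
  unfolding hausdorff_dim_def
proof (rule INF_greatest)
  fix t assume "t \<in> {t. 0 \<le> t \<and> hausdorff_measure t F = 0}"
  then show "ereal s \<le> ereal t"
    using hausdorff_measure_null_mono[of t F s] assms by (cases "t < s") auto
qed

lemma hausdorff_dim_le: "0 \<le> s \<Longrightarrow> hausdorff_measure s F = 0 \<Longrightarrow> hausdorff_dim F \<le> ereal s"
  unfolding hausdorff_dim_def by (rule INF_lower) simp

lemma hausdorff_dim_nonneg: "0 \<le> hausdorff_dim F"
  unfolding hausdorff_dim_def by (rule INF_greatest) auto

lemma hausdorff_dim_less_null:
  assumes "hausdorff_dim F < ereal s"
  shows "hausdorff_measure s F = 0"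
proof -
  obtain t where "0 \<le> t" "hausdorff_measure t F = 0" "t < s"
    using assms unfolding hausdorff_dim_def INF_less_iff by auto
  then show ?thesis using hausdorff_measure_null_mono by blast
qed

lemma hausdorff_dim_empty: "hausdorff_dim ({} :: 'a::metric_space set) = 0"
proof (rule order_antisym[OF _ hausdorff_dim_nonneg], rule ereal_le_epsilon2)
  fix e :: real assume "0 < e"
  then show "hausdorff_dim ({} :: 'a set) \<le> 0 + ereal e"
    using hausdorff_dim_le[of e "{}"] hausdorff_measure_empty[of e] by simp
qed

lemma hausdorff_measure_UN_null:
  fixes F :: "nat \<Rightarrow> 'a::metric_space set"
  assumes s: "0 < s" and null: "\<And>k. hausdorff_measure s (F k) = 0"
  shows "hausdorff_measure s (\<Union>k. F k) = 0"
proof (rule hausdorff_nullI[OF s])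
  fix e \<delta> :: real assume e: "0 < e" and d: "0 < \<delta>"
  have "\<exists>U. cover_within s \<delta> (e * (1 / 2) ^ Suc k) (F k) U" for k
  proof -
    have "0 < e * (1 / 2) ^ Suc k" using e by simp
    from hausdorff_nullE[OF null s this d] obtain U where "cover_within s \<delta> (e * (1 / 2) ^ Suc k) (F k) U" .
    then show ?thesis by (rule exI[of _ U])
  qed
  then have "\<forall>k. \<exists>U. cover_within s \<delta> (e * (1 / 2) ^ Suc k) (F k) U" by (rule allI)
  from choice[OF this] obtain U where U': "\<And>k. cover_within s \<delta> (e * (1 / 2) ^ Suc k) (F k) (U k)" by blast
  have U: "F k \<subseteq> (\<Union>i. U k i)" "bounded (U k i) \<and> diameter (U k i) \<le> \<delta>"
      "(\<Sum>i. ennreal (diameter (U k i) powr s)) \<le> ennreal (e * (1 / 2) ^ Suc k)" for k i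
    using U'[of k] unfolding cover_within_def by (elim conjE; simp only: all_simps)+
  define W where "W n = (case prod_decode n of (k, i) \<Rightarrow> U k i)" for n
  have "(\<Sum>n. ennreal (diameter (W n) powr s)) =
      (\<Sum>k. \<Sum>i. ennreal (diameter (U k i) powr s))"
  proof -
    have "(\<Sum>n. (\<lambda>(k, i). ennreal (diameter (U k i) powr s)) (prod_decode n)) =
        (\<Sum>k. \<Sum>i. ennreal (diameter (U k i) powr s))"
      using suminf_ennreal_2dimen[of "\<lambda>k. \<Sum>i. ennreal (diameter (U k i) powr s)" "\<lambda>(k, i). ennreal (diameter (U k i) powr s)"]
      unfolding comp_def by (simp only: case_prod_conv)
    moreover have "(\<lambda>(k, i). ennreal (diameter (U k i) powr s)) (prod_decode n) = ennreal (diameter (W n) powr s)" for n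
      unfolding W_def by (simp only: case_prod_unfold)
    ultimately show ?thesis by (simp only:)
  qed
  also have "\<dots> \<le> (\<Sum>k. ennreal (e * (1 / 2) ^ Suc k))"
    by (intro suminf_le U(3)) auto
  also have "\<dots> = ennreal (\<Sum>k. e * (1 / 2) ^ Suc k)"
  proof (rule suminf_ennreal2)
    show "0 \<le> e * (1 / 2) ^ Suc k" for k using e by simp
    show "summable (\<lambda>k. e * (1 / 2) ^ Suc k)"
      by (rule summable_mult[OF sums_summable[OF power_half_series]])
  qed
  also have "(\<Sum>k. e * (1 / 2) ^ Suc k) = e"
    using sums_unique[OF sums_mult[OF power_half_series, of e]] by (simp only: mult_1_right)
  finally have "(\<Sum>n. ennreal (diameter (W n) powr s)) \<le> ennreal e" .
  moreover have "(\<Union>k. F k) \<subseteq> (\<Union>n. W n)"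
  proof
    fix x assume "x \<in> (\<Union>k. F k)"
    then obtain k i where "x \<in> U k i" using U(1) by blast
    then have "x \<in> W (prod_encode (k, i))" by (simp add: W_def)
    then show "x \<in> (\<Union>n. W n)" by blast
  qed
  moreover have "bounded (W n) \<and> diameter (W n) \<le> \<delta>" for n
    using U(2) by (simp add: W_def split: prod.split)
  ultimately show "\<exists>U. cover_within s \<delta> e (\<Union>k. F k) U"
    unfolding cover_within_def by (intro exI[of _ W] conjI allI) auto
qed

lemma hausdorff_measure_Un_null:
  assumes "0 < s" "hausdorff_measure s A = 0" "hausdorff_measure s B = 0"
  shows "hausdorff_measure s (A \<union> B) = 0"
proof -
  have "hausdorff_measure s (\<Union>k::nat. if k = 0 then A else B) = 0"
    by (rule hausdorff_measure_UN_null) (use assms in auto)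
  moreover have "(\<Union>k::nat. if k = 0 then A else B) = A \<union> B" by (auto split: if_splits intro: exI[of _ 1])
  ultimately show ?thesis by simp
qed

lemma hausdorff_dim_Un_less:
  assumes "hausdorff_dim A < ereal s" "hausdorff_dim B < ereal s"
  shows "hausdorff_dim (A \<union> B) \<le> ereal s"
proof -
  have s: "0 < s" using assms(1) hausdorff_dim_nonneg[of A] by (metis ereal_less(2) order_le_less_trans)
  show ?thesis
    using hausdorff_dim_le[OF _ hausdorff_measure_Un_null[OF s hausdorff_dim_less_null[OF assms(1)]
        hausdorff_dim_less_null[OF assms(2)]]] s by simp
qed

lemma finite_cover_hausdorff_sum:
  fixes A :: "'b set" and B :: "'b \<Rightarrow> 'a::metric_space set"
  assumes "finite A" "F \<subseteq> (\<Union>a\<in>A. B a)" "\<And>a. a \<in> A \<Longrightarrow> bounded (B a) \<and> diameter (B a) \<le> \<delta>" "0 \<le> \<delta>" "0 < s"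
  shows "\<exists>U. cover_within s \<delta> (real (card A) * \<delta> powr s) F U"
proof -
  obtain f where f: "bij_betw f {..<card A} A"
    using ex_bij_betw_nat_finite[OF assms(1)] unfolding atLeast0LessThan by blast
  define U where "U i = (if i < card A then B (f i) else {})" for i
  have "F \<subseteq> (\<Union>i. U i)"
  proof
    fix x assume "x \<in> F"
    then obtain a where a: "a \<in> A" "x \<in> B a" using assms(2) by blast
    then obtain i where "i < card A" "f i = a" using bij_betw_imp_surj_on[OF f] by (metis imageE lessThan_iff)
    then have "x \<in> U i" using a by (simp add: U_def)
    then show "x \<in> (\<Union>i. U i)" by blast
  qed
  moreover have U: "bounded (U i) \<and> diameter (U i) \<le> \<delta>" for i
    using assms(3,4) bij_betwE[OF f] by (auto simp: U_def)
  moreover have "(\<Sum>i. ennreal (diameter (U i) powr s)) \<le> ennreal (real (card A) * \<delta> powr s)"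
  proof -
    have "(\<Sum>i. ennreal (diameter (U i) powr s)) = (\<Sum>i<card A. ennreal (diameter (U i) powr s))"
      by (rule suminf_finite) (auto simp: U_def)
    also have "\<dots> \<le> (\<Sum>i<card A. ennreal (\<delta> powr s))"
      using U assms(5) by (intro sum_mono ennreal_leI powr_mono2) (auto simp: diameter_ge_0)
    also have "\<dots> = ennreal (real (card A) * \<delta> powr s)"
      by (simp add: ennreal_mult ennreal_of_nat_eq_real_of_nat)
    finally show ?thesis .
  qed
  ultimately have "cover_within s \<delta> (real (card A) * \<delta> powr s) F U"
    unfolding cover_within_def by simp
  then show ?thesis by (rule exI[of _ U])
qed

lemma One_vec_nth: "(One :: real^'d::finite) $ i = 1"
proof -
  have "(One :: real^'d) \<bullet> axis i 1 = 1"
    by (simp add: inner_sum_left inner_Basis axis_in_Basis_iff sum.delta)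
  then show ?thesis by (simp add: inner_axis del: sum_component)
qed

lemma mem_cube: "x \<in> cbox a (a + \<delta> *\<^sub>R One) \<longleftrightarrow> (\<forall>i. a $ i \<le> x $ i \<and> x $ i \<le> a $ i + \<delta>)"
  for x :: "real^'d::finite"
  unfolding mem_box_cart vector_add_component vector_scaleR_component One_vec_nth by simp

lemma diameter_cube_le:
  fixes a :: "real^'d::finite"
  assumes "0 \<le> \<delta>"
  shows "diameter (cbox a (a + \<delta> *\<^sub>R One)) \<le> real CARD('d) * \<delta>"
proof (rule diameter_le)
  show "cbox a (a + \<delta> *\<^sub>R One) \<noteq> {} \<or> 0 \<le> real CARD('d) * \<delta>" using assms by simp
  fix x y assume "x \<in> cbox a (a + \<delta> *\<^sub>R One)" "y \<in> cbox a (a + \<delta> *\<^sub>R One)"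
  then have "\<bar>x $ i - y $ i\<bar> \<le> \<delta>" for i
    unfolding mem_cube by (smt (verit))
  then show "norm (x - y) \<le> real CARD('d) * \<delta>"
    using dist_le_coordinates[of x y \<delta>] by (simp add: dist_norm)
qed

lemma cover_within_mono:
  "cover_within s \<delta> e F U \<Longrightarrow> \<delta> \<le> \<delta>' \<Longrightarrow> e \<le> e' \<Longrightarrow> cover_within s \<delta>' e' F U"
  unfolding cover_within_def using order_trans ennreal_leI by metis

lemma powr_tendsto_0_right:
  fixes a c :: real
  assumes "0 < a"
  shows "((\<lambda>x. c * x powr a) \<longlongrightarrow> 0) (at_right 0)"
proof -
  have "((\<lambda>x. x powr a) \<longlongrightarrow> 0) (at_right 0)"
  proof (rule tendstoI)
    fix e :: real assume e: "0 < e"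
    have "eventually (\<lambda>x::real. x \<in> {0<..<e powr (1 / a)}) (at_right 0)"
      by (rule eventually_at_right_real) (use e in simp)
    then show "eventually (\<lambda>x. dist (x powr a) 0 < e) (at_right 0)"
    proof eventually_elim
      case (elim x)
      then have "x powr a < (e powr (1 / a)) powr a" using assms by (intro powr_less_mono2) auto
      then show ?case using assms e by (simp add: powr_powr)
    qed
  qed
  then show ?thesis by (rule tendsto_mult_right_zero)
qed

text \<open>If the lower box dimension is below t' < t, there are arbitrarily small
  \<open>\<delta>\<close> with at most \<open>\<delta> powr (- t')\<close> covering cubes, whose
  \<open>t\<close>-sum is of order \<open>\<delta> powr (t - t')\<close> and tends to 0. The
  hypothesis \<open>fin\<close> ensures that the minimum in \<open>cube_cover_number\<close> is
  attained.\<close>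

lemma hausdorff_dim_le_lower_box_dim:
  fixes F :: "(real^'d::finite) set"
  assumes fin: "\<And>\<delta>. 0 < \<delta> \<Longrightarrow> \<exists>A. finite A \<and> F \<subseteq> (\<Union>a\<in>A. cbox a (a + \<delta> *\<^sub>R One))"
  shows "hausdorff_dim F \<le> lower_box_dim F"
proof (cases "F = {}")
  case True
  then show ?thesis by (simp add: hausdorff_dim_empty lower_box_dim_def)
next
  case False
  let ?f = "\<lambda>\<delta>. ereal (ln (real (cube_cover_number \<delta> F)) / - ln \<delta>)"
  let ?D = "real CARD('d)"
  have D: "0 < ?D" by simp
  have lb: "lower_box_dim F = Liminf (at_right 0) ?f" using False by (simp add: lower_box_dim_def)
  have ln_nonneg: "0 \<le> ln (real m)" for m :: nat by (cases m) auto
  have small: "eventually (\<lambda>\<delta>::real. 0 < \<delta> \<and> \<delta> < 1) (at_right 0)"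
    using eventually_at_right_real[of 0 1] by simp
  have "eventually (\<lambda>\<delta>. 0 \<le> ?f \<delta>) (at_right 0)"
    using small
  proof eventually_elim
    case (elim \<delta>)
    then have "0 \<le> ln (real (cube_cover_number \<delta> F)) / - ln \<delta>"
      by (intro divide_nonneg_pos ln_nonneg) simp
    then show ?case by (simp only: zero_ereal_def ereal_less_eq(3))
  qed
  then have lb0: "0 \<le> lower_box_dim F" unfolding lb by (rule Liminf_bounded)
  have null: "hausdorff_dim F \<le> ereal t" if less: "lower_box_dim F < ereal t" for t
  proof -
    obtain t' where t': "lower_box_dim F < ereal t'" "t' < t"
      using ereal_dense2[OF less] by auto
    have "ereal 0 < ereal t'" using order_le_less_trans[OF lb0 t'(1)] by (simp only: zero_ereal_def)
    then have t0: "0 < t'" by simp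
    have "hausdorff_measure t F = 0"
    proof (rule hausdorff_nullI)
      show "0 < t" using t0 t'(2) by simp
      fix e \<delta>0 :: real assume e: "0 < e" and d0: "0 < \<delta>0"
      let ?good = "\<lambda>\<delta>. 0 < \<delta> \<and> \<delta> < 1 \<and> ?D * \<delta> \<le> \<delta>0 \<and> ?D powr t * \<delta> powr (t - t') < e"
      have "eventually (\<lambda>\<delta>::real. \<delta> \<in> {0<..<\<delta>0 / ?D}) (at_right 0)"
        by (rule eventually_at_right_real) (use d0 D in simp)
      moreover have "eventually (\<lambda>\<delta>. ?D powr t * \<delta> powr (t - t') < e) (at_right 0)"
        by (rule order_tendstoD(2)[OF powr_tendsto_0_right e]) (use t' in simp)
      ultimately have good: "eventually ?good (at_right 0)"
        using small by eventually_elim (use D in \<open>auto simp: field_simps\<close>)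
      have "\<exists>\<delta>. ?good \<delta> \<and> ?f \<delta> < ereal t'"
      proof (rule ccontr)
        assume none: "\<nexists>\<delta>. ?good \<delta> \<and> ?f \<delta> < ereal t'"
        have "eventually (\<lambda>\<delta>. ereal t' \<le> ?f \<delta>) (at_right 0)"
          by (rule eventually_mono[OF good]) (use none in \<open>meson not_less\<close>)
        then have "ereal t' \<le> lower_box_dim F" unfolding lb by (rule Liminf_bounded)
        then show False using t'(1) by simp
      qed
      then obtain \<delta> where \<delta>: "?good \<delta>" "?f \<delta> < ereal t'" by blast
      let ?M = "cube_cover_number \<delta> F"
      have "\<exists>m. \<exists>A. finite A \<and> card A = m \<and> F \<subseteq> (\<Union>a\<in>A. cbox a (a + \<delta> *\<^sub>R One))"
        using fin[of \<delta>] \<delta>(1) by blast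
      then have "\<exists>A. finite A \<and> card A = ?M \<and> F \<subseteq> (\<Union>a\<in>A. cbox a (a + \<delta> *\<^sub>R One))"
        unfolding cube_cover_number_def by (rule LeastI_ex)
      then obtain A where A: "finite A" "card A = ?M" "F \<subseteq> (\<Union>a\<in>A. cbox a (a + \<delta> *\<^sub>R One))" by blast
      have "\<exists>U. cover_within t (?D * \<delta>) (real (card A) * (?D * \<delta>) powr t) F U"
        by (rule finite_cover_hausdorff_sum[OF A(1,3)])
           (use \<delta>(1) t0 t'(2) in \<open>auto intro!: diameter_cube_le bounded_cbox\<close>)
      then obtain U where U: "cover_within t (?D * \<delta>) (real (card A) * (?D * \<delta>) powr t) F U" by blast
      have M: "real ?M \<le> \<delta> powr (- t')"
      proof (cases "?M = 0")
        case False
        have "ln (real ?M) / - ln \<delta> < t'" using \<delta>(2) by simp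
        then have "ln (real ?M) < t' * - ln \<delta>" using \<delta>(1) by (subst (asm) pos_divide_less_eq) auto
        then have "exp (ln (real ?M)) \<le> exp (- t' * ln \<delta>)" by simp
        then show ?thesis using False \<delta>(1) by (simp add: powr_def)
      qed simp
      have "real (card A) * (?D * \<delta>) powr t \<le> \<delta> powr (- t') * (?D * \<delta>) powr t"
        using M A(2) by (intro mult_right_mono) auto
      also have "\<dots> = ?D powr t * \<delta> powr (t - t')"
        using \<delta>(1) by (simp add: powr_mult powr_diff powr_minus field_simps)
      also have "\<dots> \<le> e" using \<delta>(1) by simp
      finally show "\<exists>U. cover_within t \<delta>0 e F U"
        using cover_within_mono[OF U, of \<delta>0 e] \<delta>(1) by (intro exI[of _ U]) simp
    qed
    then show ?thesis using t0 t'(2) by (intro hausdorff_dim_le) auto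
  qed
  show ?thesis
  proof (rule dense_ge)
    fix z assume "lower_box_dim F < z"
    then obtain t where "lower_box_dim F < ereal t" "ereal t < z" using ereal_dense2 by blast
    then show "hausdorff_dim F \<le> z" using null[of t] by (meson less_imp_le order_trans)
  qed
qed

lemma lower_le_upper_box_dim: "lower_box_dim F \<le> upper_box_dim F"
  unfolding lower_box_dim_def upper_box_dim_def
  by (auto intro: Liminf_le_Limsup simp: trivial_limit_at_right_real)

lemma box_dim_eqI:
  assumes "lower_box_dim F = D" "upper_box_dim F = D"
  shows "box_dim_exists F" "box_dim F = D"
  using assms by (auto simp: box_dim_exists_def box_dim_def)

context perc
begin

section \<open>The dimension of the limit set\<close>

definition count :: "nat \<Rightarrow> ('d::finite node \<Rightarrow> bool) \<Rightarrow> nat" where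
  "count n \<omega> = card {j \<in> grid n. retained \<omega> n j}"

lemma prob_retained:
  fixes j :: "'d::finite \<Rightarrow> int"
  assumes "0 \<le> p" "p \<le> 1"
  shows "measure (BF p) {\<omega>. retained \<omega> n j} = p ^ n"
proof -
  let ?J = "(\<lambda>l. (l, anc (n - l) j)) ` {1..n}"
  have "card ?J = n" by (subst card_image) (auto simp: inj_on_def)
  moreover have "{\<omega>. retained \<omega> n j} = {\<omega>. \<forall>x\<in>?J. \<omega> x = True}"
    by (auto simp: retained_def)
  ultimately show ?thesis
    using prob_finite_cylinder[of ?J p "\<lambda>_. True"] assms by simp
qed

lemma retained_sets: "{\<omega>. retained \<omega> n (j :: 'd::finite \<Rightarrow> int)} \<in> sets (BF p)"
  by (rule dep_finite_sets[OF dep_retained]) simp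

lemma count_eq_sum: "real (count n \<omega>) = (\<Sum>j\<in>grid n. indicat_real {\<omega>. retained \<omega> n j} \<omega>)"
proof -
  have "(\<Sum>j\<in>grid n. indicat_real {\<omega>. retained \<omega> n j} \<omega>) = (\<Sum>j\<in>grid n. if retained \<omega> n j then 1 else 0)"
    by (intro sum.cong) (auto simp: indicator_def)
  also have "\<dots> = real (card {j \<in> grid n. retained \<omega> n j})"
    by (subst sum.inter_filter[symmetric]) (auto simp: finite_grid)
  finally show ?thesis by (simp add: count_def)
qed

lemma expectation_count:
  assumes "0 \<le> p" "p \<le> 1"
  shows "integrable (BF p) (\<lambda>\<omega> :: 'd::finite node \<Rightarrow> bool. real (count n \<omega>))"
    and "(\<integral>\<omega>. real (count n \<omega>) \<partial>(BF p :: ('d::finite node \<Rightarrow> bool) measure)) = (p * real (N ^ CARD('d))) ^ n"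
proof -
  let ?M = "BF p :: ('d node \<Rightarrow> bool) measure"
  interpret prob_space ?M by (rule prob_space_BF)
  have int: "integrable ?M (indicat_real {\<omega>. retained \<omega> n j})" for j :: "'d \<Rightarrow> int"
    using retained_sets[of n j p] by (simp add: emeasure_eq_measure)
  show "integrable ?M (\<lambda>\<omega>. real (count n \<omega>))"
    unfolding count_eq_sum by (intro Bochner_Integration.integrable_sum int)
  have "(\<integral>\<omega>. real (count n \<omega>) \<partial>?M) = (\<Sum>j\<in>(grid n :: ('d \<Rightarrow> int) set). \<integral>\<omega>. indicat_real {\<omega>. retained \<omega> n j} \<omega> \<partial>?M)"
    unfolding count_eq_sum by (rule Bochner_Integration.integral_sum[OF int])
  also have "\<dots> = (\<Sum>j\<in>(grid n :: ('d \<Rightarrow> int) set). p ^ n)"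
    by (intro sum.cong refl) (simp add: retained_sets prob_retained[OF assms])
  also have "\<dots> = (p * real (N ^ CARD('d))) ^ n"
    by (simp add: card_grid power_mult_distrib mult.commute flip: power_mult)
  finally show "(\<integral>\<omega>. real (count n \<omega>) \<partial>?M) = (p * real (N ^ CARD('d))) ^ n" .
qed

lemma markov_BF:
  assumes "integrable (BF p) f" "\<And>\<omega>. 0 \<le> f \<omega>" "0 < c"
  shows "{\<omega>. c < f \<omega>} \<in> sets (BF p)" "measure (BF p) {\<omega>. c < f \<omega>} \<le> (\<integral>\<omega>. f \<omega> \<partial>BF p) / c"
proof -
  interpret prob_space "BF p :: ('a \<Rightarrow> bool) measure" by (rule prob_space_BF)
  have [measurable]: "f \<in> borel_measurable (BF p)" using assms(1) by auto
  have "{\<omega>\<in>space (BF p). c < f \<omega>} \<in> sets (BF p)" by measurable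
  then show s: "{\<omega>. c < f \<omega>} \<in> sets (BF p)" by simp
  have "(\<integral>\<omega>. c * indicat_real {\<omega>. c < f \<omega>} \<omega> \<partial>BF p) \<le> (\<integral>\<omega>. f \<omega> \<partial>BF p)"
  proof (rule integral_mono)
    show "integrable (BF p) (\<lambda>\<omega>. c * indicat_real {\<omega>. c < f \<omega>} \<omega>)"
      using s by (simp add: emeasure_eq_measure)
    show "c * indicat_real {\<omega>. c < f \<omega>} \<omega> \<le> f \<omega>" for \<omega>
      using assms(2)[of \<omega>] by (simp add: indicator_def)
  qed (rule assms(1))
  then have "c * prob {\<omega>. c < f \<omega>} \<le> (\<integral>\<omega>. f \<omega> \<partial>BF p)" using s by simp
  then show "prob {\<omega>. c < f \<omega>} \<le> (\<integral>\<omega>. f \<omega> \<partial>BF p) / c"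
    using assms(3) by (simp add: pos_le_divide_eq mult.commute)
qed

text \<open>Markov's inequality makes the probabilities of exceeding \<open>c n\<close> summable,
  and Borel-Cantelli applies. It serves both for the retained cubes and for the unshielded
  ones.\<close>

lemma AE_eventually_le_of_expectation:
  fixes f :: "nat \<Rightarrow> ('a \<Rightarrow> bool) \<Rightarrow> real"
  assumes "\<And>n. integrable (BF p) (f n)" "\<And>n \<omega>. 0 \<le> f n \<omega>" "\<And>n. 0 < c n"
    and "summable (\<lambda>n. (\<integral>\<omega>. f n \<omega> \<partial>BF p) / c n)"
  shows "AE \<omega> in BF p. eventually (\<lambda>n. f n \<omega> \<le> c n) sequentially"
proof -
  interpret prob_space "BF p :: ('a \<Rightarrow> bool) measure" by (rule prob_space_BF)
  let ?A = "\<lambda>n. {\<omega>. c n < f n \<omega>}"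
  have "AE \<omega> in BF p. eventually (\<lambda>n. \<omega> \<in> space (BF p) - ?A n) sequentially"
  proof (rule borel_cantelli_AE1)
    show "?A n \<in> events" for n by (rule markov_BF(1)[OF assms(1-3)])
    show "emeasure (BF p) (?A n) < \<infinity>" for n by (simp add: emeasure_eq_measure)
    show "summable (\<lambda>n. prob (?A n))"
      by (rule summable_comparison_test'[OF assms(4), of 0])
         (use markov_BF(2)[OF assms(1-3)] in simp)
  qed
  then show ?thesis by eventually_elim (simp add: not_less)
qed

lemma AE_count_le:
  assumes "0 \<le> p" "p \<le> 1" "p * real (N ^ CARD('d::finite)) < r"
  shows "AE \<omega> in (BF p :: ('d node \<Rightarrow> bool) measure). eventually (\<lambda>n. real (count n \<omega>) \<le> r ^ n) sequentially"
proof (rule AE_eventually_le_of_expectation)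
  have r: "0 < r" using assms by (smt (verit) mult_nonneg_nonneg of_nat_0_le_iff)
  then show "0 < r ^ n" for n by simp
  have "summable (\<lambda>n. (p * real (N ^ CARD('d)) / r) ^ n)"
    using assms r by (intro summable_geometric) (simp add: abs_mult)
  then show "summable (\<lambda>n. (\<integral>\<omega>. real (count n \<omega>) \<partial>(BF p :: ('d node \<Rightarrow> bool) measure)) / r ^ n)"
    by (simp only: expectation_count[OF assms(1,2)] power_divide)
qed (use expectation_count[OF assms(1,2)] in auto)

lemma cell_subset_cube:
  assumes "1 / S n \<le> \<delta>"
  shows "cell n j \<subseteq> cbox (\<chi> i. real_of_int (j i) / S n) ((\<chi> i. real_of_int (j i) / S n) + \<delta> *\<^sub>R One)"
proof
  fix x assume "x \<in> cell n j"
  then have *: "real_of_int (j i) / S n \<le> x $ i \<and> x $ i \<le> real_of_int (j i) / S n + 1 / S n" for i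
    by (simp add: mem_cell field_simps)
  have "real_of_int (j i) / S n \<le> x $ i \<and> x $ i \<le> real_of_int (j i) / S n + \<delta>" for i
    using *[of i] assms by linarith
  then show "x \<in> cbox (\<chi> i. real_of_int (j i) / S n) ((\<chi> i. real_of_int (j i) / S n) + \<delta> *\<^sub>R One)"
    unfolding mem_cube vec_lambda_beta by blast
qed

lemma lim_set_cube_cover:
  fixes \<omega> :: "'d::finite node \<Rightarrow> bool"
  assumes "1 / S n \<le> \<delta>"
  shows "\<exists>A. finite A \<and> card A \<le> count n \<omega> \<and> lim_set \<omega> \<subseteq> (\<Union>a\<in>A. cbox a (a + \<delta> *\<^sub>R One))"
proof -
  let ?J = "{j \<in> grid n. retained \<omega> n j}"
  let ?c = "\<lambda>j::'d \<Rightarrow> int. (\<chi> i. real_of_int (j i) / S n)"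
  have fin: "finite ?J" using finite_grid by (rule finite_subset[rotated]) auto
  have "lim_set \<omega> \<subseteq> (\<Union>a\<in>?c ` ?J. cbox a (a + \<delta> *\<^sub>R One))"
  proof
    fix x assume "x \<in> lim_set \<omega>"
    then have "x \<in> level_set \<omega> n" by (auto simp: lim_set_def)
    then obtain j where "j \<in> grid n" "retained \<omega> n j" "x \<in> cell n j" by (rule level_setE)
    then show "x \<in> (\<Union>a\<in>?c ` ?J. cbox a (a + \<delta> *\<^sub>R One))"
      using cell_subset_cube[OF assms, of j] by blast
  qed
  then show ?thesis
    using fin card_image_le[OF fin, of ?c] by (intro exI[of _ "?c ` ?J"]) (simp add: count_def)
qed

lemma cube_cover_number_le_count:
  assumes "1 / S n \<le> \<delta>"
  shows "cube_cover_number \<delta> (lim_set \<omega>) \<le> count n \<omega>"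
proof -
  obtain A where A: "finite A" "card A \<le> count n \<omega>" "lim_set \<omega> \<subseteq> (\<Union>a\<in>A. cbox a (a + \<delta> *\<^sub>R One))"
    using lim_set_cube_cover[OF assms, of \<omega>] by blast
  have "cube_cover_number \<delta> (lim_set \<omega>) \<le> card A"
    unfolding cube_cover_number_def by (rule Least_le) (use A in blast)
  then show ?thesis using A(2) by simp
qed

lemma hausdorff_le_lower_box_lim_set: "hausdorff_dim (lim_set \<omega>) \<le> lower_box_dim (lim_set \<omega>)"
proof (rule hausdorff_dim_le_lower_box_dim)
  fix \<delta> :: real assume "0 < \<delta>"
  then obtain n where "1 / S n < \<delta>" using ex_inverse_S_less by blast
  then show "\<exists>A. finite A \<and> lim_set \<omega> \<subseteq> (\<Union>a\<in>A. cbox a (a + \<delta> *\<^sub>R One))"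
    using lim_set_cube_cover[of n \<delta> \<omega>] by (meson less_imp_le)
qed

text \<open>For given \<open>\<delta>\<close> the level \<open>n\<close> is the first whose cells
  have side at most \<open>\<delta>\<close>, so that n - 1 < - ln \<delta> / ln N. The off-by-one
  contributes the term \<open>ln r / - ln \<delta>\<close> of \<open>?g\<close>, which vanishes in
  the limit.\<close>

lemma upper_box_dim_lim_set_le:
  fixes \<omega> :: "'d::finite node \<Rightarrow> bool"
  assumes r: "1 < r" and ev: "eventually (\<lambda>n. real (count n \<omega>) \<le> r ^ n) sequentially"
  shows "upper_box_dim (lim_set \<omega>) \<le> ereal (ln r / ln (real N))"
proof (cases "lim_set \<omega> = {}")
  case True
  then show ?thesis using r N2 by (simp add: upper_box_dim_def zero_ereal_def)
next
  case False
  obtain n0 where n0: "\<And>n. n0 \<le> n \<Longrightarrow> real (count n \<omega>) \<le> r ^ n"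
    using ev by (auto simp: eventually_sequentially)
  have lnN: "0 < ln (real N)" "0 < ln r" using N2 r by auto
  let ?f = "\<lambda>\<delta>. ln (real (cube_cover_number \<delta> (lim_set \<omega>))) / - ln \<delta>"
  let ?g = "\<lambda>\<delta>. ln r / ln (real N) + ln r / - ln \<delta>"
  have bound: "?f \<delta> \<le> ?g \<delta>" if d: "0 < \<delta>" "\<delta> < 1 / S n0" "\<delta> < 1" for \<delta>
  proof -
    define n where "n = (LEAST n. 1 / S n \<le> \<delta>)"
    obtain m where "1 / S m < \<delta>" using ex_inverse_S_less[OF d(1)] by blast
    then have n: "1 / S n \<le> \<delta>" unfolding n_def by (rule LeastI[OF less_imp_le])
    have "n0 \<le> n"
    proof (rule ccontr)
      assume "\<not> n0 \<le> n"
      then have "S n \<le> S n0" using N2 by (intro power_increasing) auto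
      then have "1 / S n0 \<le> 1 / S n" by (intro divide_left_mono) auto
      then show False using n d(2) by simp
    qed
    have "n \<noteq> 0" using n d(3) by (intro notI) simp
    then obtain k where k: "n = Suc k" by (cases n) auto
    have "\<not> 1 / S k \<le> \<delta>" using not_less_Least[of k "\<lambda>n. 1 / S n \<le> \<delta>"] k n_def by simp
    then have "\<delta> < 1 / S k" by simp
    then have "ln \<delta> < ln (1 / S k)" using d(1) by (subst ln_less_cancel_iff) auto
    also have "\<dots> = - (real k * ln (real N))" by (simp add: ln_div ln_realpow)
    finally have "real k * ln (real N) < - ln \<delta>" by simp
    then have k_le: "real k < - ln \<delta> / ln (real N)" using lnN(1) by (simp only: pos_less_divide_eq)
    have "ln (real (cube_cover_number \<delta> (lim_set \<omega>))) \<le> real n * ln r"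
    proof (cases "cube_cover_number \<delta> (lim_set \<omega>) = 0")
      case False
      have "real (cube_cover_number \<delta> (lim_set \<omega>)) \<le> r ^ n"
        using cube_cover_number_le_count[OF n, of \<omega>] n0[OF \<open>n0 \<le> n\<close>] by linarith
      then have "ln (real (cube_cover_number \<delta> (lim_set \<omega>))) \<le> ln (r ^ n)"
        using False r by (subst ln_le_cancel_iff) auto
      then show ?thesis using r by (simp add: ln_realpow)
    qed (use lnN in simp)
    also have "\<dots> \<le> (- ln \<delta> / ln (real N) + 1) * ln r"
      using k_le k lnN by (intro mult_right_mono) auto
    finally have "?f \<delta> \<le> ((- ln \<delta> / ln (real N) + 1) * ln r) / - ln \<delta>"
      using d by (intro divide_right_mono) auto
    also have "\<dots> = ?g \<delta>" using d lnN by (simp add: field_simps)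
    finally show ?thesis .
  qed
  have "filterlim (\<lambda>\<delta>::real. - ln \<delta>) at_top (at_right 0)"
    using ln_at_0 by (simp add: filterlim_uminus_at_top)
  then have "((\<lambda>\<delta>. ln r / - ln \<delta>) \<longlongrightarrow> 0) (at_right (0::real))"
    by (rule tendsto_divide_0[OF tendsto_const filterlim_at_top_imp_at_infinity])
  then have "(?g \<longlongrightarrow> ln r / ln (real N) + 0) (at_right 0)" by (intro tendsto_add tendsto_const)
  then have g: "((\<lambda>\<delta>. ereal (?g \<delta>)) \<longlongrightarrow> ereal (ln r / ln (real N))) (at_right 0)" by simp
  have "eventually (\<lambda>\<delta>::real. \<delta> \<in> {0<..<min (1 / S n0) 1}) (at_right 0)"
    by (rule eventually_at_right_real) simp
  then have "eventually (\<lambda>\<delta>. ereal (?f \<delta>) \<le> ereal (?g \<delta>)) (at_right 0)"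
    by eventually_elim (use bound in simp)
  then have "Limsup (at_right 0) (\<lambda>\<delta>. ereal (?f \<delta>)) \<le> Limsup (at_right 0) (\<lambda>\<delta>. ereal (?g \<delta>))"
    by (rule Limsup_mono)
  also have "\<dots> = ereal (ln r / ln (real N))"
    by (rule lim_imp_Limsup[OF _ g]) (simp add: trivial_limit_at_right_real)
  finally show ?thesis using False by (simp add: upper_box_dim_def)
qed

definition dim_value :: "real \<Rightarrow> 'd itself \<Rightarrow> real" where
  "dim_value p _ = ln (p * real (N ^ CARD('d))) / ln (real N)"

theorem AE_dim_lim_set:
  assumes p: "0 < p" "p < 1" and surv: "measure (BF p) {\<omega> :: 'd::finite node \<Rightarrow> bool. survives \<omega>} > 0"
  shows "AE \<omega> in (BF p :: ('d node \<Rightarrow> bool) measure). survives \<omega> \<longrightarrow>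
    hausdorff_dim (lim_set \<omega>) = ereal (dim_value p TYPE('d)) \<and>
    lower_box_dim (lim_set \<omega>) = ereal (dim_value p TYPE('d)) \<and>
    upper_box_dim (lim_set \<omega>) = ereal (dim_value p TYPE('d))"
proof -
  let ?m = "p * real (N ^ CARD('d))"
  let ?a = "dim_value p TYPE('d)"
  have m: "1 < ?m" using mean_gt_1[OF _ _ surv] p by simp
  have lnN: "0 < ln (real N)" using N2 by simp
  have a: "0 < ?a" using m lnN by (simp add: dim_value_def)
  \<comment> \<open>The exponents \<open>s k\<close> approach the dimension from below and the rates
    \<open>r k\<close> the mean from above. Being countably many, their exceptional null sets can be
    united; \<open>k + 2\<close> keeps \<open>s 0\<close> positive.\<close>
  define s where "s k = ?a * (1 - 1 / real (k + 2))" for k :: nat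
  have s: "0 < s k" "s k < ?a" for k using a by (auto simp: s_def)
  define r where "r k = ?m * (1 + 1 / real (k + 1))" for k :: nat
  have r: "?m < r k" for k
  proof -
    have "?m * 1 < ?m * (1 + 1 / real (k + 1))" using m by (intro mult_strict_left_mono) auto
    then show ?thesis by (simp only: r_def mult_1_right)
  qed
  have lower: "AE \<omega> in (BF p :: ('d node \<Rightarrow> bool) measure). \<forall>k. survives \<omega> \<longrightarrow> phi_pos (1 / real N powr s k) \<omega>"
  proof (subst AE_all_countable, rule allI, rule AE_phi_pos)
    fix k
    have N1: "1 < real N powr s k" using N2 s by (intro gr_one_powr) auto
    then show "0 < 1 / real N powr s k" "1 / real N powr s k \<le> 1" by auto
    have "s k * ln (real N) < ln ?m"
      using s(2)[of k] lnN by (simp add: dim_value_def pos_less_divide_eq)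
    then have "exp (s k * ln (real N)) < ?m" using m by (metis exp_less_mono exp_ln less_trans zero_less_one)
    then have "real N powr s k < ?m" by (simp add: powr_def)
    then show "1 < p * (1 / real N powr s k) * real (N ^ CARD('d))" using N1 by (simp add: field_simps)
  qed (use p in auto)
  have upper: "AE \<omega> in (BF p :: ('d node \<Rightarrow> bool) measure).
      \<forall>k. eventually (\<lambda>n. real (count n \<omega>) \<le> r k ^ n) sequentially"
    by (subst AE_all_countable, rule allI, rule AE_count_le) (use p r in auto)
  have lims: "(\<lambda>k. ereal (s k)) \<longlonglongrightarrow> ereal ?a" "(\<lambda>k. ereal (ln (r k) / ln (real N))) \<longlonglongrightarrow> ereal ?a"
  proof -
    have 1: "(\<lambda>k. 1 / real (k + 2)) \<longlonglongrightarrow> 0" "(\<lambda>k. 1 / real (k + 1)) \<longlonglongrightarrow> 0"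
      using LIMSEQ_ignore_initial_segment[OF lim_const_over_n[of 1], of 2]
        LIMSEQ_ignore_initial_segment[OF lim_const_over_n[of 1], of 1] by simp_all
    have "s \<longlonglongrightarrow> ?a * (1 - 0)" unfolding s_def by (intro tendsto_intros 1)
    then show "(\<lambda>k. ereal (s k)) \<longlonglongrightarrow> ereal ?a" by simp
    have "(\<lambda>k. ln (r k) / ln (real N)) \<longlonglongrightarrow> ln (?m * (1 + 0)) / ln (real N)"
      unfolding r_def by (intro tendsto_intros 1) (use m lnN in auto)
    then show "(\<lambda>k. ereal (ln (r k) / ln (real N))) \<longlonglongrightarrow> ereal ?a" by (simp add: dim_value_def)
  qed
  show ?thesis
    using lower upper
  proof eventually_elim
    case (elim \<omega>)
    show ?case
    proof
      assume sv: "survives \<omega>"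
      have "ereal (s k) \<le> hausdorff_dim (lim_set \<omega>)" for k
      proof (rule hausdorff_dim_ge, rule notI)
        assume "hausdorff_measure (s k) (lim_set \<omega>) = 0"
        from hausdorff_null_imp_not_phi_pos[OF s(1) this] show False
          using elim(1) sv by (elim allE[of _ k]) simp
      qed
      then have "ereal ?a \<le> hausdorff_dim (lim_set \<omega>)"
        by (intro LIMSEQ_le_const2[OF lims(1)]) auto
      moreover have "upper_box_dim (lim_set \<omega>) \<le> ereal (ln (r k) / ln (real N))" for k
        by (rule upper_box_dim_lim_set_le) (use elim(2) r[of k] m in auto)
      then have "upper_box_dim (lim_set \<omega>) \<le> ereal ?a"
        by (intro LIMSEQ_le_const[OF lims(2)]) auto
      ultimately show "hausdorff_dim (lim_set \<omega>) = ereal ?a \<and> lower_box_dim (lim_set \<omega>) = ereal ?a \<and>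
          upper_box_dim (lim_set \<omega>) = ereal ?a"
        using hausdorff_le_lower_box_lim_set[of \<omega>] lower_le_upper_box_dim[of "lim_set \<omega>"]
        by (metis order_antisym order_trans)
    qed
  qed
qed

end

section \<open>Nontrivial components and chains of cubes\<close>

lemma not_totally_disconnected_iff:
  "\<not> totally_disconnected C \<longleftrightarrow> (\<exists>K x y. connected K \<and> K \<subseteq> C \<and> x \<in> K \<and> y \<in> K \<and> x \<noteq> y)"
proof
  assume "\<not> totally_disconnected C"
  then obtain x where x: "x \<in> C" "connected_component_set C x \<noteq> {x}"
    by (auto simp: totally_disconnected_def)
  have "x \<in> connected_component_set C x" using x(1) by (simp add: connected_component_refl)
  then obtain y where "y \<in> connected_component_set C x" "y \<noteq> x" using x(2) by blast
  then show "\<exists>K x y. connected K \<and> K \<subseteq> C \<and> x \<in> K \<and> y \<in> K \<and> x \<noteq> y"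
    using \<open>x \<in> connected_component_set C x\<close> connected_connected_component connected_component_subset by blast
next
  assume "\<exists>K x y. connected K \<and> K \<subseteq> C \<and> x \<in> K \<and> y \<in> K \<and> x \<noteq> y"
  then obtain K x y where K: "connected K" "K \<subseteq> C" "x \<in> K" "y \<in> K" "x \<noteq> y" by blast
  then have "y \<in> connected_component_set C x" by (auto simp: connected_component_def)
  moreover have "x \<in> C" using K(2,3) by (rule subsetD)
  ultimately show "\<not> totally_disconnected C" using K(5) by (metis singletonD totally_disconnected_def)
qed

lemma connected_partI:
  assumes "connected K" "K \<subseteq> C" "x \<in> K" "y \<in> K" "x \<noteq> y"
  shows "x \<in> connected_part C"
proof -
  have "y \<in> connected_component_set C x" using assms by (auto simp: connected_component_def)
  then show ?thesis using assms by (auto simp: connected_part_def dust_part_def)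
qed

lemma connected_partE:
  assumes "x \<in> connected_part C"
  obtains K y where "connected K" "K \<subseteq> C" "x \<in> K" "y \<in> K" "x \<noteq> y"
proof -
  have x: "x \<in> C" "connected_component_set C x \<noteq> {x}"
    using assms by (auto simp: connected_part_def dust_part_def)
  have "x \<in> connected_component_set C x" using x(1) by (simp add: connected_component_refl)
  then obtain y where "y \<in> connected_component_set C x" "y \<noteq> x" using x(2) by blast
  then show thesis
    using that[OF connected_connected_component connected_component_subset \<open>x \<in> connected_component_set C x\<close>] by blast
qed

lemma connected_part_subset: "connected_part C \<subseteq> C"
  by (auto simp: connected_part_def)

text \<open>A finite union of closed cubes is closed, so a finite cover of \<open>A\<close> also
  covers its closure.\<close>

lemma cube_cover_number_dense:
  assumes "A \<subseteq> B" "B \<subseteq> closure A"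
  shows "cube_cover_number \<delta> A = cube_cover_number \<delta> B"
proof -
  have "A \<subseteq> (\<Union>a\<in>X. cbox a (a + \<delta> *\<^sub>R One)) \<longleftrightarrow> B \<subseteq> (\<Union>a\<in>X. cbox a (a + \<delta> *\<^sub>R One))" if "finite X" for X
  proof
    have "closed (\<Union>a\<in>X. cbox a (a + \<delta> *\<^sub>R One))" using that by (intro closed_UN) auto
    moreover assume "A \<subseteq> (\<Union>a\<in>X. cbox a (a + \<delta> *\<^sub>R One))"
    ultimately have "closure A \<subseteq> (\<Union>a\<in>X. cbox a (a + \<delta> *\<^sub>R One))" by (rule closure_minimal[rotated])
    then show "B \<subseteq> (\<Union>a\<in>X. cbox a (a + \<delta> *\<^sub>R One))" using assms(2) by (rule order_trans[rotated])
  qed (use assms(1) in \<open>rule order_trans\<close>)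
  then show ?thesis unfolding cube_cover_number_def by (metis (mono_tags, lifting))
qed

lemma box_dims_dense:
  assumes "A \<subseteq> B" "B \<subseteq> closure A"
  shows "lower_box_dim A = lower_box_dim B" "upper_box_dim A = upper_box_dim B"
proof -
  have "A = {} \<longleftrightarrow> B = {}" using assms by auto
  then show "lower_box_dim A = lower_box_dim B" "upper_box_dim A = upper_box_dim B"
    unfolding lower_box_dim_def upper_box_dim_def cube_cover_number_dense[OF assms] by simp_all
qed

text \<open>Contact in a corner counts, and every index is adjacent to itself: these are the pairs
  of equal-level cells that intersect.\<close>

definition adj :: "('d \<Rightarrow> int) \<Rightarrow> ('d \<Rightarrow> int) \<Rightarrow> bool" where
  "adj j j' \<longleftrightarrow> (\<forall>i. \<bar>j i - j' i\<bar> \<le> 1)"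

text \<open>The trivial chain from \<open>a\<close> to \<open>a\<close> exists even for
  \<open>a\<close> outside \<open>W\<close>; membership of the starting cell is therefore assumed
  separately where it matters.\<close>

definition chain :: "('d \<Rightarrow> int) set \<Rightarrow> ('d \<Rightarrow> int) \<Rightarrow> ('d \<Rightarrow> int) \<Rightarrow> bool" where
  "chain W = (\<lambda>x y. x \<in> W \<and> y \<in> W \<and> adj x y)\<^sup>*\<^sup>*"

lemma chain_refl: "chain W a a"
  by (simp add: chain_def)

lemma chain_step: "chain W a b \<Longrightarrow> b \<in> W \<Longrightarrow> c \<in> W \<Longrightarrow> adj b c \<Longrightarrow> chain W a c"
  unfolding chain_def by (rule rtranclp.rtrancl_into_rtrancl) auto

lemma chain_induct [consumes 1, case_names refl step]:
  assumes "chain W a b" "P a"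
    and "\<And>b c. chain W a b \<Longrightarrow> b \<in> W \<Longrightarrow> c \<in> W \<Longrightarrow> adj b c \<Longrightarrow> P b \<Longrightarrow> P c"
  shows "P b"
  using assms(1) unfolding chain_def
proof (induction rule: rtranclp_induct)
  case base
  show ?case by (rule assms(2))
next
  case (step b c)
  then show ?case using assms(3)[of b c] by (simp add: chain_def)
qed

lemma chain_in: "chain W a b \<Longrightarrow> a \<in> W \<Longrightarrow> b \<in> W"
  by (induction rule: chain_induct)

context perc
begin

lemma cells_meet_iff: "cell m j \<inter> cell m j' \<noteq> {} \<longleftrightarrow> adj j j'"
proof
  assume "cell m j \<inter> cell m j' \<noteq> {}"
  then obtain x where x: "x \<in> cell m j" "x \<in> cell m j'" by blast
  have "\<bar>j i - j' i\<bar> \<le> 1" for i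
  proof -
    have "real_of_int (j i) \<le> real_of_int (j' i) + 1" "real_of_int (j' i) \<le> real_of_int (j i) + 1"
      using x by (auto simp: mem_cell intro: order_trans)
    then show ?thesis by linarith
  qed
  then show "adj j j'" by (simp add: adj_def)
next
  assume a: "adj j j'"
  let ?x = "\<chi> i. real_of_int (max (j i) (j' i)) / S m"
  have b: "j i \<le> j' i + 1" "j' i \<le> j i + 1" for i
    using a unfolding adj_def by (metis abs_le_iff diff_le_eq add.commute minus_diff_eq)+
  have "real_of_int (j i) \<le> max (j i) (j' i) \<and> max (j i) (j' i) \<le> real_of_int (j i) + 1"
    "real_of_int (j' i) \<le> max (j i) (j' i) \<and> max (j i) (j' i) \<le> real_of_int (j' i) + 1" for i
    using b[of i] by (auto simp: max_def)
  then have "?x \<in> cell m j" "?x \<in> cell m j'" by (auto simp: mem_cell)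
  then show "cell m j \<inter> cell m j' \<noteq> {}" by blast
qed

lemma connected_cell: "connected (cell m j)"
  by (simp add: cell_def convex_connected)

lemma chain_connected:
  assumes "chain W a b" "a \<in> W"
  shows "\<exists>K. connected K \<and> K \<subseteq> (\<Union>j\<in>W. cell m j) \<and> cell m a \<subseteq> K \<and> cell m b \<subseteq> K"
  using assms(1)
proof (induction rule: chain_induct)
  case refl
  show ?case using assms(2) connected_cell by (intro exI[of _ "cell m a"]) auto
next
  case (step b c)
  then obtain K where K: "connected K" "K \<subseteq> (\<Union>j\<in>W. cell m j)" "cell m a \<subseteq> K" "cell m b \<subseteq> K" by blast
  have "K \<inter> cell m c \<noteq> {}" using K(4) step(4) cells_meet_iff[of m b c] by blast
  then have "connected (K \<union> cell m c)" by (rule connected_Un[OF K(1) connected_cell])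
  then show ?case using K step(3) by (intro exI[of _ "K \<union> cell m c"]) auto
qed

text \<open>The cells reachable from \<open>a\<close> and the remaining cells of \<open>W\<close>
  form two closed sets. They are disjoint, because intersecting cells are adjacent, so they would
  separate \<open>K\<close> if \<open>b\<close> were not reachable.\<close>

lemma connected_chain:
  assumes K: "connected K" "K \<subseteq> (\<Union>j\<in>W. cell m j)" and W: "finite W" "a \<in> W" "b \<in> W"
    and x: "x \<in> K" "x \<in> cell m a" and y: "y \<in> K" "y \<in> cell m b"
  shows "chain W a b"
proof (rule ccontr)
  assume nc: "\<not> chain W a b"
  let ?R = "{j \<in> W. chain W a j}"
  let ?A = "\<Union>j\<in>?R. cell m j" and ?B = "\<Union>j\<in>W - ?R. cell m j"
  have "closed ?A" "closed ?B"
    using W(1) by (auto intro!: closed_UN[OF _ ballI] compact_imp_closed[OF compact_cell] simp del: compact_UN)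
  moreover have "K \<subseteq> ?A \<union> ?B" using K(2) by blast
  moreover have "?A \<inter> ?B \<inter> K = {}"
  proof -
    have False if "j \<in> ?R" "j' \<in> W - ?R" "z \<in> cell m j" "z \<in> cell m j'" for j j' z
    proof -
      have "adj j j'" using that cells_meet_iff[of m j j'] by blast
      then show False using chain_step[of W a j j'] that by blast
    qed
    then show ?thesis by blast
  qed
  moreover have "x \<in> ?A \<inter> K" using x W(2) chain_refl by blast
  moreover have "y \<in> ?B \<inter> K" using y W(3) nc by blast
  ultimately show False using connected_closedD[OF K(1)] by blast
qed

section \<open>Components of the limit set in terms of chains\<close>

definition open_cells :: "('d::finite node \<Rightarrow> bool) \<Rightarrow> nat \<Rightarrow> ('d \<Rightarrow> int) set" where
  "open_cells \<omega> m = {j \<in> grid m. retained \<omega> m j}"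

lemma level_set_open_cells: "level_set \<omega> m = (\<Union>j\<in>open_cells \<omega> m. cell m j)"
  by (simp add: level_set_def open_cells_def)

lemma finite_open_cells: "finite (open_cells \<omega> m)"
  unfolding open_cells_def using finite_grid by (rule finite_subset[rotated]) auto

text \<open>The last condition is a division-free way to say that the lower corners of the two cells
  differ by at least \<open>1 / N ^ n\<close> in some coordinate, a distance independent of
  \<open>m\<close>.\<close>

definition linked :: "('d::finite node \<Rightarrow> bool) \<Rightarrow> nat \<Rightarrow> nat \<Rightarrow> bool" where
  "linked \<omega> n m \<longleftrightarrow> (\<exists>a\<in>open_cells \<omega> m. \<exists>b\<in>open_cells \<omega> m.
    chain (open_cells \<omega> m) a b \<and> (\<exists>i. L m \<le> \<bar>a i - b i\<bar> * L n))"

text \<open>A measurable substitute for the failure of total disconnectedness: a countable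
  combination of events on finitely many cubes. The equivalence is
  \<open>not_totally_disconnected_lim_iff\<close>.\<close>

definition nontriv :: "('d::finite node \<Rightarrow> bool) \<Rightarrow> bool" where
  "nontriv \<omega> \<longleftrightarrow> (\<exists>n. \<forall>m\<ge>n. linked \<omega> n m)"

lemma connected_pair_chain:
  fixes \<omega> :: "'d::finite node \<Rightarrow> bool"
  assumes K: "connected K" "K \<subseteq> lim_set \<omega>" "x \<in> K" "y \<in> K"
  obtains a b where "a \<in> open_cells \<omega> m" "b \<in> open_cells \<omega> m" "chain (open_cells \<omega> m) a b"
    "x \<in> cell m a" "y \<in> cell m b"
proof -
  have sub: "K \<subseteq> (\<Union>j\<in>open_cells \<omega> m. cell m j)"
    using K(2) unfolding lim_set_def level_set_open_cells by blast
  then obtain a b where ab: "a \<in> open_cells \<omega> m" "x \<in> cell m a" "b \<in> open_cells \<omega> m" "y \<in> cell m b"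
    using K(3,4) by blast
  then show thesis
    using that connected_chain[OF K(1) sub finite_open_cells ab(1,3) K(3) ab(2) K(4) ab(4)] by blast
qed

lemma cell_index_distance:
  assumes "x \<in> cell m a" "y \<in> cell m b"
  shows "\<bar>x $ i - y $ i\<bar> * S m - 1 \<le> real_of_int \<bar>a i - b i\<bar>"
proof -
  have "real_of_int (a i) \<le> x $ i * S m" "x $ i * S m \<le> real_of_int (a i) + 1"
    "real_of_int (b i) \<le> y $ i * S m" "y $ i * S m \<le> real_of_int (b i) + 1"
    using assms by (auto simp: mem_cell)
  then have "\<bar>x $ i * S m - y $ i * S m\<bar> - 1 \<le> real_of_int \<bar>a i - b i\<bar>" by (simp add: abs_if; linarith)
  moreover have "\<bar>x $ i * S m - y $ i * S m\<bar> = \<bar>x $ i - y $ i\<bar> * S m"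
    by (metis S_pos(3) abs_mult abs_of_nonneg left_diff_distrib)
  ultimately show ?thesis by simp
qed

lemma nontriv_if_connected:
  fixes \<omega> :: "'d::finite node \<Rightarrow> bool"
  assumes K: "connected K" "K \<subseteq> lim_set \<omega>" "x \<in> K" "y \<in> K" "x \<noteq> y"
  shows "nontriv \<omega>"
proof -
  obtain i where "x $ i \<noteq> y $ i" using K(5) by (auto simp: vec_eq_iff)
  then have "0 < \<bar>x $ i - y $ i\<bar> / 2" by simp
  \<comment> \<open>The factor 2 pays for passing from points to cell indices, which loses one cell:
    \<open>2 * S m - S n\<close> is still at least \<open>S m\<close> when
    \<open>n \<le> m\<close>.\<close>
  then obtain n where "1 / S n < \<bar>x $ i - y $ i\<bar> / 2" using ex_inverse_S_less by blast
  then have n: "2 < \<bar>x $ i - y $ i\<bar> * S n" by (simp add: field_simps)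
  have "linked \<omega> n m" if "n \<le> m" for m
  proof -
    obtain a b where ab: "a \<in> open_cells \<omega> m" "b \<in> open_cells \<omega> m" "chain (open_cells \<omega> m) a b"
      "x \<in> cell m a" "y \<in> cell m b"
      by (rule connected_pair_chain[OF K(1-4)])
    have mn: "S n \<le> S m" using that N2 by (intro power_increasing) auto
    have "(\<bar>x $ i - y $ i\<bar> * S m - 1) * S n \<le> real_of_int \<bar>a i - b i\<bar> * S n"
      by (intro mult_right_mono cell_index_distance[OF ab(4,5)]) simp
    moreover have "2 * S m \<le> \<bar>x $ i - y $ i\<bar> * S n * S m" using n by (intro mult_right_mono) auto
    moreover have "(\<bar>x $ i - y $ i\<bar> * S m - 1) * S n = \<bar>x $ i - y $ i\<bar> * S n * S m - S n"
      by (simp add: algebra_simps)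
    ultimately have "S m \<le> real_of_int \<bar>a i - b i\<bar> * S n" using mn by linarith
    then have "real_of_int (L m) \<le> real_of_int (\<bar>a i - b i\<bar> * L n)" by simp
    then have "L m \<le> \<bar>a i - b i\<bar> * L n" by (simp only: of_int_le_iff)
    then show ?thesis using ab by (auto simp: linked_def)
  qed
  then show ?thesis by (auto simp: nontriv_def)
qed

text \<open>Conversely, long chains at all levels produce a nontrivial component by compactness: if the
  limits \<open>x \<noteq> y\<close> of the end points were separated by a clopen set of the limit set, then disjoint open
  neighbourhoods of the two parts would already disconnect the chains at deep levels.\<close>
lemma connected_limit:
  fixes \<omega> :: "'d::finite node \<Rightarrow> bool"
  assumes xy: "\<And>m. \<exists>l\<ge>m. \<exists>K x y. connected K \<and> K \<subseteq> level_set \<omega> l \<and> x \<in> K \<and> y \<in> K \<and> c \<le> dist x y" and c: "0 < c"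
  shows "\<not> totally_disconnected (lim_set \<omega>)"
proof
  assume td: "totally_disconnected (lim_set \<omega>)"
  have "\<exists>K x y. connected K \<and> K \<subseteq> level_set \<omega> m \<and> x \<in> K \<and> y \<in> K \<and> c \<le> dist x y" for m
    using xy[of m] level_set_antimono[of m _ \<omega>] by (meson order_trans)
  then obtain K x y where K: "\<And>m. connected (K m)" "\<And>m. K m \<subseteq> level_set \<omega> m"
    "\<And>m. x m \<in> K m" "\<And>m. y m \<in> K m" "\<And>m::nat. c \<le> dist (x m) (y m)" by metis
  let ?Q = "cell 0 (\<lambda>_::'d. 0)"
  have lev: "level_set \<omega> m \<subseteq> ?Q" for m
    using level_set_antimono[of 0 m \<omega>] by (auto simp: level_set_def)
  have "compact (?Q \<times> ?Q)" by (intro compact_Times compact_cell)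
  moreover have "\<forall>m. (x m, y m) \<in> ?Q \<times> ?Q" using K lev by blast
  ultimately obtain z r where z: "z \<in> ?Q \<times> ?Q" "strict_mono (r::nat\<Rightarrow>nat)" "((\<lambda>m. (x m, y m)) \<circ> r) \<longlonglongrightarrow> z"
    unfolding compact_eq_seq_compact_metric seq_compact_def by meson
  have lx: "(\<lambda>m. x (r m)) \<longlonglongrightarrow> fst z" and ly: "(\<lambda>m. y (r m)) \<longlonglongrightarrow> snd z"
    using tendsto_fst[OF z(3)] tendsto_snd[OF z(3)] by (simp_all add: comp_def)
  have in_lim: "w \<in> lim_set \<omega>" if "(\<lambda>m. u (r m)) \<longlonglongrightarrow> w" "\<And>m. u m \<in> level_set \<omega> m" for u w
    unfolding lim_set_def
  proof
    fix m
    have "eventually (\<lambda>k. u (r k) \<in> level_set \<omega> m) sequentially"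
      unfolding eventually_sequentially
    proof (intro exI[of _ m] allI impI)
      fix k assume "m \<le> k"
      then have "m \<le> r k" using seq_suble[OF z(2), of k] by linarith
      then show "u (r k) \<in> level_set \<omega> m" using that(2) level_set_antimono by blast
    qed
    then show "w \<in> level_set \<omega> m"
      by (intro Lim_in_closed_set[OF compact_imp_closed[OF compact_level_set] _ _ that(1)]) auto
  qed
  have x: "fst z \<in> lim_set \<omega>" and y: "snd z \<in> lim_set \<omega>"
    using in_lim[OF lx] in_lim[OF ly] K by blast+
  have "c \<le> dist (fst z) (snd z)"
    by (rule LIMSEQ_le_const[OF tendsto_dist[OF lx ly]]) (use K(5) in auto)
  then have ne: "fst z \<noteq> snd z" using c by auto
  have "connected_component_set (lim_set \<omega>) (fst z) = {fst z}"
    using td x by (simp add: totally_disconnected_def)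
  then have comp: "{fst z} \<in> components (lim_set \<omega>)" using x by (auto simp: components_def)
  obtain A where A: "openin (top_of_set (lim_set \<omega>)) A" "compact A" "{fst z} \<subseteq> A" "A \<subseteq> - {snd z}"
    by (rule Sura_Bura_clopen_subset[OF closed_imp_locally_compact[OF compact_imp_closed[OF compact_lim_set]] comp, of "- {snd z}"])
       (use ne in auto)
  have "closedin (top_of_set (lim_set \<omega>)) (lim_set \<omega> - A)" using A(1) by (simp add: closedin_diff)
  then have "closed (lim_set \<omega> - A)"
    using compact_imp_closed[OF compact_lim_set] closedin_closed_trans by blast
  then obtain U V where UV: "open U" "open V" "A \<subseteq> U" "lim_set \<omega> - A \<subseteq> V" "U \<inter> V = {}"
    using separation_normal[OF compact_imp_closed[OF A(2)], of "lim_set \<omega> - A"] by blast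
  have "lim_set \<omega> \<subseteq> U \<union> V" using UV by blast
  then obtain M where M: "level_set \<omega> M \<subseteq> U \<union> V"
    using level_set_subset_open UV(1,2) open_Un by metis
  have "fst z \<in> U" "snd z \<in> V" using A UV y by blast+
  then have "eventually (\<lambda>m. x (r m) \<in> U) sequentially" "eventually (\<lambda>m. y (r m) \<in> V) sequentially"
    using topological_tendstoD[OF lx UV(1)] topological_tendstoD[OF ly UV(2)] by auto
  moreover have "eventually (\<lambda>m. M \<le> r m) sequentially"
    using filterlim_subseq[OF z(2)] unfolding filterlim_at_top by blast
  ultimately have "eventually (\<lambda>m. x (r m) \<in> U \<and> y (r m) \<in> V \<and> M \<le> r m) sequentially"
    by eventually_elim auto
  then obtain m where m: "x (r m) \<in> U" "y (r m) \<in> V" "M \<le> r m"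
    unfolding eventually_sequentially by blast
  have sub: "K (r m) \<subseteq> U \<union> V" using K(2) level_set_antimono[OF m(3)] M by blast
  show False
    using connectedD[OF K(1)[of "r m"] UV(1,2)] sub UV(5) m K(3,4) by blast
qed

lemma corner_dist_ge:
  fixes a b :: "'d::finite \<Rightarrow> int"
  assumes "L m \<le> \<bar>a i - b i\<bar> * L n"
  shows "1 / S n \<le> dist (\<chi> i. real_of_int (a i) / S m) (\<chi> i. real_of_int (b i) / S m)"
proof -
  have "real_of_int (L m) \<le> real_of_int (\<bar>a i - b i\<bar> * L n)" using assms by (simp only: of_int_le_iff)
  then have "S m \<le> \<bar>real_of_int (a i) - real_of_int (b i)\<bar> * S n" by simp
  then have "1 / S n \<le> \<bar>real_of_int (a i) - real_of_int (b i)\<bar> / S m" by (simp add: field_simps)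
  also have "\<dots> = \<bar>real_of_int (a i) / S m - real_of_int (b i) / S m\<bar>"
    by (simp add: diff_divide_distrib[symmetric] abs_divide)
  also have "\<dots> \<le> dist (\<chi> i. real_of_int (a i) / S m) (\<chi> i. real_of_int (b i) / S m)"
    using component_le_norm_cart[of "(\<chi> i. real_of_int (a i) / S m) - (\<chi> i. real_of_int (b i) / S m)" i]
    by (simp add: dist_norm)
  finally show ?thesis .
qed

lemma nontriv_imp_not_td:
  fixes \<omega> :: "'d::finite node \<Rightarrow> bool"
  assumes "nontriv \<omega>"
  shows "\<not> totally_disconnected (lim_set \<omega>)"
proof -
  obtain n where n: "\<And>m. n \<le> m \<Longrightarrow> linked \<omega> n m" using assms by (auto simp: nontriv_def)
  show ?thesis
  proof (rule connected_limit[where c="1 / S n"])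
    fix m
    have "linked \<omega> n (max n m)" by (rule n) simp
    then obtain a b i where ab: "a \<in> open_cells \<omega> (max n m)" "chain (open_cells \<omega> (max n m)) a b"
      "L (max n m) \<le> \<bar>a i - b i\<bar> * L n" by (auto simp: linked_def)
    obtain K where K: "connected K" "K \<subseteq> level_set \<omega> (max n m)" "cell (max n m) a \<subseteq> K" "cell (max n m) b \<subseteq> K"
      using chain_connected[OF ab(2,1), of "max n m"] unfolding level_set_open_cells by blast
    then show "\<exists>l\<ge>m. \<exists>K x y. connected K \<and> K \<subseteq> level_set \<omega> l \<and> x \<in> K \<and> y \<in> K \<and> 1 / S n \<le> dist x y"
      using corner_dist_ge[of "max n m" a i b n, OF ab(3)] corner_in_cell[of a "max n m"] corner_in_cell[of b "max n m"]
      by (intro exI[of _ "max n m"]) (auto, blast)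
  qed simp
qed

lemma not_totally_disconnected_lim_iff: "\<not> totally_disconnected (lim_set \<omega>) \<longleftrightarrow> nontriv \<omega>"
  using nontriv_imp_not_td nontriv_if_connected not_totally_disconnected_iff by metis

lemma dep_open_cells: "dep (tree_nodes \<inter> {(l, j). l \<le> m}) (\<lambda>\<omega>. open_cells \<omega> m)"
proof (rule depI)
  fix \<omega> \<omega>' :: "'a node \<Rightarrow> bool"
  assume *: "\<And>x. x \<in> tree_nodes \<inter> {(l, j). l \<le> m} \<Longrightarrow> \<omega> x = \<omega>' x"
  have "retained \<omega> m j = retained \<omega>' m j" if "j \<in> grid m" for j
    by (rule depD[OF dep_retained_grid[OF that]]) (rule *)
  then show "open_cells \<omega> m = open_cells \<omega>' m" by (auto simp: open_cells_def)
qed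

lemma dep_linked: "dep (tree_nodes \<inter> {(l, j). l \<le> m}) (\<lambda>\<omega>. linked \<omega> n m)"
  unfolding linked_def by (rule dep_compose[OF dep_open_cells])

lemma dep_nontriv: "dep tree_nodes nontriv"
proof (rule depI)
  fix \<omega> \<omega>' :: "'a node \<Rightarrow> bool" assume *: "\<And>x. x \<in> tree_nodes \<Longrightarrow> \<omega> x = \<omega>' x"
  have "linked \<omega> n m = linked \<omega>' n m" for n m
    by (rule depD[OF dep_linked]) (use * in auto)
  then show "nontriv \<omega> = nontriv \<omega>'" by (simp add: nontriv_def)
qed

lemma nontriv_sets: "{\<omega> :: 'd::finite node \<Rightarrow> bool. nontriv \<omega>} \<in> sets (BF p)"
proof -
  have "{\<omega> :: 'd node \<Rightarrow> bool. nontriv \<omega>} = (\<Union>n. \<Inter>m\<in>{n..}. {\<omega>. linked \<omega> n m})"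
    by (auto simp: nontriv_def)
  also have "\<dots> \<in> sets (BF p)"
    using dep_finite_sets[OF dep_linked finite_tree_nodes_le]
    by (intro sets.countable_UN' sets.countable_INT'') auto
  finally show ?thesis .
qed

lemma nontriv_survives: "nontriv \<omega> \<Longrightarrow> survives \<omega>"
  using not_totally_disconnected_lim_iff[of \<omega>] lim_set_nonempty_iff[of \<omega>]
  by (auto simp: totally_disconnected_def)

section \<open>Density of the connected part\<close>

lemma nontriv_shift_connected:
  fixes \<omega> :: "'d::finite node \<Rightarrow> bool"
  assumes "k \<in> grid n" "retained \<omega> n k" "nontriv (shift n k \<omega>)"
  shows "\<exists>K x y. connected K \<and> K \<subseteq> lim_set \<omega> \<inter> cell n k \<and> x \<in> K \<and> y \<in> K \<and> x \<noteq> y"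
proof -
  obtain K x y where K: "connected K" "K \<subseteq> lim_set (shift n k \<omega>)" "x \<in> K" "y \<in> K" "x \<noteq> y"
    using assms(3) not_totally_disconnected_lim_iff not_totally_disconnected_iff by metis
  have "connected (zoom n k ` K)" by (rule connected_continuous_image[OF continuous_on_zoom K(1)])
  moreover have "zoom n k ` K \<subseteq> lim_set \<omega> \<inter> cell n k" using zoom_lim_set[OF assms(1,2)] K(2) by blast
  moreover have "zoom n k x \<noteq> zoom n k y" using inj_zoom K(5) by (metis injD)
  ultimately show ?thesis using K(3,4) by blast
qed

lemma nontriv_inherit:
  fixes \<omega> :: "'d::finite node \<Rightarrow> bool"
  assumes "k \<in> grid 1" "\<omega> (1, k)" "nontriv (shift 1 k \<omega>)"
  shows "nontriv \<omega>"
  using nontriv_shift_connected[OF assms(1) _ assms(3)] assms(2) nontriv_if_connected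
  by (auto simp: retained_1)

lemma AE_nontriv:
  assumes p: "0 < p" "p \<le> 1" and pos: "measure (BF p) {\<omega> :: 'd::finite node \<Rightarrow> bool. nontriv \<omega>} > 0"
  shows "AE \<omega> in (BF p :: ('d node \<Rightarrow> bool) measure). survives \<omega> \<longrightarrow> nontriv \<omega>"
  by (rule zero_one_law[OF p nontriv_sets dep_nontriv nontriv_inherit nontriv_survives pos])

lemma AE_shift:
  fixes P :: "('d node \<Rightarrow> bool) \<Rightarrow> bool"
  assumes "AE \<omega> in BF p. P \<omega>"
  shows "AE \<omega> in BF p. P (shift n k \<omega>)"
proof -
  have "AE \<omega> in distr (BF p) (BF p) (shift n k). P \<omega>"
    unfolding shift_def[abs_def] distr_BF_reindex[OF inj_shift_idx] by (rule assms)
  then show ?thesis by (rule AE_distrD[OF measurable_shift])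
qed

text \<open>Koenig's argument along the cells containing \<open>x\<close>. A point on a common face
  does not determine its cell, and different depths may use different cells; finiteness of
  \<open>grid n\<close> yields one that works at all depths.\<close>

lemma survives_shift_near:
  fixes \<omega> :: "'d::finite node \<Rightarrow> bool"
  assumes "x \<in> lim_set \<omega>"
  shows "\<exists>k\<in>grid n. retained \<omega> n k \<and> x \<in> cell n k \<and> survives (shift n k \<omega>)"
proof (rule ccontr)
  assume "\<not> ?thesis"
  then have "\<forall>k\<in>grid n. \<exists>m. retained \<omega> n k \<and> x \<in> cell n k \<longrightarrow> (\<forall>j\<in>grid m. \<not> retained (shift n k \<omega>) m j)"
    by (auto simp: survives_def)
  then obtain f where f: "\<And>k j. k \<in> grid n \<Longrightarrow> retained \<omega> n k \<Longrightarrow> x \<in> cell n k \<Longrightarrow> j \<in> grid (f k) \<Longrightarrow>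
      \<not> retained (shift n k \<omega>) (f k) j"
    by metis
  define m where "m = Max (f ` grid n)"
  have fm: "f k \<le> m" if "k \<in> grid n" for k
    using that finite_grid unfolding m_def by (intro Max_ge) auto
  have "x \<in> level_set \<omega> (n + m)" using assms by (auto simp: lim_set_def)
  then obtain z where z: "z \<in> grid (n + m)" "retained \<omega> (n + m) z" "x \<in> cell (n + m) z" by (rule level_setE)
  let ?k = "anc m z" and ?j = "off m z"
  have k: "?k \<in> grid n" by (rule anc_in_grid[OF z(1)])
  have r: "retained \<omega> n ?k" "retained (shift n ?k \<omega>) m ?j"
    using z(2) retained_sub_grid[OF off_in_grid, of \<omega> n m ?k z] by (simp_all add: sub_anc_off)
  have e: "m = f ?k + (m - f ?k)" using fm[OF k] by simp
  have "anc (m - f ?k) ?j \<in> grid (f ?k)" "retained (shift n ?k \<omega>) (f ?k) (anc (m - f ?k) ?j)"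
    using anc_in_grid[of ?j "f ?k" "m - f ?k"] retained_anc[of "shift n ?k \<omega>" "f ?k" "m - f ?k" ?j]
      off_in_grid[of m z] r(2) fm[OF k] by simp_all
  then show False using f[OF k r(1) cell_anc[OF z(3)]] by blast
qed

text \<open>Each point lies in arbitrarily small retained cells whose trees survive, and by
  hypothesis each of these contains a nontrivial connected subset of the limit set.\<close>

lemma connected_part_dense:
  fixes \<omega> :: "'d::finite node \<Rightarrow> bool"
  assumes "\<And>n k. survives (shift n k \<omega>) \<longrightarrow> nontriv (shift n k \<omega>)"
  shows "lim_set \<omega> \<subseteq> closure (connected_part (lim_set \<omega>))"
proof
  fix x assume x: "x \<in> lim_set \<omega>"
  show "x \<in> closure (connected_part (lim_set \<omega>))"
    unfolding closure_approachable
  proof (intro allI impI)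
    fix e :: real assume "0 < e"
    then have "0 < e / real CARD('d)" by simp
    then obtain n where "1 / S n < e / real CARD('d)" using ex_inverse_S_less by blast
    then have n: "real CARD('d) * (1 / S n) < e" by (simp add: field_simps)
    obtain k where k: "k \<in> grid n" "retained \<omega> n k" "x \<in> cell n k" "survives (shift n k \<omega>)"
      using survives_shift_near[OF x] by blast
    obtain K u v where K: "connected K" "K \<subseteq> lim_set \<omega> \<inter> cell n k" "u \<in> K" "v \<in> K" "u \<noteq> v"
      using nontriv_shift_connected[OF k(1,2)] assms k(4) by blast
    have "u \<in> connected_part (lim_set \<omega>)" using K by (intro connected_partI[of K]) auto
    moreover have "dist u x < e" using cell_dist_le[of u n k x] K(2,3) k(3) n by fastforce
    ultimately show "\<exists>y\<in>connected_part (lim_set \<omega>). dist y x < e" by blast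
  qed
qed


section \<open>The dimension of the connected part\<close>

lemma L2_ge_4: "4 \<le> L 2"
proof -
  have "2 * 2 \<le> int N * int N" using N2 by (intro mult_mono) auto
  then show ?thesis by (simp add: power2_eq_square)
qed

definition boundary :: "('d \<Rightarrow> int) \<Rightarrow> bool" where
  "boundary c \<longleftrightarrow> (\<exists>i. c i = 0 \<or> c i = L 2 - 1)"

text \<open>A cube is isolated if its outermost level-\<open>n + 2\<close> subcubes are all closed.  Components meeting its
  interior are then trapped inside the cube.\<close>
definition isolated :: "('d node \<Rightarrow> bool) \<Rightarrow> nat \<Rightarrow> ('d \<Rightarrow> int) \<Rightarrow> bool" where
  "isolated \<omega> n a \<longleftrightarrow> (\<forall>c\<in>grid 2. boundary c \<longrightarrow> \<not> \<omega> (n + 2, sub 2 a c))"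

text \<open>Isolation is tested only at even levels, because the test at level 2t reads level 2t +
  2. Each step then consumes its own two levels, and the probability factorises along the
  tree.\<close>

definition unisolated :: "nat \<Rightarrow> ('d node \<Rightarrow> bool) \<Rightarrow> ('d \<Rightarrow> int) \<Rightarrow> bool" where
  "unisolated r \<omega> j \<longleftrightarrow> retained \<omega> (2 * r) j \<and>
    (\<forall>t<r. \<not> isolated \<omega> (2 * t) (anc (2 * r - 2 * t) j))"

text \<open>One generation of the two-level process. The isolation test of the root is put into the
  event of every child, so that one generation reads exactly levels 1 and 2.\<close>

definition first_ok :: "('d \<Rightarrow> int) \<Rightarrow> ('d node \<Rightarrow> bool) \<Rightarrow> bool" where
  "first_ok c \<omega> \<longleftrightarrow> retained \<omega> 2 c \<and> \<not> isolated \<omega> 0 (\<lambda>_. 0)"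

lemma isolated_shift: "isolated (shift n k \<omega>) m a \<longleftrightarrow> isolated \<omega> (n + m) (sub m k a)"
  by (simp add: isolated_def shift_apply sub_sub add.assoc)

lemma unisolated_0: "unisolated 0 \<omega> j"
  by (simp add: unisolated_def)

lemma unisolated_Suc:
  assumes "c \<in> grid 2" "j \<in> grid (2 * r)"
  shows "unisolated (Suc r) \<omega> (sub (2 * r) c j) \<longleftrightarrow> first_ok c \<omega> \<and> unisolated r (shift 2 c \<omega>) j"
proof -
  have e: "2 * Suc r = 2 + 2 * r" by simp
  have ret: "retained \<omega> (2 * Suc r) (sub (2 * r) c j) \<longleftrightarrow> retained \<omega> 2 c \<and> retained (shift 2 c \<omega>) (2 * r) j"
    unfolding e by (rule retained_sub_grid[OF assms(2)])
  have z: "isolated \<omega> (2 * 0) (anc (2 * Suc r - 2 * 0) (sub (2 * r) c j)) \<longleftrightarrow> isolated \<omega> 0 (\<lambda>_. 0)"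
    using anc_grid_0[OF sub_in_grid[OF assms]] by (simp add: e)
  have s: "isolated \<omega> (2 * Suc t) (anc (2 * Suc r - 2 * Suc t) (sub (2 * r) c j)) \<longleftrightarrow>
      isolated (shift 2 c \<omega>) (2 * t) (anc (2 * r - 2 * t) j)" if "t < r" for t
    using that by (simp add: isolated_shift anc_sub)
  have "(\<forall>t<Suc r. Q t) \<longleftrightarrow> Q 0 \<and> (\<forall>t<r. Q (Suc t))" for Q
    by (metis All_less_Suc2)
  then show ?thesis unfolding unisolated_def first_ok_def ret
    using z s by (auto simp del: mult_Suc_right)
qed

section \<open>The branching process of unshielded cubes\<close>

definition iso_nodes :: "'d node set" where
  "iso_nodes = {(2, c) |c. c \<in> grid 2 \<and> boundary c}"

lemma finite_iso_nodes: "finite (iso_nodes :: 'd::finite node set)"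
  unfolding iso_nodes_def by (rule finite_subset[of _ "Pair 2 ` grid 2"]) (auto simp: finite_grid)

lemma isolated_root: "isolated \<omega> 0 (\<lambda>_. 0) \<longleftrightarrow> (\<forall>x\<in>iso_nodes. \<omega> x = False)"
  unfolding isolated_def iso_nodes_def add_0 by (auto simp: sub_def)

lemma dep_isolated_root: "dep iso_nodes (\<lambda>\<omega>. isolated \<omega> 0 (\<lambda>_. 0))"
  unfolding isolated_root by (auto simp: dep_def)

lemma dep_first_ok:
  assumes "c \<in> grid 2"
  shows "dep (tree_nodes \<inter> {(l, j). l \<le> 2}) (first_ok c)"
proof -
  have "dep (tree_nodes \<inter> {(l, j). l \<le> 2}) (\<lambda>\<omega>. isolated \<omega> 0 (\<lambda>_. 0))"
    by (rule dep_mono[OF dep_isolated_root]) (auto simp: iso_nodes_def tree_nodes_def)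
  then have "dep (tree_nodes \<inter> {(l, j). l \<le> 2}) (\<lambda>\<omega>. \<not> isolated \<omega> 0 (\<lambda>_. 0))"
    by (rule dep_compose)
  then show ?thesis
    unfolding first_ok_def[abs_def] by (rule dep_conj[OF dep_retained_grid[OF assms]])
qed

lemma dep_unisolated:
  "j \<in> grid (2 * r) \<Longrightarrow> dep (tree_nodes \<inter> {(l, j). l \<le> 2 * r}) (\<lambda>\<omega>. unisolated r \<omega> j)"
proof (induction r arbitrary: j)
  case 0
  show ?case by (simp add: unisolated_0 dep_def)
next
  case (Suc r)
  have "j \<in> grid (2 + 2 * r)" using Suc.prems by simp
  then obtain c j' where j: "c \<in> grid 2" "j' \<in> grid (2 * r)" "j = sub (2 * r) c j'"
    unfolding grid_split by auto
  have "shift_idx 2 c ` (tree_nodes \<inter> {(l, j). l \<le> 2 * r}) \<subseteq> tree_nodes \<inter> {(l, j). l \<le> 2 * Suc r}"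
    using shift_idx_tree_nodes[OF j(1)] by (auto simp: shift_idx_def)
  then have "dep (tree_nodes \<inter> {(l, j). l \<le> 2 * Suc r}) (\<lambda>\<omega>. unisolated r (shift 2 c \<omega>) j')"
    using dep_shift[OF Suc.IH[OF j(2)], of 2 c] by (rule dep_mono[rotated])
  moreover have "dep (tree_nodes \<inter> {(l, j). l \<le> 2 * Suc r}) (first_ok c)"
    by (rule dep_mono[OF dep_first_ok[OF j(1)]]) auto
  ultimately show ?case
    unfolding j(3) unisolated_Suc[OF j(1,2)] by (intro dep_conj)
qed

lemma unisolated_sets:
  "j \<in> grid (2 * r) \<Longrightarrow> {\<omega> :: 'd::finite node \<Rightarrow> bool. unisolated r \<omega> j} \<in> sets (BF p)"
  by (rule dep_finite_sets[OF dep_unisolated finite_tree_nodes_le])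

lemma first_ok_sets:
  "c \<in> grid 2 \<Longrightarrow> {\<omega> :: 'd::finite node \<Rightarrow> bool. first_ok c \<omega>} \<in> sets (BF p)"
  by (rule dep_finite_sets[OF dep_first_ok finite_tree_nodes_le])

text \<open>The mean number of children in one generation of the two-level process. Without the
  isolation test it would be \<open>(p * N ^ CARD('d)) ^ 2\<close>.\<close>

definition kappa :: "real \<Rightarrow> 'd::finite itself \<Rightarrow> real" where
  "kappa p _ = (\<Sum>c\<in>(grid 2 :: ('d \<Rightarrow> int) set). measure (BF p) {\<omega>. first_ok c \<omega>})"

lemma kappa_nonneg: "0 \<le> kappa p TYPE('d::finite)"
  unfolding kappa_def by (intro sum_nonneg) simp

text \<open>Every summand is at most \<open>p ^ 2\<close>. The inner cube with all indices 1 has a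
  strictly smaller one: neither it nor its parent belongs to the shielding layer, so its retention
  is independent of isolation, which has positive probability as p < 1.\<close>

lemma kappa_less:
  assumes p: "0 < p" "p < 1"
  shows "kappa p TYPE('d::finite) < (p * real (N ^ CARD('d))) ^ 2"
proof -
  let ?M = "BF p :: ('d node \<Rightarrow> bool) measure"
  interpret prob_space ?M by (rule prob_space_BF)
  let ?c = "(\<lambda>_. 1) :: 'd \<Rightarrow> int"
  have c: "?c \<in> grid 2" using L2_ge_4 by (auto simp: grid_def)
  have nb: "\<not> boundary ?c" using L2_ge_4 by (auto simp: boundary_def)
  have le: "prob {\<omega>. first_ok c \<omega>} \<le> p ^ 2" for c :: "'d \<Rightarrow> int"
  proof -
    have "prob {\<omega>. first_ok c \<omega>} \<le> prob {\<omega>. retained \<omega> 2 c}"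
      by (rule finite_measure_mono[OF _ retained_sets]) (auto simp: first_ok_def)
    then show ?thesis using prob_retained[of p 2 c] p by simp
  qed
  have less: "prob {\<omega>. first_ok ?c \<omega>} < p ^ 2"
  proof -
    have iso: "prob {\<omega>. isolated \<omega> 0 (\<lambda>_. 0)} = (1 - p) ^ card (iso_nodes :: 'd node set)"
      unfolding isolated_root using prob_finite_cylinder[OF finite_iso_nodes, of p "\<lambda>_. False"] p by simp
    have isoS: "{\<omega> :: 'd node \<Rightarrow> bool. isolated \<omega> 0 (\<lambda>_. 0)} \<in> events"
      by (rule dep_finite_sets[OF dep_isolated_root finite_iso_nodes])
    let ?J = "{(l, anc (2 - l) ?c) |l. l \<in> {1..2}}"
    have "?J \<inter> iso_nodes = {}"
      using nb by (auto simp: iso_nodes_def)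
    then have "prob {\<omega>. retained \<omega> 2 ?c \<and> isolated \<omega> 0 (\<lambda>_. 0)} =
        prob {\<omega>. retained \<omega> 2 ?c} * prob {\<omega>. isolated \<omega> 0 (\<lambda>_. 0)}"
      by (intro prob_conj_dep[OF retained_sets isoS dep_retained dep_isolated_root])
    then have pos: "0 < prob {\<omega>. retained \<omega> 2 ?c \<and> isolated \<omega> 0 (\<lambda>_. 0)}"
      using p prob_retained[of p 2 ?c] by (simp add: iso)
    have S: "{\<omega>. retained \<omega> 2 ?c \<and> isolated \<omega> 0 (\<lambda>_. 0)} \<in> events"
      using sets.Int[OF retained_sets isoS, of 2 ?c] by (simp add: Collect_conj_eq)
    have "prob ({\<omega>. retained \<omega> 2 ?c} - {\<omega>. retained \<omega> 2 ?c \<and> isolated \<omega> 0 (\<lambda>_. 0)}) =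
        prob {\<omega>. retained \<omega> 2 ?c} - prob {\<omega>. retained \<omega> 2 ?c \<and> isolated \<omega> 0 (\<lambda>_. 0)}"
      by (rule finite_measure_Diff[OF retained_sets S]) auto
    moreover have "{\<omega>. retained \<omega> 2 ?c} - {\<omega>. retained \<omega> 2 ?c \<and> isolated \<omega> 0 (\<lambda>_. 0)} = {\<omega>. first_ok ?c \<omega>}"
      by (auto simp: first_ok_def)
    ultimately show ?thesis using pos prob_retained[of p 2 ?c] p by simp
  qed
  have "kappa p TYPE('d) < (\<Sum>c\<in>(grid 2 :: ('d \<Rightarrow> int) set). p ^ 2)"
    unfolding kappa_def by (rule sum_strict_mono_ex1[OF finite_grid]) (use le less c in auto)
  also have "\<dots> = (p * real (N ^ CARD('d))) ^ 2"
    by (simp add: card_grid power_mult_distrib mult.commute flip: power_mult)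
  finally show ?thesis .
qed

lemma prob_unisolated_Suc:
  fixes c :: "'d::finite \<Rightarrow> int"
  assumes "c \<in> grid 2" "j \<in> grid (2 * r)"
  shows "measure (BF p) {\<omega>. unisolated (Suc r) \<omega> (sub (2 * r) c j)} =
    measure (BF p) {\<omega>. first_ok c \<omega>} * measure (BF p) {\<omega>. unisolated r \<omega> j}"
proof -
  have "measure (BF p) {\<omega>. first_ok c \<omega> \<and> unisolated r (shift 2 c \<omega>) j} =
      measure (BF p) {\<omega>. first_ok c \<omega>} * measure (BF p) {\<omega>. unisolated r (shift 2 c \<omega>) j}"
  proof (rule prob_conj_dep[OF first_ok_sets[OF assms(1)] _ dep_first_ok[OF assms(1)]])
    show "{\<omega>. unisolated r (shift 2 c \<omega>) j} \<in> sets (BF p)"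
      by (rule prob_shift(2)[OF unisolated_sets[OF assms(2)]])
    show "dep (shift_idx 2 c ` (tree_nodes \<inter> {(l, j). l \<le> 2 * r})) (\<lambda>\<omega>. unisolated r (shift 2 c \<omega>) j)"
      by (rule dep_shift[OF dep_unisolated[OF assms(2)]])
    show "tree_nodes \<inter> {(l, j). l \<le> 2} \<inter> shift_idx 2 c ` (tree_nodes \<inter> {(l, j). l \<le> 2 * r}) = {}"
      by (auto simp: shift_idx_def tree_nodes_def)
  qed
  also have "measure (BF p) {\<omega>. unisolated r (shift 2 c \<omega>) j} = measure (BF p) {\<omega>. unisolated r \<omega> j}"
    by (rule prob_shift(1)[OF unisolated_sets[OF assms(2)]])
  finally show ?thesis by (simp only: unisolated_Suc[OF assms])
qed

lemma sum_prob_unisolated: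
  "(\<Sum>j\<in>(grid (2 * r) :: ('d::finite \<Rightarrow> int) set). measure (BF p) {\<omega>. unisolated r \<omega> j}) = kappa p TYPE('d) ^ r"
proof (induction r)
  case 0
  show ?case by (simp add: unisolated_0)
next
  case (Suc r)
  have inj: "inj_on (\<lambda>(c, j). sub (2 * r) c j) (grid 2 \<times> grid (2 * r) :: (('d \<Rightarrow> int) \<times> ('d \<Rightarrow> int)) set)"
    by (rule inj_on_subset[OF inj_on_sub]) auto
  have "(\<Sum>j\<in>(grid (2 * Suc r) :: ('d \<Rightarrow> int) set). measure (BF p) {\<omega>. unisolated (Suc r) \<omega> j}) =
      (\<Sum>j\<in>(\<lambda>(c, j). sub (2 * r) c j) ` (grid 2 \<times> grid (2 * r) :: (('d \<Rightarrow> int) \<times> ('d \<Rightarrow> int)) set).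
        measure (BF p) {\<omega>. unisolated (Suc r) \<omega> j})"
    by (simp only: mult_Suc_right grid_split)
  also have "\<dots> = (\<Sum>(c, j)\<in>(grid 2 \<times> grid (2 * r) :: (('d \<Rightarrow> int) \<times> ('d \<Rightarrow> int)) set).
      measure (BF p) {\<omega>. unisolated (Suc r) \<omega> (sub (2 * r) c j)})"
    by (subst sum.reindex[OF inj]) (auto intro!: sum.cong)
  also have "\<dots> = (\<Sum>(c, j)\<in>(grid 2 \<times> grid (2 * r) :: (('d \<Rightarrow> int) \<times> ('d \<Rightarrow> int)) set).
      measure (BF p) {\<omega>. first_ok c \<omega>} * measure (BF p) {\<omega>. unisolated r \<omega> j})"
    by (intro sum.cong refl) (auto simp: prob_unisolated_Suc)
  also have "\<dots> = kappa p TYPE('d) * (\<Sum>j\<in>(grid (2 * r) :: ('d \<Rightarrow> int) set). measure (BF p) {\<omega>. unisolated r \<omega> j})"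
    unfolding kappa_def by (simp add: sum_product sum.cartesian_product)
  finally show ?case by (simp add: Suc)
qed

definition unisolated_pairs :: "nat \<Rightarrow> nat \<Rightarrow> ('d node \<Rightarrow> bool) \<Rightarrow> (('d \<Rightarrow> int) \<times> ('d \<Rightarrow> int)) set" where
  "unisolated_pairs n r \<omega> = {(k, j). k \<in> grid n \<and> j \<in> grid (2 * r) \<and> unisolated r (shift n k \<omega>) j}"

lemma finite_unisolated_pairs: "finite (unisolated_pairs n r \<omega> :: (('d::finite \<Rightarrow> int) \<times> ('d \<Rightarrow> int)) set)"
  by (rule finite_subset[of _ "grid n \<times> grid (2 * r)"]) (auto simp: unisolated_pairs_def finite_grid)

lemma expectation_unisolated_pairs:
  fixes n r :: nat
  defines "f \<equiv> \<lambda>\<omega> :: 'd::finite node \<Rightarrow> bool. real (card (unisolated_pairs n r \<omega>))"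
  shows "integrable (BF p) f"
    and "(\<integral>\<omega>. f \<omega> \<partial>BF p) = real (card (grid n :: ('d \<Rightarrow> int) set)) * kappa p TYPE('d) ^ r"
proof -
  let ?M = "BF p :: ('d node \<Rightarrow> bool) measure"
  let ?G = "grid n \<times> grid (2 * r) :: (('d \<Rightarrow> int) \<times> ('d \<Rightarrow> int)) set"
  let ?E = "\<lambda>x. {\<omega>. unisolated r (shift n (fst x) \<omega>) (snd x)}"
  interpret prob_space ?M by (rule prob_space_BF)
  have E: "?E x \<in> events" if "x \<in> ?G" for x
    by (rule prob_shift(2)[OF unisolated_sets]) (use that in auto)
  have f_eq: "f \<omega> = (\<Sum>x\<in>?G. indicat_real (?E x) \<omega>)" for \<omega>
  proof -
    have "(\<Sum>x\<in>?G. indicat_real (?E x) \<omega>) = (\<Sum>x\<in>?G. if unisolated r (shift n (fst x) \<omega>) (snd x) then 1 else 0)"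
      by (intro sum.cong) (auto simp: indicator_def)
    also have "\<dots> = real (card {x \<in> ?G. unisolated r (shift n (fst x) \<omega>) (snd x)})"
      by (subst sum.inter_filter[symmetric]) (auto simp: finite_grid)
    also have "{x \<in> ?G. unisolated r (shift n (fst x) \<omega>) (snd x)} = unisolated_pairs n r \<omega>"
      by (auto simp: unisolated_pairs_def)
    finally show ?thesis by (simp add: f_def)
  qed
  have int: "integrable ?M (indicat_real (?E x))" if "x \<in> ?G" for x
    using E[OF that] by (simp add: emeasure_eq_measure)
  show "integrable ?M f"
    unfolding f_eq[abs_def] by (intro Bochner_Integration.integrable_sum int)
  have "(\<integral>\<omega>. f \<omega> \<partial>?M) = (\<Sum>x\<in>?G. \<integral>\<omega>. indicat_real (?E x) \<omega> \<partial>?M)"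
    unfolding f_eq by (rule Bochner_Integration.integral_sum[OF int])
  also have "\<dots> = (\<Sum>x\<in>?G. measure ?M {\<omega>. unisolated r \<omega> (snd x)})"
  proof (intro sum.cong refl)
    fix x assume x: "x \<in> ?G"
    have "(\<integral>\<omega>. indicat_real (?E x) \<omega> \<partial>?M) = measure ?M (?E x)" using E[OF x] by simp
    also have "\<dots> = measure ?M {\<omega>. unisolated r \<omega> (snd x)}"
      by (rule prob_shift(1)[OF unisolated_sets]) (use x in auto)
    finally show "(\<integral>\<omega>. indicat_real (?E x) \<omega> \<partial>?M) = measure ?M {\<omega>. unisolated r \<omega> (snd x)}" .
  qed
  also have "\<dots> = (\<Sum>k\<in>(grid n :: ('d \<Rightarrow> int) set). \<Sum>j\<in>(grid (2 * r) :: ('d \<Rightarrow> int) set). measure ?M {\<omega>. unisolated r \<omega> j})"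
    unfolding sum.cartesian_product by (simp only: case_prod_unfold)
  also have "\<dots> = real (card (grid n :: ('d \<Rightarrow> int) set)) * kappa p TYPE('d) ^ r"
    by (simp add: sum_prob_unisolated)
  finally show "(\<integral>\<omega>. f \<omega> \<partial>BF p) = real (card (grid n :: ('d \<Rightarrow> int) set)) * kappa p TYPE('d) ^ r" .
qed

text \<open>Inside the open cell \<open>?O\<close> the limit set meets only the closed inner box
  \<open>?I\<close>, the cell without its outer layer of relative width \<open>1 / S 2\<close>.
  Hence \<open>?O\<close> and the complement of \<open>?I\<close> are open sets that would separate
  a connected set reaching both.\<close>

lemma isolated_component:
  fixes \<omega> :: "'d::finite node \<Rightarrow> bool"
  assumes K: "connected K" "K \<subseteq> lim_set \<omega>" "x \<in> K"
    and c: "c \<in> grid 2" "retained \<omega> (n + 2) (sub 2 a c)" "x \<in> cell (n + 2) (sub 2 a c)"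
    and iso: "isolated \<omega> n a"
  shows "K \<subseteq> cell n a"
proof -
  let ?e = "1 / S 2"
  have e: "0 < ?e" by simp
  let ?I = "{y :: real^'d. \<forall>i. real_of_int (a i) + ?e \<le> y $ i * S n \<and> y $ i * S n \<le> real_of_int (a i) + 1 - ?e}"
  let ?O = "{y :: real^'d. \<forall>i. real_of_int (a i) < y $ i * S n \<and> y $ i * S n < real_of_int (a i) + 1}"
  have inner: "y \<in> ?I" if c': "c' \<in> grid 2" "retained \<omega> (n + 2) (sub 2 a c')" "y \<in> cell (n + 2) (sub 2 a c')" for c' y
  proof -
    have "\<omega> (n + 2, sub 2 a c')" using c'(2) by (auto simp: retained_def dest!: bspec[of _ _ "n + 2"])
    then have nb: "\<not> boundary c'" using iso c'(1) by (auto simp: isolated_def)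
    have "real_of_int (a i) + ?e \<le> y $ i * S n \<and> y $ i * S n \<le> real_of_int (a i) + 1 - ?e" for i
    proof -
      have "0 \<le> c' i" "c' i < L 2" using c'(1) by (auto simp: grid_def)
      moreover have "c' i \<noteq> 0" "c' i \<noteq> L 2 - 1" using nb by (auto simp: boundary_def)
      ultimately have "1 \<le> c' i" "c' i \<le> L 2 - 2" by auto
      then have r: "real_of_int 1 \<le> real_of_int (c' i)" "real_of_int (c' i) \<le> real_of_int (L 2 - 2)"
        by (simp_all only: of_int_le_iff)
      have "real_of_int (sub 2 a c' i) \<le> y $ i * S (n + 2)" "y $ i * S (n + 2) \<le> real_of_int (sub 2 a c' i) + 1"
        using c'(3) unfolding mem_cell by blast+
      then have "real_of_int (a i) * S 2 + real_of_int (c' i) \<le> (y $ i * S n) * S 2"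
        "(y $ i * S n) * S 2 \<le> real_of_int (a i) * S 2 + real_of_int (c' i) + 1"
        by (simp_all only: sub_def power_add mult.assoc of_int_add of_int_mult real_of_L)
      then have "(real_of_int (a i) + ?e) * S 2 \<le> (y $ i * S n) * S 2"
        "(y $ i * S n) * S 2 \<le> (real_of_int (a i) + 1 - ?e) * S 2"
        using r by (simp_all add: algebra_simps)
      then show ?thesis using S_pos(1)[of 2] by (simp only: mult_le_cancel_right_pos)
    qed
    then show ?thesis by blast
  qed
  have IO: "?I \<subseteq> ?O"
  proof
    fix y assume "y \<in> ?I"
    then have "real_of_int (a i) + ?e \<le> y $ i * S n \<and> y $ i * S n \<le> real_of_int (a i) + 1 - ?e" for i by blast
    then have "real_of_int (a i) < y $ i * S n \<and> y $ i * S n < real_of_int (a i) + 1" for i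
      using e by (smt (verit))
    then show "y \<in> ?O" by blast
  qed
  have OI: "y \<in> ?I" if y: "y \<in> lim_set \<omega>" "y \<in> ?O" for y
  proof -
    have "y \<in> level_set \<omega> (n + 2)" using y(1) by (auto simp: lim_set_def)
    then obtain z where z: "z \<in> grid (n + 2)" "retained \<omega> (n + 2) z" "y \<in> cell (n + 2) z" by (rule level_setE)
    have "y \<in> cell n (anc 2 z)" by (rule cell_anc[OF z(3)])
    then have "anc 2 z i = a i" for i
    proof -
      have "real_of_int (anc 2 z i) \<le> y $ i * S n" "y $ i * S n \<le> real_of_int (anc 2 z i) + 1"
        using \<open>y \<in> cell n (anc 2 z)\<close> by (auto simp: mem_cell)
      moreover have "real_of_int (a i) < y $ i * S n" "y $ i * S n < real_of_int (a i) + 1" using y(2) by auto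
      ultimately have "real_of_int (anc 2 z i) < real_of_int (a i) + 1" "real_of_int (a i) < real_of_int (anc 2 z i) + 1"
        by linarith+
      then show ?thesis by linarith
    qed
    then have "anc 2 z = a" by (rule ext)
    then have "z = sub 2 a (off 2 z)" using sub_anc_off[of 2 z] by simp
    then show ?thesis using inner[OF off_in_grid[of 2 z], of y] z by simp
  qed
  have xI: "x \<in> ?I" by (rule inner[OF c])
  have "?O = (\<Inter>i. {y. real_of_int (a i) < y $ i * S n} \<inter> {y. y $ i * S n < real_of_int (a i) + 1})"
    by auto
  also have "open \<dots>"
    by (intro open_INT open_Int ballI open_Collect_less continuous_intros) auto
  finally have "open ?O" .
  moreover have "closed ?I"
    by (intro closed_Collect_all closed_Collect_conj closed_Collect_le continuous_intros)
  then have "open (- ?I)" by (rule open_Compl)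
  moreover have "?O \<inter> - ?I \<inter> K = {}" using OI K(2) by blast
  moreover have "K \<subseteq> ?O \<union> - ?I" using IO by blast
  moreover have "?O \<inter> K \<noteq> {}" using xI IO K(3) by blast
  ultimately have "- ?I \<inter> K = {}" using connectedD[OF K(1)] by blast
  then have "K \<subseteq> ?I" by blast
  also have "?I \<subseteq> cell n a"
  proof
    fix y assume "y \<in> ?I"
    then have "y \<in> ?O" using IO by blast
    then show "y \<in> cell n a" unfolding mem_cell by (blast intro: less_imp_le)
  qed
  finally show ?thesis .
qed

text \<open>An isolated ancestor at a level n + 2t would confine \<open>K\<close> to a single cell
  of that level, whose diameter is at most \<open>CARD('d) * (1 / S n)\<close> and thus smaller than
  the distance of \<open>x\<close> and \<open>y\<close>.\<close>

lemma large_component_unisolated: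
  fixes \<omega> :: "'d::finite node \<Rightarrow> bool"
  assumes K: "connected K" "K \<subseteq> lim_set \<omega>" "x \<in> K" "y \<in> K" and far: "real CARD('d) * (1 / S n) < dist x y"
  shows "\<exists>(k, j)\<in>unisolated_pairs n r \<omega>. x \<in> cell (n + 2 * r) (sub (2 * r) k j)"
proof -
  have "x \<in> level_set \<omega> (n + 2 * r)" using K(2,3) by (auto simp: lim_set_def)
  then obtain z where z: "z \<in> grid (n + 2 * r)" "retained \<omega> (n + 2 * r) z" "x \<in> cell (n + 2 * r) z" by (rule level_setE)
  define k where "k = anc (2 * r) z"
  define j where "j = off (2 * r) z"
  have zk: "z = sub (2 * r) k j" by (simp add: k_def j_def sub_anc_off)
  have k: "k \<in> grid n" unfolding k_def by (rule anc_in_grid[OF z(1)])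
  have j: "j \<in> grid (2 * r)" unfolding j_def by (rule off_in_grid)
  have "\<not> isolated (shift n k \<omega>) (2 * t) (anc (2 * r - 2 * t) j)" if t: "t < r" for t
  proof
    assume iso: "isolated (shift n k \<omega>) (2 * t) (anc (2 * r - 2 * t) j)"
    define a where "a = anc (2 * r - 2 * t) z"
    have "a = sub (2 * t) k (anc (2 * r - 2 * t) j)"
      unfolding a_def zk using t by (subst anc_sub) auto
    then have isoa: "isolated \<omega> (n + 2 * t) a" using iso by (simp add: isolated_shift)
    define b where "b = anc (2 * r - 2 * t - 2) z"
    have lev: "n + 2 * r = (n + 2 * t + 2) + (2 * r - 2 * t - 2)" using t by simp
    have b: "retained \<omega> (n + 2 * t + 2) b" "x \<in> cell (n + 2 * t + 2) b"
      using z retained_anc cell_anc unfolding b_def lev by blast+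
    have "2 * r - 2 * t - 2 + 2 = 2 * r - 2 * t" using t by linarith
    then have "anc 2 b = a" by (simp only: a_def b_def anc_anc)
    then have bs: "b = sub 2 a (off 2 b)" using sub_anc_off[of 2 b] by simp
    have "K \<subseteq> cell (n + 2 * t) a"
      using isolated_component[OF K(1-3) off_in_grid[of 2 b] _ _ isoa] b bs by simp
    then have "dist x y \<le> real CARD('d) * (1 / S (n + 2 * t))"
      using K(3,4) cell_dist_le by blast
    also have "\<dots> \<le> real CARD('d) * (1 / S n)"
      using N2 by (intro mult_left_mono divide_left_mono power_increasing) auto
    finally show False using far by simp
  qed
  moreover have "retained (shift n k \<omega>) (2 * r) j"
    using z(2) retained_sub_grid[OF j, of \<omega> n k] zk by simp
  ultimately have "(k, j) \<in> unisolated_pairs n r \<omega>"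
    using k j by (simp add: unisolated_pairs_def unisolated_def)
  then show ?thesis using z(3) zk by blast
qed

text \<open>The threshold is the bound of \<open>cell_dist_le\<close> for cells of level
  \<open>n\<close>. These countably many pieces exhaust the connected part, and each has its own
  starting level for the two-level process.\<close>

definition large_part :: "('d::finite node \<Rightarrow> bool) \<Rightarrow> nat \<Rightarrow> (real^'d) set" where
  "large_part \<omega> n = {x. \<exists>K y. connected K \<and> K \<subseteq> lim_set \<omega> \<and> x \<in> K \<and> y \<in> K \<and> real CARD('d) * (1 / S n) < dist x y}"

lemma connected_part_large_part:
  fixes \<omega> :: "'d::finite node \<Rightarrow> bool"
  shows "connected_part (lim_set \<omega>) \<subseteq> (\<Union>n. large_part \<omega> n)"
proof
  fix x assume "x \<in> connected_part (lim_set \<omega>)"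
  then obtain K y where K: "connected K" "K \<subseteq> lim_set \<omega>" "x \<in> K" "y \<in> K" "x \<noteq> y" by (rule connected_partE)
  have "0 < dist x y / real CARD('d)" using K(5) by simp
  then obtain n where "1 / S n < dist x y / real CARD('d)" using ex_inverse_S_less by blast
  then have "real CARD('d) * (1 / S n) < dist x y" by (simp add: field_simps)
  then have "x \<in> large_part \<omega> n" using K unfolding large_part_def by blast
  then show "x \<in> (\<Union>n. large_part \<omega> n)" by blast
qed

text \<open>At most \<open>\<rho> ^ r\<close> cells of diameter of order
  \<open>N ^ (- 2 * r)\<close> cover the piece, and their \<open>s\<close>-sum decays like
  \<open>(\<rho> / S 2 powr s) ^ r\<close>.\<close>

lemma large_part_null:
  fixes \<omega> :: "'d::finite node \<Rightarrow> bool"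
  assumes ev: "eventually (\<lambda>r. real (card (unisolated_pairs n r \<omega>)) \<le> \<rho> ^ r) sequentially"
    and s: "0 < s" and \<rho>: "0 < \<rho>" "\<rho> < S 2 powr s"
  shows "hausdorff_measure s (large_part \<omega> n) = 0"
proof (rule hausdorff_nullI[OF s])
  fix e \<delta> :: real assume e: "0 < e" and d: "0 < \<delta>"
  let ?D = "real CARD('d)"
  let ?B = "\<lambda>r. ?D * (1 / S (n + 2 * r))"
  have lim1: "(\<lambda>r. ?B r) \<longlonglongrightarrow> 0"
  proof -
    have "(\<lambda>r. 1 / S (n + 2 * r)) \<longlonglongrightarrow> 0"
      using LIMSEQ_subseq_LIMSEQ[OF inverse_S_tendsto_0, of "\<lambda>r. n + 2 * r"]
      by (simp add: comp_def strict_mono_def)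
    then show ?thesis by (rule tendsto_mult_right_zero)
  qed
  have "(\<lambda>r. (?D / S n) powr s * (\<rho> / S 2 powr s) ^ r) \<longlonglongrightarrow> 0"
    using \<rho> by (intro tendsto_mult_right_zero LIMSEQ_realpow_zero) auto
  then have "eventually (\<lambda>r. (?D / S n) powr s * (\<rho> / S 2 powr s) ^ r < e) sequentially"
    by (rule order_tendstoD(2)) (rule e)
  moreover have "eventually (\<lambda>r. ?B r < \<delta>) sequentially"
    by (rule order_tendstoD(2)[OF lim1 d])
  ultimately have "eventually (\<lambda>r. (?D / S n) powr s * (\<rho> / S 2 powr s) ^ r < e \<and> ?B r < \<delta> \<and>
      real (card (unisolated_pairs n r \<omega>)) \<le> \<rho> ^ r) sequentially"
    using ev by eventually_elim auto
  then obtain r where r: "(?D / S n) powr s * (\<rho> / S 2 powr s) ^ r < e" "?B r < \<delta>"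
      "real (card (unisolated_pairs n r \<omega>)) \<le> \<rho> ^ r"
    unfolding eventually_sequentially by blast
  have cov: "large_part \<omega> n \<subseteq> (\<Union>(k, j)\<in>unisolated_pairs n r \<omega>. cell (n + 2 * r) (sub (2 * r) k j))"
    using large_component_unisolated[of _ \<omega> _ _ n r] unfolding large_part_def by blast
  have "\<exists>U. cover_within s (?B r) (real (card (unisolated_pairs n r \<omega>)) * ?B r powr s) (large_part \<omega> n) U"
  proof (rule finite_cover_hausdorff_sum[OF finite_unisolated_pairs])
    show "large_part \<omega> n \<subseteq> (\<Union>x\<in>unisolated_pairs n r \<omega>. cell (n + 2 * r) (sub (2 * r) (fst x) (snd x)))"
      using cov by (simp only: case_prod_unfold)
    fix x :: "('d \<Rightarrow> int) \<times> ('d \<Rightarrow> int)"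
    have "diameter (cell (n + 2 * r) (sub (2 * r) (fst x) (snd x))) \<le> ?B r"
      by (rule diameter_le) (auto simp: dist_norm[symmetric] intro: cell_dist_le[simplified])
    then show "bounded (cell (n + 2 * r) (sub (2 * r) (fst x) (snd x))) \<and>
        diameter (cell (n + 2 * r) (sub (2 * r) (fst x) (snd x))) \<le> ?B r"
      using compact_imp_bounded[OF compact_cell] by blast
  qed (use s in auto)
  then obtain U where U: "cover_within s (?B r) (real (card (unisolated_pairs n r \<omega>)) * ?B r powr s) (large_part \<omega> n) U"
    by blast
  have B_eq: "?B r = (?D / S n) * (1 / S (2 * r))" by (simp add: power_add)
  have "real (card (unisolated_pairs n r \<omega>)) * ?B r powr s \<le> \<rho> ^ r * ?B r powr s"
    using r(3) by (intro mult_right_mono) auto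
  also have "\<rho> ^ r * ?B r powr s = (?D / S n) powr s * (\<rho> / S 2 powr s) ^ r"
  proof -
    have "S (2 * r) powr s = (S 2 powr s) ^ r"
      unfolding S_powr by (rule power_mult)
    then have "((?D / S n) * (1 / S (2 * r))) powr s = (?D / S n) powr s * (1 / (S 2 powr s) ^ r)"
      by (simp only: powr_mult powr_divide powr_one_eq_one)
    then show ?thesis unfolding B_eq by (simp add: power_divide)
  qed
  finally have "real (card (unisolated_pairs n r \<omega>)) * ?B r powr s \<le> e" using r(1) by simp
  then show "\<exists>U. cover_within s \<delta> e (large_part \<omega> n) U"
    using cover_within_mono[OF U, of \<delta> e] r(2) by (intro exI[of _ U]) simp
qed

theorem AE_dim_connected_part:
  assumes p: "0 < p" "p < 1" and mean: "1 < p * real (N ^ CARD('d::finite))"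
  shows "AE \<omega> in (BF p :: ('d node \<Rightarrow> bool) measure).
    hausdorff_dim (connected_part (lim_set \<omega>)) < ereal (dim_value p TYPE('d))"
proof -
  let ?m = "p * real (N ^ CARD('d))"
  let ?a = "dim_value p TYPE('d)"
  let ?k = "kappa p TYPE('d)"
  have lnN: "0 < ln (real N)" using N2 by simp
  have m1: "1 < ?m ^ 2" using mean by (intro one_less_power) auto
  \<comment> \<open>The strict gap between \<open>kappa\<close> and the squared mean leaves room for
    a growth rate \<open>\<rho>\<close>, and then for an exponent \<open>s\<close> between
    \<open>ln \<rho> / (2 * ln N)\<close> and the dimension of the limit set. The maximum with 1
    makes \<open>ln \<rho>\<close>, and hence \<open>s\<close>, positive.\<close>
  obtain \<rho> where \<rho>: "max ?k 1 < \<rho>" "\<rho> < ?m ^ 2"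
    using dense[of "max ?k 1" "?m ^ 2"] kappa_less[OF p, where 'd='d] m1 by auto
  have "ln \<rho> < ln (?m ^ 2)" using \<rho> mean by (subst ln_less_cancel_iff) auto
  also have "\<dots> = 2 * ln ?m" using mean by (subst ln_realpow) auto
  finally have "ln \<rho> / (2 * ln (real N)) < ?a"
    using lnN by (simp add: dim_value_def field_simps)
  then obtain s where s: "ln \<rho> / (2 * ln (real N)) < s" "s < ?a" using dense by blast
  have "0 < ln \<rho> / (2 * ln (real N))" using \<rho> lnN by (intro divide_pos_pos) auto
  then have s0: "0 < s" using s by simp
  have "\<rho> < S 2 powr s"
  proof -
    have "ln \<rho> < s * (2 * ln (real N))" using s(1) lnN by (simp only: pos_divide_less_eq mult_pos_pos zero_less_numeral)
    then have "exp (ln \<rho>) < exp (s * (2 * ln (real N)))" by (rule exp_less_mono)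
    then show ?thesis using \<rho> by (simp add: powr_def ln_realpow)
  qed
  note \<rho>_s = this
  have "AE \<omega> in (BF p :: ('d node \<Rightarrow> bool) measure). \<forall>n. eventually (\<lambda>r. real (card (unisolated_pairs n r \<omega>)) \<le> \<rho> ^ r) sequentially"
  proof (subst AE_all_countable, rule allI, rule AE_eventually_le_of_expectation)
    fix n
    show "0 < \<rho> ^ r" for r using \<rho> by simp
    have "0 \<le> ?k / \<rho>" "?k / \<rho> < 1" using \<rho> kappa_nonneg[of p, where 'd='d] by auto
    then have "summable (\<lambda>r. real (card (grid n :: ('d \<Rightarrow> int) set)) * (?k / \<rho>) ^ r)"
      by (intro summable_mult summable_geometric) (simp only: real_norm_def abs_of_nonneg)
    then show "summable (\<lambda>r. (\<integral>\<omega>. real (card (unisolated_pairs n r \<omega>)) \<partial>(BF p :: ('d node \<Rightarrow> bool) measure)) / \<rho> ^ r)"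
      by (simp only: expectation_unisolated_pairs(2) power_divide times_divide_eq_right)
  qed (use expectation_unisolated_pairs(1) in auto)
  then show ?thesis
  proof eventually_elim
    case (elim \<omega>)
    have "hausdorff_measure s (\<Union>n. large_part \<omega> n) = 0"
      by (rule hausdorff_measure_UN_null[OF s0], rule large_part_null[OF _ s0 _ \<rho>_s]) (use elim \<rho> in auto)
    then have "hausdorff_dim (\<Union>n. large_part \<omega> n) \<le> ereal s" using s0 by (intro hausdorff_dim_le) auto
    then have "hausdorff_dim (connected_part (lim_set \<omega>)) \<le> ereal s"
      using hausdorff_dim_mono[OF connected_part_large_part[of \<omega>]] by (rule order_trans[rotated])
    also have "\<dots> < ereal ?a" using s by simp
    finally show ?case .
  qed
qed

end

section \<open>Crossings and the critical parameter\<close>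

lemma chain_map:
  assumes "chain W a b" "\<And>x. x \<in> W \<Longrightarrow> f x \<in> W'" "\<And>x y. x \<in> W \<Longrightarrow> y \<in> W \<Longrightarrow> adj x y \<Longrightarrow> adj (f x) (f y)"
  shows "chain W' (f a) (f b)"
  using assms(1)
proof (induction rule: chain_induct)
  case refl
  show ?case by (rule chain_refl)
next
  case (step b c)
  then show ?case using chain_step[of W' "f a" "f b" "f c"] assms(2,3) by blast
qed

lemma chain_first_exit:
  assumes "chain W a b" "\<not> Q a" "Q b"
  shows "\<exists>c c'. chain W a c \<and> c \<in> W \<and> c' \<in> W \<and> adj c c' \<and> \<not> Q c \<and> Q c' \<and> chain W c' b"
proof -
  have "Q b \<longrightarrow> (\<exists>c c'. chain W a c \<and> c \<in> W \<and> c' \<in> W \<and> adj c c' \<and> \<not> Q c \<and> Q c' \<and> chain W c' b)"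
    using assms(1)
  proof (induction rule: chain_induct)
    case (step b c)
    show ?case
    proof (cases "Q b")
      case True
      then obtain u u' where "chain W a u" "u \<in> W" "u' \<in> W" "adj u u'" "\<not> Q u" "Q u'" "chain W u' b"
        using step by blast
      then show ?thesis using chain_step[of W u' b c] step by blast
    next
      case False
      then show ?thesis using step chain_refl by blast
    qed
  qed (use assms(2) in simp)
  then show ?thesis using assms(3) by blast
qed

context perc
begin

definition box3 :: "nat \<Rightarrow> ('d \<Rightarrow> int) set" where
  "box3 m = {j. \<forall>i. - L m \<le> j i \<and> j i < 2 * L m}"

definition box3_cells :: "('d node \<Rightarrow> bool) \<Rightarrow> nat \<Rightarrow> ('d \<Rightarrow> int) set" where
  "box3_cells \<omega> m = {j \<in> box3 m. retained \<omega> m j}"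

text \<open>The unit cube together with its neighbours is \<open>[-1, 2]^d\<close>; the event says that the retained
  level-\<open>m\<close> cubes cross from the unit cube to (roughly) the boundary of this larger cube.\<close>
definition crosses :: "('d node \<Rightarrow> bool) \<Rightarrow> nat \<Rightarrow> bool" where
  "crosses \<omega> m \<longleftrightarrow> (\<exists>a\<in>grid m \<inter> box3_cells \<omega> m. \<exists>b i. chain (box3_cells \<omega> m) a b \<and> L m \<le> \<bar>a i - b i\<bar>)"

lemma div_bounds: "j div L m * L m \<le> j" "j < (j div L m + 1) * L m"
proof -
  have "j = j div L m * L m + j mod L m" by (rule div_mult_mod_eq[symmetric])
  moreover have "0 \<le> j mod L m" "j mod L m < L m"
    by (rule pos_mod_sign[OF L_pos(1)], rule pos_mod_bound[OF L_pos(1)])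
  moreover have "(j div L m + 1) * L m = j div L m * L m + L m" by (simp add: algebra_simps)
  ultimately show "j div L m * L m \<le> j" "j < (j div L m + 1) * L m" by linarith+
qed

lemma anc_bounds: "anc m x i * L m \<le> x i" "x i < (anc m x i + 1) * L m"
  unfolding anc_def by (rule div_bounds)+

lemma mult_L_less: "a * L m < b * L m \<longleftrightarrow> a < b" "a * L m \<le> b * L m \<longleftrightarrow> a \<le> b"
  using L_pos(1)[of m] by (simp_all only: mult_less_cancel_right_pos mult_le_cancel_right_pos)

lemma anc_in_box3:
  assumes "j \<in> box3 (n + m)"
  shows "anc m j \<in> box3 n"
  unfolding box3_def
proof (rule CollectI, rule allI)
  fix i
  have j: "- L n * L m \<le> j i" "j i < 2 * L n * L m"
    using assms by (auto simp: box3_def power_add mult.assoc)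
  have "- L n * L m < (anc m j i + 1) * L m" using j(1) anc_bounds(2)[of j i m] by linarith
  moreover have "anc m j i * L m < 2 * L n * L m" using j(2) anc_bounds(1)[of m j i] by linarith
  ultimately have "- L n < anc m j i + 1" "anc m j i < 2 * L n" by (simp_all only: mult_L_less)
  then show "- L n \<le> anc m j i \<and> anc m j i < 2 * L n" by linarith
qed

lemma anc_adj:
  assumes "adj x y"
  shows "adj (anc m x) (anc m y)"
  unfolding adj_def
proof
  fix i
  have a: "x i \<le> y i + 1" "y i \<le> x i + 1"
    using assms unfolding adj_def by (metis abs_le_iff diff_le_eq add.commute minus_diff_eq)+
  have "anc m x i * L m < (anc m y i + 2) * L m" if "x i \<le> y i + 1" for x y
    using that anc_bounds(1)[of m x i] anc_bounds(2)[of y i m] L_pos(1)[of m] unfolding distrib_right by linarith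
  then have "anc m x i < anc m y i + 2" "anc m y i < anc m x i + 2" using a by (simp_all only: mult_L_less)
  then show "\<bar>anc m x i - anc m y i\<bar> \<le> 1" by linarith
qed

lemma finite_box3: "finite (box3 m :: ('d::finite \<Rightarrow> int) set)"
proof -
  have "box3 m = (PiE UNIV (\<lambda>_. {- L m..<2 * L m}) :: ('d \<Rightarrow> int) set)"
    by (auto simp: box3_def PiE_iff)
  then show ?thesis by (simp add: finite_PiE)
qed

definition box3_nodes :: "nat \<Rightarrow> 'd node set" where
  "box3_nodes m = {(l, j). 1 \<le> l \<and> l \<le> m \<and> j \<in> box3 l}"

lemma finite_box3_nodes: "finite (box3_nodes m :: 'd::finite node set)"
proof (rule finite_subset)
  show "box3_nodes m \<subseteq> (\<Union>l\<le>m. (\<lambda>j. (l, j)) ` (box3 l :: ('d \<Rightarrow> int) set))"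
    by (auto simp: box3_nodes_def)
qed (simp add: finite_box3)

lemma dep_box3_cells: "dep (box3_nodes m) (\<lambda>\<omega>. box3_cells \<omega> m)"
proof (rule depI)
  fix \<omega> \<omega>' :: "'a node \<Rightarrow> bool"
  assume *: "\<And>x. x \<in> box3_nodes m \<Longrightarrow> \<omega> x = \<omega>' x"
  have "retained \<omega> m j = retained \<omega>' m j" if "j \<in> box3 m" for j
  proof (rule depD[OF dep_retained], rule *)
    fix x assume "x \<in> {(l, anc (m - l) j) |l. l \<in> {1..m}}"
    then obtain l where l: "l \<in> {1..m}" "x = (l, anc (m - l) j)" by blast
    then have "anc (m - l) j \<in> box3 l" using anc_in_box3[of j l "m - l"] that by simp
    then show "x \<in> box3_nodes m" using l by (auto simp: box3_nodes_def)
  qed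
  then show "box3_cells \<omega> m = box3_cells \<omega>' m" by (auto simp: box3_cells_def)
qed

lemma dep_crosses: "dep (box3_nodes m) (\<lambda>\<omega>. crosses \<omega> m)"
  unfolding crosses_def by (rule dep_compose[OF dep_box3_cells])

lemma crosses_sets: "{\<omega> :: 'd::finite node \<Rightarrow> bool. crosses \<omega> m} \<in> sets (BF p)"
  by (rule dep_finite_sets[OF dep_crosses finite_box3_nodes])

text \<open>Let P be the level-\<open>n\<close> parent of \<open>a\<close> and follow the chain
  until it leaves the 3^d block of cubes around P. The last cell inside is still \<open>L m\<close>
  away from \<open>a\<close>, because a full cube lies between the start and the face that is
  crossed. If the chain never leaves, its end \<open>b\<close> is far enough by \<open>far\<close>.
  Recentring at P turns the piece inside into a crossing of the shifted field.\<close>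

lemma crosses_of_chain:
  assumes W: "\<And>x. x \<in> W \<Longrightarrow> retained \<omega> (n + m) x" and ch: "chain W a b" "a \<in> W"
    and far: "2 * L m \<le> \<bar>a i - b i\<bar>"
  shows "crosses (shift n (anc m a) \<omega>) m"
proof -
  define P where "P = anc m a"
  define near where "near = {x. \<forall>i. (P i - 1) * L m \<le> x i \<and> x i < (P i + 2) * L m}"
  have aP: "P i * L m \<le> a i" "a i < (P i + 1) * L m" for i
    unfolding P_def by (rule anc_bounds)+
  have a_near: "a \<in> near"
    unfolding near_def
  proof (rule CollectI, rule allI)
    fix i
    show "(P i - 1) * L m \<le> a i \<and> a i < (P i + 2) * L m"
      using aP[of i] L_pos(1)[of m] unfolding left_diff_distrib distrib_right by linarith
  qed
  have "(\<exists>c i. chain (W \<inter> near) a c \<and> L m \<le> \<bar>a i - c i\<bar>) \<or> chain (W \<inter> near) a b"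
    using ch(1)
  proof (induction rule: chain_induct)
    case (step b c)
    show ?case
    proof (cases "chain (W \<inter> near) a b \<and> c \<notin> near")
      case True
      then have ab: "chain (W \<inter> near) a b" by blast
      have b: "b \<in> near" using chain_in[OF ab] ch(2) a_near by blast
      obtain i where "c i < (P i - 1) * L m \<or> (P i + 2) * L m \<le> c i"
        using True unfolding near_def by (auto simp: not_le not_less)
      moreover have "b i \<le> c i + 1" "c i \<le> b i + 1"
        using step(4) unfolding adj_def by (metis abs_le_iff diff_le_eq add.commute minus_diff_eq)+
      ultimately have "L m \<le> \<bar>a i - b i\<bar>"
        using aP[of i] unfolding left_diff_distrib distrib_right by linarith
      then show ?thesis using ab by blast
    next
      case False
      then show ?thesis using step chain_step[of "W \<inter> near" a b c] chain_in[of "W \<inter> near" a b] ch(2) a_near by blast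
    qed
  qed (simp add: chain_refl)
  then obtain c i where c: "chain (W \<inter> near) a c" "L m \<le> \<bar>a i - c i\<bar>"
  proof (elim disjE)
    assume ab: "chain (W \<inter> near) a b"
    have "L m \<le> \<bar>a i - b i\<bar>" using far L_pos(1)[of m] by linarith
    then show thesis using ab that by blast
  qed blast
  let ?f = "\<lambda>x i. x i - P i * L m"
  have f_sub: "sub m P (?f x) = x" for x by (simp add: sub_def)
  have f_in: "?f x \<in> box3_cells (shift n P \<omega>) m" if "x \<in> W \<inter> near" for x
  proof -
    have "?f x \<in> box3 m"
      unfolding box3_def
    proof (rule CollectI, rule allI)
      fix i
      have "(P i - 1) * L m \<le> x i" "x i < (P i + 2) * L m" using that by (auto simp: near_def)
      then show "- L m \<le> x i - P i * L m \<and> x i - P i * L m < 2 * L m"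
        unfolding left_diff_distrib distrib_right by linarith
    qed
    moreover have "retained (shift n P \<omega>) m (?f x)"
      using W[of x] that retained_shift[of \<omega> n m P "?f x"] by (simp only: f_sub) blast
    ultimately show ?thesis by (simp add: box3_cells_def)
  qed
  have "chain (box3_cells (shift n P \<omega>) m) (?f a) (?f c)"
    by (rule chain_map[OF c(1) f_in]) (auto simp: adj_def)
  moreover have "?f a \<in> grid m"
    unfolding grid_def
  proof (rule CollectI, rule allI)
    fix i
    show "0 \<le> a i - P i * L m \<and> a i - P i * L m < L m"
      using aP[of i] unfolding distrib_right by linarith
  qed
  moreover have "?f a \<in> box3_cells (shift n P \<omega>) m" using f_in ch(2) a_near by blast
  moreover have "L m \<le> \<bar>?f a i - ?f c i\<bar>" using c(2) by simp
  ultimately show ?thesis unfolding crosses_def P_def by blast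
qed

text \<open>The chain spans at least \<open>8 * L m\<close> in one coordinate. Stop it at a cell c'
  whose parent is the first found to differ by 3 or more from the parent of \<open>a\<close>. One
  step earlier the difference was at most 2, so now it is at most 3 and c' is less than
  \<open>4 * L m\<close> away from \<open>a\<close> in that coordinate. More than
  \<open>4 * L m\<close> remain to \<open>b\<close>, enough for a second local crossing around the
  parent of c'.\<close>

lemma crosses_two_scales:
  assumes cr: "crosses \<omega> (n + m)" and n: "8 \<le> L n"
  shows "\<exists>P\<in>box3 n. \<exists>P'\<in>box3 n. (\<exists>i. 3 \<le> \<bar>P i - P' i\<bar>) \<and> crosses (shift n P \<omega>) m \<and> crosses (shift n P' \<omega>) m"
proof -
  let ?W = "box3_cells \<omega> (n + m)"
  obtain a b i where ab: "a \<in> ?W" "chain ?W a b" "L (n + m) \<le> \<bar>a i - b i\<bar>"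
    using cr unfolding crosses_def by blast
  have W: "x \<in> ?W \<Longrightarrow> retained \<omega> (n + m) x" for x by (simp add: box3_cells_def)
  have "8 * L m \<le> L n * L m" using n by (intro mult_right_mono) auto
  then have far: "8 * L m \<le> \<bar>a i - b i\<bar>" using ab(3) unfolding power_add by linarith
  have dist_anc: "\<bar>x i - y i\<bar> < (\<bar>anc m x i - anc m y i\<bar> + 1) * L m" for x y
  proof -
    have "anc m x i * L m - anc m y i * L m = (anc m x i - anc m y i) * L m" by (simp add: left_diff_distrib)
    moreover have "\<bar>(anc m x i - anc m y i) * L m\<bar> = \<bar>anc m x i - anc m y i\<bar> * L m" by (simp add: abs_mult)
    ultimately show ?thesis
      using anc_bounds(1)[of m x i] anc_bounds(1)[of m y i] anc_bounds(2)[of x i m] anc_bounds(2)[of y i m]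
      unfolding distrib_right by linarith
  qed
  let ?Q = "\<lambda>x. \<exists>i. 3 \<le> \<bar>anc m x i - anc m a i\<bar>"
  have "8 * L m < (\<bar>anc m a i - anc m b i\<bar> + 1) * L m" using far dist_anc[of a b] by linarith
  then have "8 < \<bar>anc m a i - anc m b i\<bar> + 1" by (simp only: mult_L_less)
  then have "3 \<le> \<bar>anc m b i - anc m a i\<bar>" by linarith
  then have Qb: "?Q b" by blast
  obtain c c' where c: "c \<in> ?W" "c' \<in> ?W" "adj c c'" "\<not> ?Q c" "?Q c'" "chain ?W c' b"
    using chain_first_exit[of ?W a b ?Q, OF ab(2) _ Qb] by auto
  have "\<bar>anc m c i - anc m a i\<bar> \<le> 2" using c(4) by (auto dest: spec[of _ i])
  moreover have "\<bar>anc m c i - anc m c' i\<bar> \<le> 1" using anc_adj[OF c(3), of m] by (simp add: adj_def)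
  ultimately have "\<bar>anc m a i - anc m c' i\<bar> + 1 \<le> 4" by linarith
  then have "(\<bar>anc m a i - anc m c' i\<bar> + 1) * L m \<le> 4 * L m" by (intro mult_right_mono) auto
  then have "\<bar>a i - c' i\<bar> < 4 * L m" using dist_anc[of a c'] by linarith
  then have far': "2 * L m \<le> \<bar>c' i - b i\<bar>" using far L_pos(1)[of m] by linarith
  have far2: "2 * L m \<le> \<bar>a i - b i\<bar>" using far L_pos(1)[of m] by linarith
  have "crosses (shift n (anc m a) \<omega>) m" by (rule crosses_of_chain[OF W ab(2,1) far2])
  moreover have "crosses (shift n (anc m c') \<omega>) m" by (rule crosses_of_chain[OF W c(6,2) far'])
  moreover have "anc m a \<in> box3 n" "anc m c' \<in> box3 n"
    using ab(1) c(2) anc_in_box3 by (auto simp: box3_cells_def)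
  moreover have "\<exists>i. 3 \<le> \<bar>anc m a i - anc m c' i\<bar>" using c(5) by (metis abs_minus_commute)
  ultimately show ?thesis by blast
qed

lemma disjoint_shifted_box3:
  assumes "3 \<le> \<bar>P i - P' i\<bar>"
  shows "shift_idx n P ` box3_nodes m \<inter> shift_idx n P' ` box3_nodes m = {}"
proof -
  have False if "j \<in> box3 l" "j' \<in> box3 l" "sub l P j = sub l P' j'" for l j j'
  proof -
    have "P i * L l + j i = P' i * L l + j' i" using that(3) by (simp add: sub_def fun_eq_iff)
    then have "(P i - P' i) * L l = j' i - j i" by (simp add: left_diff_distrib)
    then have "\<bar>P i - P' i\<bar> * L l = \<bar>j' i - j i\<bar>" by (metis L_pos(3) abs_mult abs_of_nonneg)
    moreover have "- L l \<le> j i" "j i < 2 * L l" "- L l \<le> j' i" "j' i < 2 * L l"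
      using that(1,2) by (auto simp: box3_def)
    moreover have "3 * L l \<le> \<bar>P i - P' i\<bar> * L l" using assms by (intro mult_right_mono) auto
    ultimately show False by linarith
  qed
  then show ?thesis by (auto simp: shift_idx_def box3_nodes_def)
qed

text \<open>Union bound over the pairs of parents, with independence for each pair. The factor
  depends on neither \<open>m\<close> nor \<open>p\<close>, so that one threshold serves all scales
  and all parameters.\<close>

lemma prob_crosses_two_scales:
  fixes p :: real
  defines "a \<equiv> \<lambda>m. measure (BF p) {\<omega> :: 'd::finite node \<Rightarrow> bool. crosses \<omega> m}"
  assumes n: "8 \<le> L n"
  shows "a (n + m) \<le> real (card (box3 n \<times> box3 n :: (('d \<Rightarrow> int) \<times> ('d \<Rightarrow> int)) set)) * a m ^ 2"
proof -
  let ?M = "BF p :: ('d node \<Rightarrow> bool) measure"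
  interpret prob_space ?M by (rule prob_space_BF)
  let ?F = "{x \<in> box3 n \<times> box3 n :: (('d \<Rightarrow> int) \<times> ('d \<Rightarrow> int)) set. \<exists>i. 3 \<le> \<bar>fst x i - snd x i\<bar>}"
  let ?E = "\<lambda>x. {\<omega>. crosses (shift n (fst x) \<omega>) m \<and> crosses (shift n (snd x) \<omega>) m}"
  have finF: "finite ?F" by (rule finite_subset[of _ "box3 n \<times> box3 n"]) (auto simp: finite_box3)
  have S: "{\<omega>. crosses (shift n P \<omega>) m} \<in> events" for P by (rule prob_shift(2)[OF crosses_sets])
  have E: "?E x \<in> events" for x using sets.Int[OF S S, of "fst x" "snd x"] by (simp add: Collect_conj_eq)
  have PE: "prob (?E x) = a m ^ 2" if x: "x \<in> ?F" for x
  proof -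
    obtain i where i: "3 \<le> \<bar>fst x i - snd x i\<bar>" using x by blast
    have "prob (?E x) = prob {\<omega>. crosses (shift n (fst x) \<omega>) m} * prob {\<omega>. crosses (shift n (snd x) \<omega>) m}"
      by (rule prob_conj_dep[OF S S dep_shift[OF dep_crosses] dep_shift[OF dep_crosses] disjoint_shifted_box3[of "fst x" i "snd x", OF i]])
    then show ?thesis by (simp add: prob_shift(1)[OF crosses_sets] a_def power2_eq_square)
  qed
  have "a (n + m) \<le> prob (\<Union>x\<in>?F. ?E x)"
    unfolding a_def
  proof (rule finite_measure_mono)
    show "{\<omega>. crosses \<omega> (n + m)} \<subseteq> (\<Union>x\<in>?F. ?E x)"
    proof
      fix \<omega> :: "'d node \<Rightarrow> bool" assume "\<omega> \<in> {\<omega>. crosses \<omega> (n + m)}"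
      then obtain P P' where "P \<in> box3 n" "P' \<in> box3 n" "\<exists>i. 3 \<le> \<bar>P i - P' i\<bar>"
          "crosses (shift n P \<omega>) m" "crosses (shift n P' \<omega>) m"
        using crosses_two_scales[OF _ n, of \<omega> m] by blast
      then have "(P, P') \<in> ?F" "\<omega> \<in> ?E (P, P')" by auto
      then show "\<omega> \<in> (\<Union>x\<in>?F. ?E x)" by blast
    qed
    show "(\<Union>x\<in>?F. ?E x) \<in> events" by (intro sets.finite_UN finF E)
  qed
  also have "\<dots> \<le> (\<Sum>x\<in>?F. prob (?E x))"
    by (rule finite_measure_subadditive_finite[OF finF]) (use E in auto)
  also have "\<dots> = real (card ?F) * a m ^ 2" using PE by simp
  also have "\<dots> \<le> real (card (box3 n \<times> box3 n :: (('d \<Rightarrow> int) \<times> ('d \<Rightarrow> int)) set)) * a m ^ 2"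
    by (intro mult_right_mono of_nat_mono card_mono) (auto simp: finite_box3)
  finally show ?thesis .
qed

text \<open>The natural variable is \<open>K * a m\<close>, which the recursion at most squares.
  Once below 1/2 it is at least halved every \<open>n\<close> levels.\<close>

lemma quadratic_recursion_tendsto_0:
  fixes a :: "nat \<Rightarrow> real"
  assumes rec: "\<And>m. a (n + m) \<le> K * a m ^ 2" and nn: "\<And>m. 0 \<le> a m" and K: "0 < K"
    and small: "a m0 < 1 / (2 * K)" and e: "0 < e"
  shows "\<exists>m. a m < e"
proof -
  have "K * a (m0 + r * n) \<le> (1 / 2) ^ Suc r" for r
  proof (induction r)
    case 0
    then show ?case using small K by (simp add: field_simps)
  next
    case (Suc r)
    have h: "K * a (m0 + r * n) \<le> 1 / 2"
      using Suc power_le_one[of "1 / 2 :: real" r] by simp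
    have "a (m0 + Suc r * n) \<le> K * a (m0 + r * n) ^ 2"
      using rec[of "m0 + r * n"] by (simp add: algebra_simps)
    then have "K * a (m0 + Suc r * n) \<le> K * (K * a (m0 + r * n) ^ 2)"
      using K by (intro mult_left_mono) auto
    also have "\<dots> = (K * a (m0 + r * n)) * (K * a (m0 + r * n))" by (simp add: power2_eq_square)
    also have "\<dots> \<le> 1 / 2 * (1 / 2) ^ Suc r"
      using h Suc K nn by (intro mult_mono) auto
    finally show ?case by simp
  qed
  moreover obtain r where "(1 / 2 :: real) ^ r < K * e"
    using real_arch_pow_inv[of "K * e" "1 / 2"] K e by auto
  then have "(1 / 2 :: real) ^ Suc r < K * e"
    by (rule le_less_trans[rotated]) simp
  ultimately have "K * a (m0 + r * n) < K * e" by (meson le_less_trans)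
  then show ?thesis using K by auto
qed

text \<open>The level-2 cells with indices in {0, 1, 2} form the block of the cell with all indices
  1 and its neighbours; \<open>L 2 \<ge> 4\<close> keeps it in the unit cube. As the whole block is
  retained, crossings of the field shifted to its centre are chains of retained cells, of extent at
  least \<open>1 / S 2\<close> at every depth.\<close>

lemma crosses_imp_nontriv:
  fixes \<omega> :: "'d::finite node \<Rightarrow> bool"
  assumes open2: "\<And>k. (\<And>i. 0 \<le> k i \<and> k i \<le> 2) \<Longrightarrow> retained \<omega> 2 k"
    and cr: "\<And>m. \<exists>l\<ge>m. crosses (shift 2 (\<lambda>_. 1) \<omega>) l" and L2: "4 \<le> L 2"
  shows "nontriv \<omega>"
proof -
  let ?e = "(\<lambda>_. 1) :: 'd \<Rightarrow> int"
  have "\<not> totally_disconnected (lim_set \<omega>)"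
  proof (rule connected_limit[where c="1 / S 2"])
    fix m
    obtain l where l: "m \<le> l" "crosses (shift 2 ?e \<omega>) l" using cr by blast
    let ?W = "box3_cells (shift 2 ?e \<omega>) l"
    obtain a b i where ab: "a \<in> ?W" "chain ?W a b" "L l \<le> \<bar>a i - b i\<bar>"
      using l(2) unfolding crosses_def by blast
    let ?f = "sub l ?e"
    have f_in: "?f x \<in> open_cells \<omega> (2 + l)" if x: "x \<in> ?W" for x
    proof -
      have bx: "x \<in> box3 l" "retained (shift 2 ?e \<omega>) l x" using x by (auto simp: box3_cells_def)
      have "0 \<le> L l + x i \<and> L l + x i < L 2 * L l" for i
      proof -
        have "4 * L l \<le> L 2 * L l" using L2 by (intro mult_right_mono) auto
        moreover have "- L l \<le> x i" "x i < 2 * L l" using bx(1) by (auto simp: box3_def)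
        ultimately show ?thesis using L_pos(1)[of l] by linarith
      qed
      then have "?f x \<in> grid (2 + l)" unfolding grid_def sub_def power_add mult_1 mem_Collect_eq by (rule allI)
      moreover have "retained \<omega> 2 (\<lambda>i. 1 + anc l x i)"
      proof (rule open2)
        fix i
        have "anc l x \<in> box3 0" using anc_in_box3[of x 0 l] bx(1) by simp
        then have "- 1 \<le> anc l x i \<and> anc l x i < 2" by (simp add: box3_def)
        then show "0 \<le> 1 + anc l x i \<and> 1 + anc l x i \<le> 2" by linarith
      qed
      ultimately show ?thesis using bx(2) retained_shift[of \<omega> 2 l ?e x] by (simp add: open_cells_def)
    qed
    have "chain (open_cells \<omega> (2 + l)) (?f a) (?f b)"
      by (rule chain_map[OF ab(2) f_in]) (auto simp: adj_def sub_def)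
    then obtain K where K: "connected K" "K \<subseteq> level_set \<omega> (2 + l)" "cell (2 + l) (?f a) \<subseteq> K" "cell (2 + l) (?f b) \<subseteq> K"
      using chain_connected[of "open_cells \<omega> (2 + l)" "?f a" "?f b" "2 + l"] f_in[OF ab(1)]
      unfolding level_set_open_cells by blast
    have "L l * L 2 \<le> \<bar>a i - b i\<bar> * L 2" using ab(3) by (intro mult_right_mono) auto
    moreover have "L (2 + l) = L l * L 2" by (simp only: power_add mult.commute)
    moreover have "?f a i - ?f b i = a i - b i" by (simp add: sub_def)
    ultimately have "L (2 + l) \<le> \<bar>?f a i - ?f b i\<bar> * L 2" by (simp only:)
    from corner_dist_ge[of "2 + l" "?f a" i "?f b" 2, OF this]
    have "1 / S 2 \<le> dist (\<chi> i. real_of_int (?f a i) / S (2 + l)) (\<chi> i. real_of_int (?f b i) / S (2 + l))" .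
    moreover have "(\<chi> i. real_of_int (?f a i) / S (2 + l)) \<in> K" "(\<chi> i. real_of_int (?f b i) / S (2 + l)) \<in> K"
      using K(3,4) corner_in_cell by blast+
    moreover have "m \<le> 2 + l" using l(1) by simp
    ultimately show "\<exists>l\<ge>m. \<exists>K x y. connected K \<and> K \<subseteq> level_set \<omega> l \<and> x \<in> K \<and> y \<in> K \<and> 1 / S 2 \<le> dist x y"
      using K(1,2) by blast
  qed simp
  then show ?thesis by (simp only: not_totally_disconnected_lim_iff)
qed

text \<open>Crossings at infinitely many levels, combined with the independent event that the
  surrounding block is open, would produce a nontrivial component with positive probability. So they
  have probability 0, and continuity from above makes crossings at a single deep level
  unlikely.\<close>

lemma crosses_tendsto_0:
  assumes p: "0 < p" "p \<le> 1" and triv: "measure (BF p) {\<omega> :: 'd::finite node \<Rightarrow> bool. nontriv \<omega>} = 0"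
    and L2: "4 \<le> L 2" and e: "0 < e"
  shows "\<exists>m. measure (BF p) {\<omega> :: 'd node \<Rightarrow> bool. crosses \<omega> m} < e"
proof -
  let ?M = "BF p :: ('d node \<Rightarrow> bool) measure"
  interpret prob_space ?M by (rule prob_space_BF)
  let ?c = "(\<lambda>_. 1) :: 'd \<Rightarrow> int"
  let ?B = "{k :: 'd \<Rightarrow> int. \<forall>i. 0 \<le> k i \<and> k i \<le> 2}"
  \<comment> \<open>The cells of the block and their parents, hence levels 1 and 2 only. The field
    shifted by two levels is read from level 3 on, which gives the independence.\<close>
  let ?O = "\<Union>k\<in>?B. {(l, anc (2 - l) k) |l. l \<in> {1..2}}"
  let ?open = "\<lambda>\<omega> :: 'd node \<Rightarrow> bool. \<forall>x\<in>?O. \<omega> x = True"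
  let ?io = "\<lambda>\<omega> :: 'd node \<Rightarrow> bool. \<forall>m. \<exists>l\<ge>m. crosses \<omega> l"
  have "?B = PiE UNIV (\<lambda>_. {0..2})" by (auto simp: PiE_iff)
  then have "finite ?B" by (simp add: finite_PiE)
  then have finO: "finite ?O" by (intro finite_UN_I) auto
  have depO: "dep ?O ?open" by (auto simp: dep_def)
  have openS: "{\<omega>. ?open \<omega>} \<in> events" by (rule dep_finite_sets[OF depO finO])
  have ioS: "{\<omega>. ?io \<omega>} \<in> events"
  proof -
    have "{\<omega>. ?io \<omega>} = (\<Inter>m. \<Union>l\<in>{m..}. {\<omega>. crosses \<omega> l})" by auto
    also have "\<dots> \<in> events" using crosses_sets by (intro sets.countable_INT' sets.countable_UN') auto
    finally show ?thesis .
  qed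
  have depio: "dep {(l, j). 1 \<le> l} ?io"
  proof (rule depI)
    fix \<omega> \<omega>' :: "'d node \<Rightarrow> bool" assume *: "\<And>x. x \<in> {(l, j). 1 \<le> l} \<Longrightarrow> \<omega> x = \<omega>' x"
    have "crosses \<omega> l = crosses \<omega>' l" for l
      by (rule depD[OF dep_crosses], rule *) (auto simp: box3_nodes_def)
    then show "?io \<omega> = ?io \<omega>'" by simp
  qed
  have "prob {\<omega>. ?open \<omega> \<and> ?io (shift 2 ?c \<omega>)} = prob {\<omega>. ?open \<omega>} * prob {\<omega>. ?io (shift 2 ?c \<omega>)}"
    by (rule prob_conj_dep[OF openS prob_shift(2)[OF ioS] depO dep_shift[OF depio]])
       (auto simp: shift_idx_def)
  moreover have "prob {\<omega>. ?open \<omega>} = p ^ card ?O"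
    using prob_finite_cylinder[OF finO, of p "\<lambda>_. True"] p by simp
  moreover have "prob {\<omega>. ?open \<omega> \<and> ?io (shift 2 ?c \<omega>)} \<le> prob {\<omega>. nontriv \<omega>}"
  proof (rule finite_measure_mono[OF _ nontriv_sets], rule subsetI, rule CollectI)
    fix \<omega> assume "\<omega> \<in> {\<omega>. ?open \<omega> \<and> ?io (shift 2 ?c \<omega>)}"
    then have o: "?open \<omega>" "?io (shift 2 ?c \<omega>)" by blast+
    show "nontriv \<omega>"
    proof (rule crosses_imp_nontriv[OF _ _ L2])
      fix k :: "'d \<Rightarrow> int" assume "\<And>i. 0 \<le> k i \<and> k i \<le> 2"
      then have "{(l, anc (2 - l) k) |l. l \<in> {1..2}} \<subseteq> ?O" by blast
      then show "retained \<omega> 2 k" unfolding retained_def using o(1) by blast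
    qed (use o(2) in blast)
  qed
  ultimately have "p ^ card ?O * prob {\<omega>. ?io (shift 2 ?c \<omega>)} \<le> 0" using triv by simp
  moreover have "0 < p ^ card ?O" using p(1) by (rule zero_less_power)
  ultimately have "prob {\<omega>. ?io (shift 2 ?c \<omega>)} \<le> 0" by (meson mult_pos_pos not_le)
  then have io0: "prob {\<omega>. ?io \<omega>} = 0" using prob_shift(1)[OF ioS] by (simp add: measure_le_0_iff)
  define B where "B m = (\<Union>l\<in>{m..}. {\<omega> :: 'd node \<Rightarrow> bool. crosses \<omega> l})" for m
  have BS: "B m \<in> events" for m unfolding B_def using crosses_sets by (intro sets.countable_UN') auto
  have "decseq B" unfolding decseq_def B_def by (auto intro: order_trans)
  then have "(\<lambda>m. prob (B m)) \<longlonglongrightarrow> prob (\<Inter>m. B m)"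
    using BS by (intro finite_Lim_measure_decseq) auto
  moreover have "(\<Inter>m. B m) = {\<omega>. ?io \<omega>}" by (auto simp: B_def)
  ultimately have "(\<lambda>m. prob (B m)) \<longlonglongrightarrow> 0" using io0 by simp
  then have "eventually (\<lambda>m. prob (B m) < e) sequentially" using e by (rule order_tendstoD(2))
  then obtain m where m: "prob (B m) < e" unfolding eventually_sequentially by blast
  have "prob {\<omega>. crosses \<omega> m} \<le> prob (B m)"
    by (rule finite_measure_mono[OF _ BS]) (auto simp: B_def)
  then show ?thesis using m by (intro exI[of _ m]) simp
qed

lemma nontriv_imp_crosses:
  fixes \<omega> :: "'d::finite node \<Rightarrow> bool"
  assumes "nontriv \<omega>"
  shows "\<exists>n. \<forall>m. \<exists>k\<in>grid n. crosses (shift n k \<omega>) m"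
proof -
  obtain n where n: "\<And>m. n \<le> m \<Longrightarrow> linked \<omega> n m" using assms by (auto simp: nontriv_def)
  \<comment> \<open>One level more than in \<open>linked\<close> gains a factor N \<ge> 2, which
    supplies the distance \<open>2 * L m\<close> required by
    \<open>crosses_of_chain\<close>.\<close>
  have "\<exists>k\<in>grid (n + 1). crosses (shift (n + 1) k \<omega>) m" for m
  proof -
    let ?W = "open_cells \<omega> (n + 1 + m)"
    have "linked \<omega> n (n + 1 + m)" by (rule n) simp
    then obtain a b i where ab: "a \<in> ?W" "chain ?W a b" "L (n + 1 + m) \<le> \<bar>a i - b i\<bar> * L n"
      by (auto simp: linked_def)
    have "(int N * L m) * L n \<le> \<bar>a i - b i\<bar> * L n" using ab(3) by (simp add: power_add mult_ac)
    then have "int N * L m \<le> \<bar>a i - b i\<bar>" by (simp only: mult_L_less)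
    moreover have "2 * L m \<le> int N * L m" using N2 by (intro mult_right_mono) auto
    ultimately have far: "2 * L m \<le> \<bar>a i - b i\<bar>" by linarith
    have "crosses (shift (n + 1) (anc m a) \<omega>) m"
      by (rule crosses_of_chain[OF _ ab(2,1) far]) (simp add: open_cells_def)
    moreover have "anc m a \<in> grid (n + 1)" using ab(1) anc_in_grid by (auto simp: open_cells_def)
    ultimately show ?thesis by blast
  qed
  then show ?thesis by blast
qed

text \<open>For fixed \<open>n\<close> a nontrivial component needs, at every depth
  \<open>m\<close>, a crossing from one of the finitely many cubes of \<open>grid n\<close>. Their
  number is fixed, so one depth with a very unlikely crossing suffices.\<close>

lemma nontriv_null_of_crosses:
  assumes small: "\<And>e. 0 < e \<Longrightarrow> \<exists>m. measure (BF p) {\<omega> :: 'd::finite node \<Rightarrow> bool. crosses \<omega> m} < e"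
  shows "AE \<omega> in (BF p :: ('d node \<Rightarrow> bool) measure). \<not> nontriv \<omega>"
proof -
  let ?M = "BF p :: ('d node \<Rightarrow> bool) measure"
  interpret prob_space ?M by (rule prob_space_BF)
  have S: "{\<omega>. crosses (shift n k \<omega>) m} \<in> events" for n m and k :: "'d \<Rightarrow> int"
    by (rule prob_shift(2)[OF crosses_sets])
  have "AE \<omega> in ?M. \<forall>n. \<not> (\<forall>m. \<exists>k\<in>grid n. crosses (shift n k \<omega>) m)"
  proof (subst AE_all_countable, rule allI)
    fix n
    let ?C = "\<lambda>m. \<Union>k\<in>(grid n :: ('d \<Rightarrow> int) set). {\<omega>. crosses (shift n k \<omega>) m}"
    have C: "?C m \<in> events" for m by (intro sets.finite_UN finite_grid S)
    have inS: "(\<Inter>m. ?C m) \<in> events" using C by (intro sets.countable_INT') auto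
    have card_pos: "0 < real (card (grid n :: ('d \<Rightarrow> int) set))" using N2 by (simp add: card_grid)
    have "prob (\<Inter>m. ?C m) \<le> 0 + e" if e: "0 < e" for e
    proof -
      obtain m where m: "prob {\<omega> :: 'd node \<Rightarrow> bool. crosses \<omega> m} < e / real (card (grid n :: ('d \<Rightarrow> int) set))"
        using small[of "e / real (card (grid n :: ('d \<Rightarrow> int) set))"] e card_pos by auto
      have "prob (\<Inter>m. ?C m) \<le> prob (?C m)" by (rule finite_measure_mono[OF _ C]) auto
      also have "\<dots> \<le> (\<Sum>k\<in>(grid n :: ('d \<Rightarrow> int) set). prob {\<omega>. crosses (shift n k \<omega>) m})"
        by (rule finite_measure_subadditive_finite[OF finite_grid]) (use S in auto)
      also have "\<dots> = real (card (grid n :: ('d \<Rightarrow> int) set)) * prob {\<omega> :: 'd node \<Rightarrow> bool. crosses \<omega> m}"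
        by (simp add: prob_shift(1)[OF crosses_sets])
      also have "\<dots> \<le> e" using m card_pos by (simp add: field_simps)
      finally show ?thesis by simp
    qed
    then have "prob (\<Inter>m. ?C m) \<le> 0" by (rule field_le_epsilon)
    then have "(\<Inter>m. ?C m) \<in> null_sets ?M"
      using inS by (simp add: null_sets_def emeasure_eq_measure measure_le_0_iff)
    then show "AE \<omega> in ?M. \<not> (\<forall>m. \<exists>k\<in>grid n. crosses (shift n k \<omega>) m)"
      by (rule AE_I') auto
  qed
  then show ?thesis
    by eventually_elim (use nontriv_imp_crosses in blast)
qed

text \<open>The threshold \<open>1 / (2 * K)\<close> is the same for all parameters. It is met at
  \<open>p\<close> at some finite depth, by continuity also at some p' > p, and the recursion at p'
  then makes crossings arbitrarily unlikely.\<close>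

theorem totally_disconnected_right_open:
  assumes p: "0 < p" "p < 1" and triv: "measure (BF p) {\<omega> :: 'd::finite node \<Rightarrow> bool. nontriv \<omega>} = 0"
  shows "\<exists>p'>p. p' < 1 \<and> (AE \<omega> in (BF p' :: ('d node \<Rightarrow> bool) measure). totally_disconnected (lim_set \<omega>))"
proof -
  have N4: "2 * 2 \<le> int N * int N" using N2 by (intro mult_mono) auto
  then have L2: "4 \<le> L 2" by (simp add: power2_eq_square)
  have "4 * 2 \<le> L 2 * int N" using L2 N2 by (intro mult_mono) auto
  then have L3: "8 \<le> L 3" by (simp add: power2_eq_square power3_eq_cube)
  define K where "K = real (card (box3 3 \<times> box3 3 :: (('d \<Rightarrow> int) \<times> ('d \<Rightarrow> int)) set))"
  have "(\<lambda>_. 0) \<in> (box3 3 :: ('d \<Rightarrow> int) set)" by (simp add: box3_def)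
  then have "0 < card (box3 3 :: ('d \<Rightarrow> int) set)" using finite_box3 card_gt_0_iff by blast
  then have K: "0 < K" by (simp add: K_def card_cartesian_product)
  obtain m where "measure (BF p) {\<omega> :: 'd node \<Rightarrow> bool. crosses \<omega> m} < 1 / (2 * K)"
    using crosses_tendsto_0[OF p(1) _ triv L2, of "1 / (2 * K)"] p K by auto
  then obtain p' where p': "p < p'" "p' < 1" "measure (BF p') {\<omega> :: 'd node \<Rightarrow> bool. crosses \<omega> m} < 1 / (2 * K)"
    using prob_dep_finite_right_continuous[OF dep_crosses finite_box3_nodes, of p m] p by auto
  have "AE \<omega> in (BF p' :: ('d node \<Rightarrow> bool) measure). \<not> nontriv \<omega>"
  proof (rule nontriv_null_of_crosses)
    fix e :: real assume "0 < e"
    then show "\<exists>m. measure (BF p') {\<omega> :: 'd node \<Rightarrow> bool. crosses \<omega> m} < e"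
      using quadratic_recursion_tendsto_0[OF prob_crosses_two_scales[OF L3, where 'd='d, of p', folded K_def] _ K p'(3)]
      by simp
  qed
  then have "AE \<omega> in (BF p' :: ('d node \<Rightarrow> bool) measure). totally_disconnected (lim_set \<omega>)"
    by eventually_elim (use not_totally_disconnected_lim_iff in blast)
  then show ?thesis using p'(1,2) by (intro exI[of _ p'] conjI)
qed


section \<open>The cubes of the percolation measure\<close>

definition node_cube :: "'d::finite node \<Rightarrow> (real^'d) set" where
  "node_cube x = cell (fst x) (snd x)"

lemma cell_eq_iff:
  "cell n j = cell n' j' \<longleftrightarrow> n = n' \<and> j = (j' :: 'd::finite \<Rightarrow> int)"
proof
  assume eq: "cell n j = cell n' j'"
  have "cell n j \<noteq> {}" using corner_in_cell by blast
  then have v: "(\<chi> i. real_of_int (j i) / S n) = (\<chi> i. real_of_int (j' i) / S n')"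
      "(\<chi> i. (real_of_int (j i) + 1) / S n) = (\<chi> i. (real_of_int (j' i) + 1) / S n')"
    using eq unfolding cell_def eq_cbox by blast+
  then have c: "real_of_int (j i) / S n = real_of_int (j' i) / S n'"
      "(real_of_int (j i) + 1) / S n = (real_of_int (j' i) + 1) / S n'" for i
    unfolding vec_eq_iff by simp_all
  \<comment> \<open>In any coordinate the difference of upper and lower corner is the side length,
    which determines the level.\<close>
  have "1 / S n = 1 / S n'" using c[of undefined] by (simp add: add_divide_distrib)
  then have "S n = S n'" by simp
  then have n: "n = n'" using N2 by (subst (asm) power_inject_exp) auto
  have "j i = j' i" for i using c(1)[of i] n by simp
  then show "n = n' \<and> j = j'" using n by auto
qed simp

text \<open>The percolation measure is indexed by cubes as point sets, so no set may arise from two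
  nodes, not even from different levels.\<close>

lemma inj_node_cube: "inj node_cube"
  by (rule injI) (simp add: node_cube_def cell_eq_iff prod_eq_iff)

lemma level_cube_cell:
  assumes "\<forall>i. k i \<in> {1..N ^ n}"
  shows "level_cube N n k = cell n (\<lambda>i. int (k i) - 1)"
  using assms by (simp add: level_cube_def cell_def)

lemma level_cubes_eq: "level_cubes N n = cell n ` (grid n :: ('d::finite \<Rightarrow> int) set)"
proof (intro set_eqI iffI)
  fix Q :: "(real^'d) set" assume "Q \<in> level_cubes N n"
  then obtain k where k: "Q = level_cube N n k" "\<forall>i. k i \<in> {1..N ^ n}" by (auto simp: level_cubes_def)
  have "0 \<le> int (k i) - 1 \<and> int (k i) - 1 < L n" for i
  proof -
    have k': "1 \<le> k i" "k i \<le> N ^ n" using k(2) by auto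
    then have "int (k i) \<le> L n" by (metis of_nat_le_iff of_nat_power)
    then show ?thesis using k'(1) by linarith
  qed
  then have "(\<lambda>i. int (k i) - 1) \<in> grid n" by (simp add: grid_def)
  then show "Q \<in> cell n ` grid n" using level_cube_cell[OF k(2)] k(1) by blast
next
  fix Q :: "(real^'d) set" assume "Q \<in> cell n ` grid n"
  then obtain j where j: "j \<in> grid n" "Q = cell n j" by blast
  let ?k = "\<lambda>i. nat (j i + 1)"
  have b: "0 \<le> j i" "j i < L n" for i using j(1) by (auto simp: grid_def)
  have k: "\<forall>i. ?k i \<in> {1..N ^ n}"
  proof
    fix i
    have "j i + 1 \<le> int (N ^ n)" using b(2)[of i] by simp
    then show "?k i \<in> {1..N ^ n}" using b(1)[of i] by (simp add: nat_le_iff)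
  qed
  have "(\<lambda>i. int (?k i) - 1) = j" using b(1) by auto
  then have "level_cube N n ?k = Q" using level_cube_cell[OF k] j(2) by simp
  then show "Q \<in> level_cubes N n" using k unfolding level_cubes_def by blast
qed

lemma all_cubes_eq: "all_cubes N = node_cube ` (tree_nodes :: 'd::finite node set)"
  unfolding all_cubes_def level_cubes_eq by (force simp: node_cube_def tree_nodes_def)

lemma cell_subset_iff:
  "cell (m + r) j \<subseteq> cell m k \<longleftrightarrow> k = anc r (j :: 'd::finite \<Rightarrow> int)"
proof
  assume sub: "cell (m + r) j \<subseteq> cell m k"
  \<comment> \<open>The centre is used because, unlike a corner, it lies in only one cell of each
    coarser level.\<close>
  let ?x = "(\<chi> i. (real_of_int (j i) + 1 / 2) / S (m + r)) :: real^'d"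
  have "?x \<in> cell (m + r) j" by (simp add: mem_cell)
  then have x: "?x \<in> cell m k" using sub by blast
  have "k i = anc r j i" for i
  proof -
    have "?x $ i * S m = (real_of_int (j i) + 1 / 2) / S r" by (simp add: power_add)
    then have "real_of_int (k i) \<le> (real_of_int (j i) + 1 / 2) / S r"
        "(real_of_int (j i) + 1 / 2) / S r \<le> real_of_int (k i) + 1"
      using x unfolding mem_cell by metis+
    then have "real_of_int (k i) * S r \<le> real_of_int (j i) + 1 / 2"
        "real_of_int (j i) + 1 / 2 \<le> (real_of_int (k i) + 1) * S r"
      by (simp_all only: pos_le_divide_eq pos_divide_le_eq S_pos(1))
    then have "real_of_int (k i * L r) \<le> real_of_int (j i) + 1 / 2"
        "real_of_int (j i) + 1 / 2 \<le> real_of_int ((k i + 1) * L r)" by simp_all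
    then have "k i * L r \<le> j i" "j i < (k i + 1) * L r" by linarith+
    then have "k i * L r < (anc r j i + 1) * L r" "anc r j i * L r < (k i + 1) * L r"
      using anc_bounds(1)[of r j i] anc_bounds(2)[of j i r] by linarith+
    then show ?thesis by (simp only: mult_L_less)
  qed
  then show "k = anc r j" by (rule ext)
qed (use cell_anc in blast)

lemma retained_level_eq:
  fixes \<eta> :: "'d::finite node \<Rightarrow> bool"
  assumes agree: "\<And>x. x \<in> tree_nodes \<Longrightarrow> \<omega> (node_cube x) = \<eta> x" and n: "1 \<le> n"
  shows "retained_level N \<omega> n = level_set \<eta> n"
proof -
  have ag: "\<omega> (cell m j) = \<eta> (m, j)" if "1 \<le> m" "j \<in> grid m" for m j
    using agree[of "(m, j)"] that by (simp add: node_cube_def tree_nodes_def)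
  have "(\<omega> (cell n j) \<and> (\<forall>m\<in>{1..<n}. \<forall>R\<in>level_cubes N m. cell n j \<subseteq> R \<longrightarrow> \<omega> R)) \<longleftrightarrow> retained \<eta> n j"
    if j: "j \<in> grid n" for j
  proof -
    have "(\<forall>R\<in>level_cubes N m. cell n j \<subseteq> R \<longrightarrow> \<omega> R) \<longleftrightarrow> \<eta> (m, anc (n - m) j)" if m: "m \<in> {1..<n}" for m
    proof -
      have sub: "cell n j \<subseteq> cell m k \<longleftrightarrow> k = anc (n - m) j" for k
        using cell_subset_iff[of m "n - m" j k] m by simp
      have a: "anc (n - m) j \<in> grid m" using anc_in_grid[of j m "n - m"] j m by simp
      then show ?thesis unfolding level_cubes_eq using sub ag[of m] m by auto
    qed
    moreover have "{1..n} = insert n {1..<n}" using n by auto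
    ultimately show ?thesis using ag[OF n j] unfolding retained_def by auto
  qed
  then show ?thesis
    unfolding retained_level_def level_set_def level_cubes_eq by blast
qed

lemma limit_set_eq:
  fixes \<eta> :: "'d::finite node \<Rightarrow> bool"
  assumes "\<And>x. x \<in> tree_nodes \<Longrightarrow> \<omega> (node_cube x) = \<eta> x"
  shows "limit_set N \<omega> = lim_set \<eta>"
proof -
  have "limit_set N \<omega> = (\<Inter>n\<in>{1..}. level_set \<eta> n)"
    unfolding limit_set_def by (intro INF_cong refl retained_level_eq assms) auto
  also have "\<dots> = lim_set \<eta>"
    unfolding lim_set_def
  proof (rule antisym)
    show "(\<Inter>n\<in>{1..}. level_set \<eta> n) \<subseteq> (\<Inter>n. level_set \<eta> n)"
    proof (rule INT_greatest)
      fix n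
      have "(\<Inter>n\<in>{1..}. level_set \<eta> n) \<subseteq> level_set \<eta> (Suc n)" by (rule INT_lower) simp
      also have "\<dots> \<subseteq> level_set \<eta> n" by (rule level_set_antimono) simp
      finally show "(\<Inter>n\<in>{1..}. level_set \<eta> n) \<subseteq> level_set \<eta> n" .
    qed
  qed blast
  finally show ?thesis .
qed

section \<open>Transfer between the lattice field and the percolation measure\<close>

lemma lim_set_cong:
  fixes \<eta> \<eta>' :: "'d::finite node \<Rightarrow> bool"
  assumes "\<And>x. x \<in> tree_nodes \<Longrightarrow> \<eta> x = \<eta>' x"
  shows "lim_set \<eta> = lim_set \<eta>'"
proof -
  have "open_cells \<eta> m = open_cells \<eta>' m" for m
    by (rule depD[OF dep_open_cells]) (use assms in auto)
  then show ?thesis by (simp add: lim_set_def level_set_open_cells)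
qed

text \<open>One direction carries the conclusions to the given measure, and the equivalence
  translates the set whose supremum is the critical value. As \<open>P\<close> is arbitrary, its
  event need not be measurable: passing from the lattice field to the cubes forgets coordinates and
  goes through \<open>AE_BF_restrict\<close>, the converse is a pullback along a measurable
  map.\<close>

lemma AE_limit_set_iff:
  "(AE \<omega> in (percolation_measure N p :: ((real^'d::finite) set \<Rightarrow> bool) measure). P (limit_set N \<omega>)) \<longleftrightarrow>
   (AE \<eta> in (BF p :: ('d node \<Rightarrow> bool) measure). P (lim_set \<eta>))"
proof
  let ?B = "measure_pmf (bernoulli_pmf p)"
  let ?A = "all_cubes N :: (real^'d) set set"
  assume ae: "AE \<eta> in (BF p :: ('d node \<Rightarrow> bool) measure). P (lim_set \<eta>)"
  have "lim_set (restrict \<eta> tree_nodes) = lim_set \<eta>" for \<eta> :: "'d node \<Rightarrow> bool"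
    by (rule lim_set_cong) simp
  then have "AE \<eta> in (BF p :: ('d node \<Rightarrow> bool) measure). P (lim_set (restrict \<eta> tree_nodes))" using ae by simp
  then have ae': "AE \<eta> in PiM (tree_nodes :: 'd node set) (\<lambda>_. ?B). P (lim_set \<eta>)" by (rule AE_BF_restrict)
  have e: "distr (PiM ?A (\<lambda>_. ?B)) (PiM tree_nodes (\<lambda>_. ?B)) (\<lambda>\<omega>. \<lambda>x\<in>tree_nodes. \<omega> (node_cube x)) =
      PiM (tree_nodes :: 'd node set) (\<lambda>_. ?B)"
    by (rule distr_PiM_reindex) (auto simp: measure_pmf.prob_space_axioms all_cubes_eq intro: inj_on_subset[OF inj_node_cube])
  have "AE \<eta> in distr (PiM ?A (\<lambda>_. ?B)) (PiM tree_nodes (\<lambda>_. ?B)) (\<lambda>\<omega>. \<lambda>x\<in>tree_nodes. \<omega> (node_cube x)).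
      P (lim_set \<eta>)" unfolding e by (fact ae')
  then have ae2: "AE \<omega> in PiM ?A (\<lambda>_. ?B). P (lim_set (\<lambda>x\<in>tree_nodes. \<omega> (node_cube x)))"
    by (rule AE_distrD[rotated])
       (intro measurable_restrict measurable_component_singleton, auto simp: all_cubes_eq)
  have eq: "lim_set (\<lambda>x\<in>tree_nodes. \<omega> (node_cube x)) = limit_set N \<omega>" for \<omega> :: "(real^'d) set \<Rightarrow> bool"
    by (rule limit_set_eq[symmetric]) simp
  show "AE \<omega> in (percolation_measure N p :: ((real^'d) set \<Rightarrow> bool) measure). P (limit_set N \<omega>)"
    unfolding percolation_measure_def using ae2 by (rule eventually_mono) (simp only: eq)
next
  let ?B = "measure_pmf (bernoulli_pmf p)"
  let ?A = "all_cubes N :: (real^'d) set set"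
  let ?g = "inv node_cube :: (real^'d) set \<Rightarrow> 'd node"
  have g: "?g (node_cube x) = x" for x :: "'d node" by (rule inv_f_f[OF inj_node_cube])
  assume "AE \<omega> in (percolation_measure N p :: ((real^'d) set \<Rightarrow> bool) measure). P (limit_set N \<omega>)"
  then have ae: "AE \<omega> in PiM ?A (\<lambda>_. ?B). P (limit_set N \<omega>)" unfolding percolation_measure_def .
  have e: "distr (BF p) (PiM ?A (\<lambda>_. ?B)) (\<lambda>\<eta>. \<lambda>R\<in>?A. \<eta> (?g R)) = PiM ?A (\<lambda>_. ?B)"
    unfolding bernoulli_field_def
    by (rule distr_PiM_reindex) (auto simp: measure_pmf.prob_space_axioms all_cubes_eq g intro!: inj_onI)
  have "AE \<omega> in distr (BF p) (PiM ?A (\<lambda>_. ?B)) (\<lambda>\<eta>. \<lambda>R\<in>?A. \<eta> (?g R)). P (limit_set N \<omega>)"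
    unfolding e by (fact ae)
  then have ae2: "AE \<eta> in BF p. P (limit_set N (\<lambda>R\<in>?A. \<eta> (?g R)))"
    unfolding bernoulli_field_def
    by (rule AE_distrD[rotated]) (intro measurable_restrict measurable_component_singleton, auto)
  have eq: "limit_set N (\<lambda>R\<in>?A. \<eta> (?g R)) = lim_set \<eta>" for \<eta> :: "'d node \<Rightarrow> bool"
    by (rule limit_set_eq) (auto simp: all_cubes_eq g)
  show "AE \<eta> in (BF p :: ('d node \<Rightarrow> bool) measure). P (lim_set \<eta>)"
    using ae2 by (rule eventually_mono) (simp only: eq)
qed

text \<open>Puts the parameter 0 into the set whose supremum is the critical value, which yields
  \<open>0 \<le> p\<close>.\<close>

lemma AE_not_survives_0: "AE \<omega> in (BF 0 :: ('d::finite node \<Rightarrow> bool) measure). \<not> survives \<omega>"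
proof -
  let ?M = "BF 0 :: ('d node \<Rightarrow> bool) measure"
  interpret prob_space ?M by (rule prob_space_BF)
  have "AE \<omega> in ?M. \<not> retained \<omega> 1 j" for j :: "'d \<Rightarrow> int"
  proof -
    have "prob {\<omega>. retained \<omega> 1 j} = 0" using prob_retained[of 0 1 j] by simp
    then have "{\<omega>. retained \<omega> 1 j} \<in> null_sets ?M"
      using retained_sets by (simp add: null_sets_def emeasure_eq_measure)
    then show ?thesis by (rule AE_I') auto
  qed
  then have "AE \<omega> in ?M. \<forall>j. \<not> retained \<omega> 1 j" by (simp add: AE_all_countable)
  then show ?thesis by eventually_elim (auto simp: survives_def)
qed

lemma AE_lim_set_dims:
  assumes p: "0 < p" "p < 1" and surv: "measure (BF p) {\<omega> :: 'd::finite node \<Rightarrow> bool. survives \<omega>} > 0"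
    and nontriv: "measure (BF p) {\<omega> :: 'd node \<Rightarrow> bool. nontriv \<omega>} > 0"
  shows "AE \<omega> in (BF p :: ('d node \<Rightarrow> bool) measure). survives \<omega> \<longrightarrow>
    lim_set \<omega> \<subseteq> closure (connected_part (lim_set \<omega>)) \<and>
    lower_box_dim (lim_set \<omega>) = hausdorff_dim (lim_set \<omega>) \<and>
    upper_box_dim (lim_set \<omega>) = hausdorff_dim (lim_set \<omega>) \<and>
    hausdorff_dim (connected_part (lim_set \<omega>)) < hausdorff_dim (lim_set \<omega>)"
proof -
  let ?M = "BF p :: ('d node \<Rightarrow> bool) measure"
  have mean: "1 < p * real (N ^ CARD('d))" using mean_gt_1[OF p(1) _ surv] p by simp
  \<comment> \<open>There are countably many subcubes, so the zero-one law holds almost surely in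
    all of them at once.\<close>
  have "AE \<omega> in ?M. \<forall>n k. survives (shift n k \<omega>) \<longrightarrow> nontriv (shift n k \<omega>)"
    unfolding AE_all_countable using AE_shift[OF AE_nontriv[OF p(1) _ nontriv]] p by simp
  then show ?thesis
    using AE_dim_lim_set[OF p surv] AE_dim_connected_part[OF p mean]
  proof eventually_elim
    case (elim \<omega>)
    then show ?case using connected_part_dense[of \<omega>] by auto
  qed
qed

end

section \<open>Dust part and the final dimension statements\<close>

lemma box_dim_empty:
  "box_dim_exists ({} :: 'a::euclidean_space set)" "box_dim ({} :: 'a set) = 0"
  using box_dim_eqI[of "{} :: 'a set" 0] by (simp_all add: lower_box_dim_def upper_box_dim_def)

lemma connected_part_empty: "connected_part {} = {}"
  by (simp add: connected_part_def)

text \<open>Finite stability of the Hausdorff dimension: if both parts had smaller dimension, so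
  would their union.\<close>

lemma hausdorff_dim_dust_part:
  assumes "hausdorff_dim (connected_part C) < hausdorff_dim C"
  shows "hausdorff_dim (dust_part C) = hausdorff_dim C"
proof (rule ccontr)
  assume ne: "hausdorff_dim (dust_part C) \<noteq> hausdorff_dim C"
  have "hausdorff_dim (dust_part C) \<le> hausdorff_dim C"
    by (rule hausdorff_dim_mono) (auto simp: dust_part_def)
  then have "max (hausdorff_dim (connected_part C)) (hausdorff_dim (dust_part C)) < hausdorff_dim C"
    using assms ne by simp
  then obtain s where s: "max (hausdorff_dim (connected_part C)) (hausdorff_dim (dust_part C)) < ereal s"
      "ereal s < hausdorff_dim C" using ereal_dense2 by blast
  have "C = connected_part C \<union> dust_part C" by (auto simp: connected_part_def dust_part_def)
  then have "hausdorff_dim C \<le> ereal s"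
    using hausdorff_dim_Un_less[of "connected_part C" s "dust_part C"] s(1) by simp
  then show False using s(2) by simp
qed

theorem theorem1p1:
  fixes N :: nat and p :: real
  assumes "CARD('d::finite) \<ge> 2" and "N \<ge> 2"
    and "critical_p N TYPE('d) \<le> p" and "p < 1"
  shows "(AE \<omega> in (percolation_measure N p :: ((real^'d) set \<Rightarrow> bool) measure).
            box_dim_exists (connected_part (limit_set N \<omega>)) \<and>
            box_dim_exists (limit_set N \<omega>) \<and>
            box_dim (connected_part (limit_set N \<omega>)) = box_dim (limit_set N \<omega>) \<and>
            box_dim (limit_set N \<omega>) = hausdorff_dim (limit_set N \<omega>))
       \<and> (AE \<omega> in (percolation_measure N p :: ((real^'d) set \<Rightarrow> bool) measure).
            limit_set N \<omega> \<noteq> {} \<longrightarrow>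
              hausdorff_dim (connected_part (limit_set N \<omega>)) < hausdorff_dim (limit_set N \<omega>) \<and>
              hausdorff_dim (dust_part (limit_set N \<omega>)) = hausdorff_dim (limit_set N \<omega>))"
proof -
  interpret perc N by unfold_locales (rule assms(2))
  define T where "T = {q \<in> {0..1::real}. AE \<omega> in (percolation_measure N q :: ((real^'d) set \<Rightarrow> bool) measure).
    totally_disconnected (limit_set N \<omega>)}"
  have T: "T = {q \<in> {0..1}. AE \<omega> in (BF q :: ('d node \<Rightarrow> bool) measure). totally_disconnected (lim_set \<omega>)}"
    unfolding T_def AE_limit_set_iff by (rule refl)
  have pc: "q \<le> p" if "q \<in> T" for q
  proof -
    have "bdd_above T" unfolding T by (rule bdd_aboveI[of _ 1]) auto
    then have "q \<le> critical_p N TYPE('d)" using that unfolding critical_p_def T_def[symmetric] by (intro cSup_upper)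
    then show ?thesis using assms(3) by simp
  qed
  have "AE \<omega> in (BF 0 :: ('d node \<Rightarrow> bool) measure). totally_disconnected (lim_set \<omega>)"
    using AE_not_survives_0
    by eventually_elim (use lim_set_nonempty_iff in \<open>force simp: totally_disconnected_def\<close>)
  then have "0 \<in> T" by (simp add: T)
  then have p0: "0 \<le> p" by (rule pc)
  let ?M = "BF p :: ('d node \<Rightarrow> bool) measure"
  interpret P: prob_space ?M by (rule prob_space_BF)
  have main: "AE \<omega> in ?M. lim_set \<omega> \<noteq> {} \<longrightarrow>
    lim_set \<omega> \<subseteq> closure (connected_part (lim_set \<omega>)) \<and>
    lower_box_dim (lim_set \<omega>) = hausdorff_dim (lim_set \<omega>) \<and>
    upper_box_dim (lim_set \<omega>) = hausdorff_dim (lim_set \<omega>) \<and>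
    hausdorff_dim (connected_part (lim_set \<omega>)) < hausdorff_dim (lim_set \<omega>)"
  \<comment> \<open>If extinction is almost sure there is nothing to show. In the other case p = 0
    is excluded, which provides the positivity of \<open>p\<close> that the branching arguments
    use.\<close>
  proof (cases "measure ?M {\<omega>. survives \<omega>} = 0")
    case True
    then have "{\<omega>. survives \<omega>} \<in> null_sets ?M"
      using survives_sets by (simp add: null_sets_def P.emeasure_eq_measure)
    then have "AE \<omega> in ?M. \<not> survives \<omega>" by (rule AE_I') auto
    then show ?thesis by eventually_elim (simp add: lim_set_nonempty_iff)
  next
    case False
    then have surv: "0 < measure ?M {\<omega>. survives \<omega>}" by (simp add: zero_less_measure_iff)
    have "p \<noteq> 0"
    proof
      assume p_eq_0: "p = 0"
      have "AE \<omega> in ?M. \<omega> \<notin> {\<omega>. survives \<omega>}" using AE_not_survives_0[where 'd='d] by (simp only: p_eq_0 mem_Collect_eq)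
      then have "measure ?M {\<omega>. survives \<omega>} = 0" by (simp add: P.prob_eq_0[OF survives_sets])
      then show False using surv by simp
    qed
    then have pp: "0 < p" using p0 by simp
    \<comment> \<open>Otherwise some parameter beyond \<open>p\<close> would still be totally
      disconnected and exceed the supremum, although the critical value is at most
      \<open>p\<close>.\<close>
    have "measure ?M {\<omega>. nontriv \<omega>} \<noteq> 0"
    proof
      assume "measure ?M {\<omega>. nontriv \<omega>} = 0"
      then obtain p' where p': "p < p'" "p' < 1"
          "AE \<omega> in (BF p' :: ('d node \<Rightarrow> bool) measure). totally_disconnected (lim_set \<omega>)"
        using totally_disconnected_right_open[OF pp assms(4)] by blast
      then have "p' \<in> T" using pp by (simp add: T)
      then show False using pc[of p'] p'(1) by simp
    qed
    then have nt: "0 < measure ?M {\<omega>. nontriv \<omega>}" by (simp add: zero_less_measure_iff)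
    show ?thesis using AE_lim_set_dims[OF pp assms(4) surv nt] by (simp add: lim_set_nonempty_iff)
  qed
  show ?thesis
  proof (intro conjI AE_limit_set_iff[where P="\<lambda>C. box_dim_exists (connected_part C) \<and> box_dim_exists C \<and>
        box_dim (connected_part C) = box_dim C \<and> box_dim C = hausdorff_dim C", THEN iffD2]
      AE_limit_set_iff[where P="\<lambda>C. C \<noteq> {} \<longrightarrow> hausdorff_dim (connected_part C) < hausdorff_dim C \<and>
        hausdorff_dim (dust_part C) = hausdorff_dim C", THEN iffD2])
    show "AE \<omega> in ?M. box_dim_exists (connected_part (lim_set \<omega>)) \<and> box_dim_exists (lim_set \<omega>) \<and>
        box_dim (connected_part (lim_set \<omega>)) = box_dim (lim_set \<omega>) \<and>
        box_dim (lim_set \<omega>) = hausdorff_dim (lim_set \<omega>)"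
      using main
    proof eventually_elim
      case (elim \<omega>)
      let ?C = "lim_set \<omega>"
      show ?case
      proof (cases "?C = {}")
        \<comment> \<open>The equalities of dimensions are asserted without assuming survival; for
          the empty set both dimensions are 0.\<close>
        case True
        then show ?thesis by (simp add: connected_part_empty box_dim_empty hausdorff_dim_empty)
      next
        case False
        then have d: "?C \<subseteq> closure (connected_part ?C)" "lower_box_dim ?C = hausdorff_dim ?C"
            "upper_box_dim ?C = hausdorff_dim ?C" using elim by blast+
        have d': "lower_box_dim (connected_part ?C) = hausdorff_dim ?C" "upper_box_dim (connected_part ?C) = hausdorff_dim ?C"
          using box_dims_dense[OF connected_part_subset d(1)] d(2,3) by simp_all
        show ?thesis using box_dim_eqI[OF d(2,3)] box_dim_eqI[OF d'] by simp
      qed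
    qed
    show "AE \<omega> in ?M. lim_set \<omega> \<noteq> {} \<longrightarrow>
        hausdorff_dim (connected_part (lim_set \<omega>)) < hausdorff_dim (lim_set \<omega>) \<and>
        hausdorff_dim (dust_part (lim_set \<omega>)) = hausdorff_dim (lim_set \<omega>)"
      using main by eventually_elim (use hausdorff_dim_dust_part in blast)
  qed
qed

end
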